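(* Let $G$ be a torsion-free, one-ended hyperbolic group which admits a cyclic splitting with a free non-abelian vertex group. Then $V_{1}^{hyp}(G)>0$.
   Context: Actions on trees are without inversions. A splitting $(\mathcal{G},Y)$ of a group $G$ is a decomposition of $G$ as the fundamental group of a graph of groups, equivalently an action of $G$ on the Bass–Serre tree $X$ with $Y=X/G$. It is cyclic if every edge group is infinite cyclic. An element is elliptic if it fixes a vertex of $X$ and hyperbolic otherwise. $r(Y)$ is the rank of the free group $\pi_1(Y)$. A vertex $v$ of $Y$ is degenerate if there is an edge $e$ incident to $v$ with $G_e=G_v$; $V_{ndeg}(Y)$ is the set of non-degenerate vertices. The splitting is reduced if for every edge $e$ that is not a loop, $G_e$ is properly contained in the vertex groups of both endpoints. Given a function $\varphi\ge 0$ on vertex groups, the weighted complexity of a splitting of a finitely generated group $G$ is $r(Y)+\sum_{v\in V_{ndeg}(Y)}(1+\varphi(G_v))$ if $G$ contains hyperbolic elements, and $1$ if every element of $G$ is elliptic; it is computed on the minimal invariant subtree. With $\varphi=0$ it is called the complexity. $N_G$ is the set of normal subgroups of finite index of $G$ ordered by reverse inclusion. For a function $C$ on finite index subgroups, $\varlimsup_{H\in N_G}\frac{C(H)}{[G:H]}$ is the supremum of all $\ell$ such that $(C(K)/[G:K])_{K\in\mathcal K}\to\ell$ for some cofinal subset $\mathcal K\subseteq N_G$. $V_{fin}(\Gamma)=\varlimsup_{H\in N_\Gamma}\frac{C_{max}(H)}{[\Gamma:H]}$, where $C_{max}(H)$ is the maximal complexity of $H$ over all reduced splittings of $H$ with finite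 edge groups (no restriction on vertex groups). For a one-ended torsion-free hyperbolic group $G$, $V_1^{hyp}(G)=\varlimsup_{H\in N_G}\frac{C^{\varphi}_{max}(H)}{[G:H]}$, where $C^{\varphi}_{max}(H)$ is the maximal weighted complexity of $H$ over all reduced cyclic splittings of $H$, with $\varphi(H_v)=V_{fin}(H_v)$ for finitely presented (torsion-free) vertex groups $H_v$ and $\varphi(H_v)=0$ otherwise. (Cyclic splittings of such groups are acylindrical, so no acylindricity constant is imposed.) *)

theory Defs
  imports
    "HOL-Algebra.Group_Action"
    "HOL-Algebra.Elementary_Groups"
    "HOL-Analysis.Infinite_Sum"
    "Graph_Theory.Digraph_Component"
begin

section \<open>Words, presentations, free groups, rank\<close>

text \<open>Words over an alphabet \<open>A\<close> with formal inverse \<open>\<iota>\<close>, modulo free cancellation and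
  deletion of relators from \<open>R\<close>.\<close>

inductive word_step :: "'x set \<Rightarrow> ('x \<Rightarrow> 'x) \<Rightarrow> 'x list set \<Rightarrow> 'x list \<Rightarrow> 'x list \<Rightarrow> bool"
  for A \<iota> R where
  cancel: "x \<in> A \<Longrightarrow> word_step A \<iota> R (u @ [x, \<iota> x] @ v) (u @ v)"
| relator: "r \<in> R \<Longrightarrow> word_step A \<iota> R (u @ r @ v) (u @ v)"

definition word_eq :: "'x set \<Rightarrow> ('x \<Rightarrow> 'x) \<Rightarrow> 'x list set \<Rightarrow> 'x list \<Rightarrow> 'x list \<Rightarrow> bool" where
  "word_eq A \<iota> R = equivclp (word_step A \<iota> R)"

text \<open>A letter \<open>(s, True)\<close> stands for \<open>s\<close>, and \<open>(s, False)\<close> for its inverse.\<close>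

definition letter_value :: "('a, 'b) monoid_scheme \<Rightarrow> 'a \<times> bool \<Rightarrow> 'a" where
  "letter_value G x = (if snd x then fst x else inv\<^bsub>G\<^esub> fst x)"

definition word_value :: "('a, 'b) monoid_scheme \<Rightarrow> ('a \<times> bool) list \<Rightarrow> 'a" where
  "word_value G w = foldr (\<lambda>x y. letter_value G x \<otimes>\<^bsub>G\<^esub> y) w \<one>\<^bsub>G\<^esub>"

definition generates :: "('a, 'b) monoid_scheme \<Rightarrow> 'a set \<Rightarrow> bool" where
  "generates G S \<longleftrightarrow> S \<subseteq> carrier G \<and> generate G S = carrier G"

text \<open>\<open>G\<close> has the presentation with generators \<open>S\<close> and relators \<open>R\<close>.\<close>

definition presented_by :: "('a, 'b) monoid_scheme \<Rightarrow> 'a set \<Rightarrow> ('a \<times> bool) list set \<Rightarrow> bool" where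
  "presented_by G S R \<longleftrightarrow>
     generates G S \<and>
     (\<forall>r\<in>R. r \<in> lists (S \<times> UNIV) \<and> word_value G r = \<one>\<^bsub>G\<^esub>) \<and>
     (\<forall>w \<in> lists (S \<times> UNIV). word_value G w = \<one>\<^bsub>G\<^esub> \<longrightarrow>
        word_eq (S \<times> UNIV) (\<lambda>(s, b). (s, \<not> b)) R w [])"

definition free_group :: "('a, 'b) monoid_scheme \<Rightarrow> bool" where
  "free_group G \<longleftrightarrow> group G \<and> (\<exists>S. presented_by G S {})"

definition finitely_presented :: "('a, 'b) monoid_scheme \<Rightarrow> bool" where
  "finitely_presented G \<longleftrightarrow> group G \<and> (\<exists>S R. finite S \<and> finite R \<and> presented_by G S R)"

text \<open>The least number of generators, infinite if there is no finite generating set.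
  For a free group this is the cardinality of a basis.\<close>

definition group_rank :: "('a, 'b) monoid_scheme \<Rightarrow> ennreal" where
  "group_rank G = (INF S \<in> {S. finite S \<and> generates G S}. of_nat (card S))"

definition torsion_free :: "('a, 'b) monoid_scheme \<Rightarrow> bool" where
  "torsion_free G \<longleftrightarrow>
     (\<forall>g \<in> carrier G. \<forall>n::nat. n > 0 \<longrightarrow> g [^]\<^bsub>G\<^esub> n = \<one>\<^bsub>G\<^esub> \<longrightarrow> g = \<one>\<^bsub>G\<^esub>)"

definition infinite_cyclic :: "('a, 'b) monoid_scheme \<Rightarrow> bool" where
  "infinite_cyclic G \<longleftrightarrow> group G \<and> cyclic_group G \<and> infinite (carrier G)"

section \<open>Cayley graph: ends and hyperbolicity\<close>

definition cayley_adj :: "('a, 'b) monoid_scheme \<Rightarrow> 'a set \<Rightarrow> ('a \<times> 'a) set" where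
  "cayley_adj G S = {(g, g \<otimes>\<^bsub>G\<^esub> letter_value G x) | g x. g \<in> carrier G \<and> x \<in> S \<times> UNIV}"

definition word_dist :: "('a, 'b) monoid_scheme \<Rightarrow> 'a set \<Rightarrow> 'a \<Rightarrow> 'a \<Rightarrow> nat" where
  "word_dist G S g h = (LEAST n. (g, h) \<in> cayley_adj G S ^^ n)"

text \<open>Being one-ended and being hyperbolic do not depend on the finite generating set.\<close>

definition one_ended :: "('a, 'b) monoid_scheme \<Rightarrow> bool" where
  "one_ended G \<longleftrightarrow> (\<exists>S. finite S \<and> generates G S \<and>
     (\<forall>K. finite K \<and> K \<subseteq> carrier G \<longrightarrow>
        (\<exists>!C. C \<in> (carrier G - K) // (Restr (cayley_adj G S) (carrier G - K))\<^sup>* \<and> infinite C)))"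

definition gromov_product :: "('x \<Rightarrow> 'x \<Rightarrow> real) \<Rightarrow> 'x \<Rightarrow> 'x \<Rightarrow> 'x \<Rightarrow> real" where
  "gromov_product d w x y = (d x w + d y w - d x y) / 2"

definition hyperbolic_group :: "('a, 'b) monoid_scheme \<Rightarrow> bool" where
  "hyperbolic_group G \<longleftrightarrow> group G \<and> (\<exists>S \<delta>. finite S \<and> generates G S \<and>
     (\<forall>w \<in> carrier G. \<forall>x \<in> carrier G. \<forall>y \<in> carrier G. \<forall>z \<in> carrier G.
        let p = gromov_product (\<lambda>g h. real (word_dist G S g h)) w
        in p x z \<ge> min (p x y) (p y z) - \<delta>))"

section \<open>Trees, actions and splittings\<close>

text \<open>Graphs are graphs in the sense of Serre: every edge is a pair of mutually inverse arcs
  exchanged by a fixed-point free involution.\<close>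

definition reduced_walk :: "('e \<Rightarrow> 'e) \<Rightarrow> 'e list \<Rightarrow> bool" where
  "reduced_walk \<iota> p \<longleftrightarrow> (\<forall>i. Suc i < length p \<longrightarrow> p ! Suc i \<noteq> \<iota> (p ! i))"

definition is_tree :: "('v, 'e) pre_digraph \<Rightarrow> ('e \<Rightarrow> 'e) \<Rightarrow> bool" where
  "is_tree X \<iota> \<longleftrightarrow> bidirected_digraph X \<iota> \<and> strongly_connected X \<and>
     (\<forall>v p. pre_digraph.awalk X v p v \<and> reduced_walk \<iota> p \<longrightarrow> p = [])"

record ('a, 'v, 'e) graph_action =
  space :: "('v, 'e) pre_digraph"
  flip :: "'e \<Rightarrow> 'e"
  vact :: "'a \<Rightarrow> 'v \<Rightarrow> 'v"
  eact :: "'a \<Rightarrow> 'e \<Rightarrow> 'e"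

abbreviation vertices :: "('a, 'v, 'e) graph_action \<Rightarrow> 'v set" where
  "vertices X \<equiv> verts (space X)"

abbreviation edges :: "('a, 'v, 'e) graph_action \<Rightarrow> 'e set" where
  "edges X \<equiv> arcs (space X)"

text \<open>A splitting of \<open>G\<close>: an action without inversions on the Bass--Serre tree.\<close>

definition splitting :: "('a, 'b) monoid_scheme \<Rightarrow> ('a, 'v, 'e) graph_action \<Rightarrow> bool" where
  "splitting G X \<longleftrightarrow>
     group G \<and> is_tree (space X) (flip X) \<and>
     group_action G (vertices X) (vact X) \<and> group_action G (edges X) (eact X) \<and>
     (\<forall>g \<in> carrier G. \<forall>e \<in> edges X.
        tail (space X) (eact X g e) = vact X g (tail (space X) e) \<and>
        head (space X) (eact X g e) = vact X g (head (space X) e) \<and>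
        eact X g (flip X e) = flip X (eact X g e) \<and>
        eact X g e \<noteq> flip X e)"

abbreviation vertex_group :: "('a, 'b) monoid_scheme \<Rightarrow> ('a, 'v, 'e) graph_action \<Rightarrow> 'v \<Rightarrow> 'a set" where
  "vertex_group G X v \<equiv> stabilizer G (vact X) v"

abbreviation edge_group :: "('a, 'b) monoid_scheme \<Rightarrow> ('a, 'v, 'e) graph_action \<Rightarrow> 'e \<Rightarrow> 'a set" where
  "edge_group G X e \<equiv> stabilizer G (eact X) e"

definition cyclic_splitting :: "('a, 'b) monoid_scheme \<Rightarrow> ('a, 'v, 'e) graph_action \<Rightarrow> bool" where
  "cyclic_splitting G X \<longleftrightarrow> splitting G X \<and>
     (\<forall>e \<in> edges X. infinite_cyclic (G\<lparr>carrier := edge_group G X e\<rparr>))"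

definition finite_edge_splitting :: "('a, 'b) monoid_scheme \<Rightarrow> ('a, 'v, 'e) graph_action \<Rightarrow> bool" where
  "finite_edge_splitting G X \<longleftrightarrow> splitting G X \<and> (\<forall>e \<in> edges X. finite (edge_group G X e))"

definition quotient_graph ::
    "('a, 'b) monoid_scheme \<Rightarrow> ('a, 'v, 'e) graph_action \<Rightarrow> ('v set, 'e set) pre_digraph" where
  "quotient_graph G X =
     \<lparr>verts = orbits G (vertices X) (vact X), arcs = orbits G (edges X) (eact X),
      tail = image (tail (space X)), head = image (head (space X))\<rparr>"

definition quotient_flip ::
    "('a, 'b) monoid_scheme \<Rightarrow> ('a, 'v, 'e) graph_action \<Rightarrow> 'e set \<Rightarrow> 'e set" where
  "quotient_flip G X E = (if E \<in> arcs (quotient_graph G X) then flip X ` E else E)"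

text \<open>An edge of the tree maps to a loop of the quotient iff its endpoints share an orbit.\<close>

definition reduced_splitting :: "('a, 'b) monoid_scheme \<Rightarrow> ('a, 'v, 'e) graph_action \<Rightarrow> bool" where
  "reduced_splitting G X \<longleftrightarrow> splitting G X \<and>
     (\<forall>e \<in> edges X.
        orbit G (vact X) (tail (space X) e) \<noteq> orbit G (vact X) (head (space X) e) \<longrightarrow>
        edge_group G X e \<subset> vertex_group G X (tail (space X) e) \<and>
        edge_group G X e \<subset> vertex_group G X (head (space X) e))"

definition elliptic :: "('a, 'v, 'e) graph_action \<Rightarrow> 'a \<Rightarrow> bool" where
  "elliptic X g \<longleftrightarrow> (\<exists>v \<in> vertices X. vact X g v = v)"

definition restrict_action :: "('a, 'v, 'e) graph_action \<Rightarrow> 'v set \<Rightarrow> ('a, 'v, 'e) graph_action" where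
  "restrict_action X W =
     \<lparr>space = induce_subgraph (space X) W,
      flip = (\<lambda>e. if e \<in> arcs (induce_subgraph (space X) W) then flip X e else e),
      vact = (\<lambda>g. restrict (vact X g) W),
      eact = (\<lambda>g. restrict (eact X g) (arcs (induce_subgraph (space X) W)))\<rparr>"

text \<open>A subtree of a tree is induced by its vertex set. If there is a hyperbolic element, then
  the intersection of all invariant subtrees is the minimal invariant subtree.\<close>

definition invariant_subtree ::
    "('a, 'b) monoid_scheme \<Rightarrow> ('a, 'v, 'e) graph_action \<Rightarrow> 'v set \<Rightarrow> bool" where
  "invariant_subtree G X W \<longleftrightarrow> W \<subseteq> vertices X \<and>
     is_tree (space (restrict_action X W)) (flip (restrict_action X W)) \<and>
     (\<forall>g \<in> carrier G. vact X g ` W = W)"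

definition minimal_subtree ::
    "('a, 'b) monoid_scheme \<Rightarrow> ('a, 'v, 'e) graph_action \<Rightarrow> ('a, 'v, 'e) graph_action" where
  "minimal_subtree G X = restrict_action X (\<Inter>{W. invariant_subtree G X W})"

text \<open>Both orientations of an edge are arcs, so arcs starting at \<open>v\<close> account for all edges
  incident to \<open>v\<close>. In the quotient, a loop gives two arcs at \<open>v\<close>, one for each inclusion of
  the edge group.\<close>

definition degenerate :: "('a, 'b) monoid_scheme \<Rightarrow> ('a, 'v, 'e) graph_action \<Rightarrow> 'v \<Rightarrow> bool" where
  "degenerate G X v \<longleftrightarrow>
     (\<exists>e \<in> edges X. tail (space X) e = v \<and> edge_group G X e = vertex_group G X v)"

definition nondegenerate_vertices ::
    "('a, 'b) monoid_scheme \<Rightarrow> ('a, 'v, 'e) graph_action \<Rightarrow> 'v set set" where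
  "nondegenerate_vertices G X =
     {orbit G (vact X) v | v. v \<in> vertices X \<and> \<not> degenerate G X v}"

section \<open>Fundamental group of a graph\<close>

text \<open>Closed walks at \<open>y\<close> modulo cancellation of backtracks. Allowing non-walks as
  intermediate words does not change the equivalence, since reduced forms are unique.\<close>

definition homotopy_class ::
    "('v, 'e) pre_digraph \<Rightarrow> ('e \<Rightarrow> 'e) \<Rightarrow> 'v \<Rightarrow> 'e list \<Rightarrow> 'e list set" where
  "homotopy_class Y \<iota> y p = {q. pre_digraph.awalk Y y q y \<and> word_eq (arcs Y) \<iota> {} p q}"

definition fundamental_group ::
    "('v, 'e) pre_digraph \<Rightarrow> ('e \<Rightarrow> 'e) \<Rightarrow> 'v \<Rightarrow> 'e list set monoid" where
  "fundamental_group Y \<iota> y =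
     \<lparr>carrier = {homotopy_class Y \<iota> y p | p. pre_digraph.awalk Y y p y},
      monoid.mult = (\<lambda>A B. \<Union>p\<in>A. \<Union>q\<in>B. homotopy_class Y \<iota> y (p @ q)),
      monoid.one = homotopy_class Y \<iota> y []\<rparr>"

definition graph_rank :: "('v, 'e) pre_digraph \<Rightarrow> ('e \<Rightarrow> 'e) \<Rightarrow> ennreal" where
  "graph_rank Y \<iota> = group_rank (fundamental_group Y \<iota> (SOME y. y \<in> verts Y))"

section \<open>Weighted complexity\<close>

text \<open>The weight \<open>\<phi>\<close> is meant to be invariant under conjugation, so that the choice of a
  representative of each orbit is immaterial.\<close>

definition complexity ::
    "('a set \<Rightarrow> ennreal) \<Rightarrow> ('a, 'b) monoid_scheme \<Rightarrow> ('a, 'v, 'e) graph_action \<Rightarrow> ennreal" where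
  "complexity \<phi> G X =
     (if \<forall>g \<in> carrier G. elliptic X g then 1
      else let T = minimal_subtree G X in
        graph_rank (quotient_graph G T) (quotient_flip G T) +
        (\<Sum>\<^sub>\<infinity>V \<in> nondegenerate_vertices G T. 1 + \<phi> (vertex_group G T (SOME v. v \<in> V))))"

text \<open>The maxima below range over trees with vertices and arcs in \<open>nat\<close>. Up to isomorphism
  these are all reduced splittings of a finitely generated group \<open>H\<close>: the vertices and edges
  outside the minimal subtree would violate reducedness, and the minimal subtree has finite
  quotient, hence is countable.\<close>

definition C_max_fin :: "('a, 'b) monoid_scheme \<Rightarrow> ennreal" where
  "C_max_fin H =
     (SUP X \<in> {X :: ('a, nat, nat) graph_action. reduced_splitting H X \<and> finite_edge_splitting H X}.
        complexity (\<lambda>_. 0) H X)"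

definition C_max_cyclic :: "('a set \<Rightarrow> ennreal) \<Rightarrow> ('a, 'b) monoid_scheme \<Rightarrow> ennreal" where
  "C_max_cyclic \<phi> H =
     (SUP X \<in> {X :: ('a, nat, nat) graph_action. reduced_splitting H X \<and> cyclic_splitting H X}.
        complexity \<phi> H X)"

section \<open>Limits over normal subgroups of finite index\<close>

definition fin_index_normal :: "('a, 'b) monoid_scheme \<Rightarrow> 'a set set" where
  "fin_index_normal G = {N. N \<lhd> G \<and> finite (rcosets\<^bsub>G\<^esub> N)}"

definition index :: "('a, 'b) monoid_scheme \<Rightarrow> 'a set \<Rightarrow> nat" where
  "index G H = card (rcosets\<^bsub>G\<^esub> H)"

definition cofinal_family :: "('a, 'b) monoid_scheme \<Rightarrow> 'a set set \<Rightarrow> bool" where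
  "cofinal_family G \<K> \<longleftrightarrow> \<K> \<subseteq> fin_index_normal G \<and> (\<forall>N \<in> fin_index_normal G. \<exists>K \<in> \<K>. K \<subseteq> N)"

text \<open>Convergence along this filter is convergence of nets indexed by \<open>\<K>\<close>, directed by
  reverse inclusion.\<close>

definition deep_subgroups :: "'a set set \<Rightarrow> 'a set filter" where
  "deep_subgroups \<K> = (INF K\<^sub>0 \<in> \<K>. principal {K \<in> \<K>. K \<subseteq> K\<^sub>0})"

definition normal_limsup :: "('a, 'b) monoid_scheme \<Rightarrow> ('a set \<Rightarrow> ennreal) \<Rightarrow> ennreal" where
  "normal_limsup G C =
     Sup {l. \<exists>\<K>. cofinal_family G \<K> \<and>
                 ((\<lambda>K. C K / of_nat (index G K)) \<longlongrightarrow> l) (deep_subgroups \<K>)}"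

definition V_fin :: "('a, 'b) monoid_scheme \<Rightarrow> ennreal" where
  "V_fin G = normal_limsup G (\<lambda>H. C_max_fin (G\<lparr>carrier := H\<rparr>))"

definition hyp_weight :: "('a, 'b) monoid_scheme \<Rightarrow> 'a set \<Rightarrow> ennreal" where
  "hyp_weight G K =
     (if finitely_presented (G\<lparr>carrier := K\<rparr>) then V_fin (G\<lparr>carrier := K\<rparr>) else 0)"

definition V1_hyp :: "('a, 'b) monoid_scheme \<Rightarrow> ennreal" where
  "V1_hyp G = normal_limsup G (\<lambda>H. C_max_cyclic (hyp_weight G) (G\<lparr>carrier := H\<rparr>))"

end

theory Submission
  imports Defs
begin

text \<open>
  Let \<open>S\<close> be a basis of the free vertex group \<open>G\<^sub>v\<close>. It is finite because \<open>G\<close> and the edge groups are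
  finitely generated, and \<open>G\<^sub>v \<noteq> G\<close> because a free group of rank at least 2 is not one-ended. For a
  normal subgroup \<open>N\<close> of finite index, the orbit of \<open>v\<close> splits into \<open>[G : N G\<^sub>v]\<close> orbits of \<open>N\<close>, whose
  stabilizers are conjugate to \<open>N \<inter> G\<^sub>v\<close>. Collapsing edges of the tree makes it reduced for \<open>N\<close>
  without changing these stabilizers: they are not abelian, so they are contained in no edge group.
  For the same reason these orbits lie in the minimal subtree and are non-degenerate. Finally
  \<open>V\<^sub>f\<^sub>i\<^sub>n(N \<inter> G\<^sub>v) \<ge> [G\<^sub>v : N \<inter> G\<^sub>v]\<close>: a subgroup of index \<open>k\<close> in a free group of rank at least 2 acts
  freely on the Cayley tree, and collapsing a maximal forest of the quotient leaves a rose with at least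
  \<open>k\<close> petals. Hence the weighted complexity of \<open>N\<close> is at least \<open>[G : N]\<close>.
\<close>

section \<open>Words\<close>

text \<open>By convention the complexity is 1 if every element is elliptic, so the sum over
  non-degenerate vertices counts only once a hyperbolic element is found. This is what
  \<open>G_v \<noteq> G\<close> provides: the orbit of \<open>v\<close> has a second vertex, and two
  vertex groups contained in no edge group yield a hyperbolic product. A second obstacle is the
  range of the maxima: reduced trees with vertices and edges in \<open>nat\<close>, whereas the
  given tree may be uncountable with infinite quotient. Hence a countable subtree with finitely many
  orbits is chosen before collapsing. A collapse may merge vertices and enlarge stabilizers; the
  forests used keep in every component a vertex that carries the whole stabilizer of that component,
  and near the orbit of \<open>v\<close> this vertex can only be the orbit point itself. The weight
  vanishes unless the vertex group is finitely presented, so \<open>N \<inter> G_v\<close> has to be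
  given a finite presentation as well. Finally, the bound holds for every \<open>N\<close>, but the
  limsup only sees convergent families, so a cofinal convergent family must be produced; both
  \<open>V_fin\<close> and \<open>V1_hyp\<close> are bounded in this way.\<close>

abbreviation linv :: "'s \<times> bool \<Rightarrow> 's \<times> bool" where
  "linv \<equiv> \<lambda>(s, b). (s, \<not> b)"

lemma linv_linv [simp]: "linv (linv x) = x"
  by (cases x) auto

lemma linv_neq [simp]: "linv x \<noteq> x" "x \<noteq> linv x"
  by (cases x; auto)+

lemma linv_eq_iff [simp]: "linv x = linv y \<longleftrightarrow> x = y"
  by (cases x; cases y) auto

lemma linv_in [simp]: "linv x \<in> S \<times> UNIV \<longleftrightarrow> x \<in> S \<times> UNIV"
  by (cases x) auto

lemma fst_linv [simp]: "fst (linv x) = fst x"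
  by (cases x) auto

lemma equivclp_invariant:
  assumes "equivclp R x y" "\<And>x y. R x y \<Longrightarrow> f x = f y"
  shows "f x = f y"
  using assms(1) by (induction rule: equivclp_induct) (use assms(2) in metis)+

lemma word_value_Nil [simp]: "word_value G [] = \<one>\<^bsub>G\<^esub>"
  by (simp add: word_value_def)

lemma word_value_Cons [simp]: "word_value G (x # w) = letter_value G x \<otimes>\<^bsub>G\<^esub> word_value G w"
  by (simp add: word_value_def)

context group
begin

lemma letter_value_closed [simp]:
  "S \<subseteq> carrier G \<Longrightarrow> x \<in> S \<times> UNIV \<Longrightarrow> letter_value G x \<in> carrier G"
  by (cases x) (auto simp: letter_value_def)

lemma letter_value_linv:
  "S \<subseteq> carrier G \<Longrightarrow> x \<in> S \<times> UNIV \<Longrightarrow> letter_value G (linv x) = inv (letter_value G x)"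
  by (cases x) (auto simp: letter_value_def)

lemma word_value_closed [simp]:
  "S \<subseteq> carrier G \<Longrightarrow> w \<in> lists (S \<times> UNIV) \<Longrightarrow> word_value G w \<in> carrier G"
  by (induction w) (auto simp del: mem_Sigma_iff)

lemma word_value_append:
  "S \<subseteq> carrier G \<Longrightarrow> u \<in> lists (S \<times> UNIV) \<Longrightarrow> w \<in> lists (S \<times> UNIV) \<Longrightarrow>
    word_value G (u @ w) = word_value G u \<otimes> word_value G w"
  by (induction u) (auto simp: m_assoc simp del: mem_Sigma_iff)

lemma word_value_rev:
  "S \<subseteq> carrier G \<Longrightarrow> w \<in> lists (S \<times> UNIV) \<Longrightarrow>
    word_value G (rev (map linv w)) = inv (word_value G w)"
proof (induction w)
  case (Cons x w)
  have "rev (map linv w) \<in> lists (S \<times> UNIV)" using Cons.prems by auto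
  then show ?case
    using Cons by (auto simp: word_value_append[of S] letter_value_linv inv_mult_group
        simp del: mem_Sigma_iff split_paired_All)
qed simp

lemma generate_word:
  assumes S: "S \<subseteq> carrier G" and g: "g \<in> generate G S"
  shows "\<exists>w \<in> lists (S \<times> UNIV). word_value G w = g"
  using g
proof induction
  case one
  show ?case by (rule bexI[of _ "[]"]) auto
next
  case (incl h)
  then show ?case using S by (intro bexI[of _ "[(h, True)]"]) (auto simp: letter_value_def)
next
  case (inv h)
  then show ?case using S by (intro bexI[of _ "[(h, False)]"]) (auto simp: letter_value_def)
next
  case (eng h1 h2)
  then obtain u w where "u \<in> lists (S \<times> UNIV)" "w \<in> lists (S \<times> UNIV)"
    "word_value G u = h1" "word_value G w = h2" by blast
  then show ?case by (intro bexI[of _ "u @ w"]) (auto simp: word_value_append[OF S] simp del: in_lists_conv_set)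
qed

lemma word_value_surj:
  assumes "generates G S" "g \<in> carrier G"
  obtains w where "w \<in> lists (S \<times> UNIV)" "word_value G w = g"
  using generate_word[of S g] assms that by (auto simp: generates_def)

lemma word_induct:
  assumes S: "generates G S" and g: "g \<in> carrier G"
    and one: "P \<one>" and step: "\<And>h y. h \<in> carrier G \<Longrightarrow> P h \<Longrightarrow> y \<in> S \<times> UNIV \<Longrightarrow> P (h \<otimes> letter_value G y)"
  shows "P g"
proof -
  have S': "S \<subseteq> carrier G" using S by (simp add: generates_def)
  have "P (word_value G w)" if "w \<in> lists (S \<times> UNIV)" for w
    using that
  proof (induction w rule: rev_induct)
    case (snoc y w)
    then have y: "y \<in> S \<times> UNIV" "[y] \<in> lists (S \<times> UNIV)" and w: "w \<in> lists (S \<times> UNIV)" by auto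
    have "word_value G (w @ [y]) = word_value G w \<otimes> letter_value G y"
      using word_value_append[OF S' w y(2)] letter_value_closed[OF S' y(1)] by simp
    then show ?case using step[OF word_value_closed[OF S' w] snoc.IH[OF w] y(1)] by simp
  qed (simp add: one)
  then show ?thesis using word_value_surj[OF S g] by metis
qed

lemma generate_commutes:
  assumes "S \<subseteq> carrier G" "z \<in> carrier G" "\<And>x. x \<in> S \<Longrightarrow> x \<otimes> z = z \<otimes> x" "g \<in> generate G S"
  shows "g \<otimes> z = z \<otimes> g"
  using assms(4)
proof induction
  case (inv h)
  then have h: "h \<in> carrier G" "h \<otimes> z = z \<otimes> h" using assms by auto
  have "inv h \<otimes> z = inv h \<otimes> (z \<otimes> h) \<otimes> inv h" using h(1) assms(2) by (simp add: m_assoc)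
  also have "\<dots> = inv h \<otimes> (h \<otimes> z) \<otimes> inv h" using h(2) by simp
  also have "\<dots> = z \<otimes> inv h" using h(1) assms(2) by (simp add: m_assoc[symmetric])
  finally show ?case .
next
  case (eng h1 h2)
  then have h: "h1 \<in> carrier G" "h2 \<in> carrier G" using assms(1) generate_in_carrier by auto
  have "h1 \<otimes> h2 \<otimes> z = h1 \<otimes> z \<otimes> h2" using assms(2) h eng.IH(2) by (simp only: m_assoc)
  also have "\<dots> = z \<otimes> h1 \<otimes> h2" using eng by simp
  also have "\<dots> = z \<otimes> (h1 \<otimes> h2)" using assms(2) h by (simp add: m_assoc)
  finally show ?case .
qed (use assms in auto)

lemma word_value_in_generate:
  assumes "S \<subseteq> carrier G" "w \<in> lists (S \<times> UNIV)"
  shows "word_value G w \<in> generate G S"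
  using assms(2)
proof (induction w)
  case (Cons x w)
  then have "letter_value G x \<in> generate G S"
    by (cases x) (auto simp: letter_value_def intro: generate.intros)
  then show ?case using Cons by (auto intro: generate.eng)
qed (auto intro: generate.one)

end

section \<open>Free groups\<close>

text \<open>Reduced words are kept as stacks, with the most recent letter at the head: a new letter
  either cancels against the head or is put on top. Stacks are therefore the reversed reduced
  words.\<close>

fun push :: "('s \<times> bool) list \<Rightarrow> 's \<times> bool \<Rightarrow> ('s \<times> bool) list" where
  "push [] y = [y]"
| "push (z # r) y = (if z = linv y then r else y # z # r)"

definition stack :: "('s \<times> bool) list \<Rightarrow> ('s \<times> bool) list" where
  "stack w = foldl push [] w"

abbreviation freely_reduced :: "('s \<times> bool) list \<Rightarrow> bool" where
  "freely_reduced \<equiv> successively (\<lambda>x y. y \<noteq> linv x)"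

lemma freely_reduced_push: "freely_reduced r \<Longrightarrow> freely_reduced (push r y)"
  by (cases r rule: remdups_adj.cases) (auto simp: successively_Cons)

lemma freely_reduced_foldl: "freely_reduced r \<Longrightarrow> freely_reduced (foldl push r w)"
  by (induction w arbitrary: r) (auto simp: freely_reduced_push)

text \<open>Van der Waerden's argument: on reduced stacks a letter and its inverse act by mutually
  inverse maps, so the stack reached by a word is unchanged by free cancellation.\<close>

lemma push_push_linv: "freely_reduced r \<Longrightarrow> push (push r x) (linv x) = r"
  by (cases r rule: remdups_adj.cases) (auto simp: successively_Cons)

lemma stack_word_eq:
  assumes "word_eq A linv {} u w"
  shows "stack u = stack w"
  using assms unfolding word_eq_def
proof (rule equivclp_invariant)
  fix u w assume "word_step A linv {} u w"
  then show "stack u = stack w"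
  proof cases
    case (cancel x u v)
    then show ?thesis
      using freely_reduced_foldl[of "[]" u] push_push_linv[of "foldl push [] u" x]
      by (simp add: stack_def)
  qed simp
qed

lemma stack_snoc: "stack (w @ [y]) = push (stack w) y"
  by (simp add: stack_def)

locale free_basis = group G for G (structure) +
  fixes S
  assumes presented: "presented_by G S {}"
begin

lemma basis_subset [simp]: "S \<subseteq> carrier G" and basis_generates: "generates G S"
  using presented by (auto simp: presented_by_def generates_def)

lemma basis_closed [simp]: "s \<in> S \<Longrightarrow> s \<in> carrier G"
  using basis_subset by (auto simp del: basis_subset)

abbreviation "letters \<equiv> S \<times> (UNIV :: bool set)"

text \<open>Without relators, \<open>u\<close> followed by the inverse of \<open>w\<close> is freely
  trivial, so reading that inverse on top of the stack of \<open>u\<close> empties it. Undoing these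
  letters one by one rebuilds exactly the stack of \<open>w\<close>.\<close>

lemma stack_eqI:
  assumes "u \<in> lists letters" "w \<in> lists letters" "word_value G u = word_value G w"
  shows "stack u = stack w"
proof -
  have w': "rev (map linv w) \<in> lists letters" using assms by auto
  have "word_value G (u @ rev (map linv w)) = \<one>"
    using word_value_append[OF basis_subset assms(1) w'] word_value_rev[OF basis_subset assms(2)]
      word_value_closed[OF basis_subset assms(2)] assms(3) by simp
  then have "word_eq letters linv {} (u @ rev (map linv w)) []"
    using presented assms w' unfolding presented_by_def by (auto simp del: in_lists_conv_set)
  then have "foldl push (stack u) (rev (map linv w)) = []"
    by (auto dest: stack_word_eq simp: stack_def)
  moreover have "foldl push r (rev (map linv w)) = [] \<Longrightarrow> freely_reduced r \<Longrightarrow> r = stack w"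
    if "w \<in> lists letters" for r w
    using that
  proof (induction w arbitrary: r rule: rev_induct)
    case (snoc x w)
    have "push r (linv x) = stack w"
      using snoc by (auto simp: freely_reduced_push simp del: split_paired_All)
    then have "push (push r (linv x)) (linv (linv x)) = stack (w @ [x])"
      by (simp add: stack_snoc)
    then show ?case using push_push_linv[OF snoc.prems(2), of "linv x"] by simp
  qed (auto simp: stack_def)
  ultimately show ?thesis
    using assms(2) freely_reduced_foldl[of "[]" u] by (auto simp: stack_def)
qed

text \<open>By \<open>stack_eqI\<close> the choice of the word is immaterial. The list is reversed:
  its head is the last letter of the reduced word and its last entry the first letter.\<close>

definition nf :: "'a \<Rightarrow> ('a \<times> bool) list" where
  "nf g = stack (SOME w. w \<in> lists letters \<and> word_value G w = g)"

lemma nf_word_value: "w \<in> lists letters \<Longrightarrow> nf (word_value G w) = stack w"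
  unfolding nf_def by (rule stack_eqI; rule someI2[of _ w]) (auto simp del: in_lists_conv_set)

lemma nf_one [simp]: "nf \<one> = []"
  using nf_word_value[of "[]"] by (simp add: stack_def)

lemma nf_mult_letter:
  assumes "g \<in> carrier G" "y \<in> letters"
  shows "nf (g \<otimes> letter_value G y) = push (nf g) y"
proof -
  obtain w where w: "w \<in> lists letters" "word_value G w = g"
    using word_value_surj[OF basis_generates assms(1)] .
  have y: "[y] \<in> lists letters" using assms by auto
  have "w @ [y] \<in> lists letters" using w y by auto
  from nf_word_value[OF this] show ?thesis
    using w letter_value_closed[OF basis_subset assms(2)]
      word_value_append[OF basis_subset w(1) y] nf_word_value[OF w(1)]
    by (simp add: stack_snoc)
qed

lemma push_in: "r \<in> lists letters \<Longrightarrow> y \<in> letters \<Longrightarrow> push r y \<in> lists letters"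
  by (cases r) auto

lemma word_value_rev_push:
  assumes "r \<in> lists letters" "y \<in> letters"
  shows "word_value G (rev (push r y)) = word_value G (rev r) \<otimes> letter_value G y"
proof (cases r)
  case Nil
  then show ?thesis using letter_value_closed[OF basis_subset assms(2)] by simp
next
  case (Cons z r')
  have r': "rev r' \<in> lists letters" and z: "z \<in> letters" "[z] \<in> lists letters" and y: "[y] \<in> lists letters"
    and zy: "[z, y] \<in> lists letters"
    using assms Cons by auto
  note cl = letter_value_closed[OF basis_subset z(1)] letter_value_closed[OF basis_subset assms(2)]
    word_value_closed[OF basis_subset r']
  show ?thesis
  proof (cases "z = linv y")
    case True
    then have "letter_value G z = inv (letter_value G y)"
      using letter_value_linv[OF basis_subset assms(2)] by simp
    then show ?thesis using Cons cl True word_value_append[OF basis_subset r' z(2)]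
      by (simp add: m_assoc)
  next
    case False
    then show ?thesis using Cons cl word_value_append[OF basis_subset r' z(2)]
        word_value_append[OF basis_subset r' zy] by (simp add: m_assoc)
  qed
qed

lemma stack_props:
  "w \<in> lists letters \<Longrightarrow> stack w \<in> lists letters \<and> word_value G (rev (stack w)) = word_value G w"
proof (induction w rule: rev_induct)
  case (snoc y w)
  then have w: "w \<in> lists letters" and y: "y \<in> letters" "[y] \<in> lists letters" by auto
  then show ?case
    using snoc.IH[OF w] word_value_append[OF basis_subset w y(2)]
      push_in[of "stack w" y] word_value_rev_push[of "stack w" y] letter_value_closed[OF basis_subset y(1)]
    by (simp add: stack_snoc del: in_lists_conv_set mem_Sigma_iff)
qed (simp add: stack_def)

lemma word_value_rev_nf:
  assumes "g \<in> carrier G"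
  shows "word_value G (rev (nf g)) = g"
proof -
  obtain w where w: "w \<in> lists letters" "word_value G w = g"
    using word_value_surj[OF basis_generates assms] .
  then show ?thesis using nf_word_value[OF w(1)] stack_props[OF w(1)] by simp
qed

text \<open>Because normal forms are reversed, \<open>last\<close> picks the first letter of the
  reduced word, that is, the first edge of the geodesic from \<open>\<one>\<close> to
  \<open>g\<close> in the Cayley tree.\<close>

definition branch :: "'a \<times> bool \<Rightarrow> 'a set" where
  "branch x = {g \<in> carrier G. nf g \<noteq> [] \<and> last (nf g) = x}"

lemma nf_letter_value: "y \<in> letters \<Longrightarrow> nf (letter_value G y) = [y]"
  using nf_mult_letter[OF one_closed, of y] letter_value_closed[OF basis_subset, of y]
  by (simp del: mem_Sigma_iff)

lemma one_notin_branch [simp]: "\<one> \<notin> branch x"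
  by (simp add: branch_def)

lemma letter_in_branch: "x \<in> letters \<Longrightarrow> letter_value G x \<in> branch x"
  using nf_letter_value letter_value_closed[OF basis_subset] by (simp add: branch_def del: mem_Sigma_iff)

text \<open>The branch of the Cayley tree beyond the edge from \<open>\<one>\<close> to \<open>x\<close> is left only along
  this edge.\<close>

lemma branch_step:
  assumes g: "g \<in> carrier G" and y: "y \<in> letters" and x: "x \<in> letters"
    and "\<not> (g = \<one> \<and> y = x)" "\<not> (g = letter_value G x \<and> y = linv x)"
  shows "g \<otimes> letter_value G y \<in> branch x \<longleftrightarrow> g \<in> branch x"
proof -
  have gy: "g \<otimes> letter_value G y \<in> carrier G"
    using g letter_value_closed[OF basis_subset y] by simp
  show ?thesis
  proof (cases "nf g")
    case Nil
    then have "g = \<one>" using word_value_rev_nf[OF g] by simp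
    with assms(4) have "y \<noteq> x" by simp
    then show ?thesis using Nil nf_mult_letter[OF g y] by (simp add: branch_def)
  next
    case (Cons z r)
    show ?thesis
    proof (cases "z = linv y")
      case False
      then show ?thesis using Cons nf_mult_letter[OF g y] gy g by (simp add: branch_def)
    next
      case True
      then have n: "nf (g \<otimes> letter_value G y) = r" using Cons nf_mult_letter[OF g y] by simp
      show ?thesis
      proof (cases "r = []")
        case True
        then have nfg: "nf g = [z]" using Cons by simp
        have "z \<noteq> x"
        proof
          assume "z = x"
          then have "g = letter_value G x" "y = linv x"
            using nfg word_value_rev_nf[OF g] letter_value_closed[OF basis_subset x] \<open>z = linv y\<close> by auto
          then show False using assms(5) by simp
        qed
        then show ?thesis using n True nfg by (simp add: branch_def)
      next
        case False
        then show ?thesis using n Cons gy g by (simp add: branch_def)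
      qed
    qed
  qed
qed

lemma nf_pow: "s \<in> S \<Longrightarrow> nf (s [^] (n::nat)) = replicate n (s, True)"
proof (induction n)
  case (Suc n)
  have s: "s \<in> carrier G" using Suc basis_subset by auto
  then show ?case using nf_mult_letter[of "s [^] n" "(s, True)"] Suc
    by (cases n) (auto simp: letter_value_def)
qed simp

lemma basis_pow_inj: "s \<in> S \<Longrightarrow> s [^] (n::nat) = s [^] (m::nat) \<longleftrightarrow> n = m"
  by (metis nf_pow length_replicate)

lemma basis_pow_in_branch:
  assumes "s \<in> S"
  shows "s [^] (n::nat) \<in> branch (t, True) \<longleftrightarrow> s = t \<and> n > 0"
proof -
  have "s \<in> carrier G" using assms basis_subset by auto
  then show ?thesis by (auto simp: branch_def nf_pow[OF assms])
qed

text \<open>Both products are already reduced, so their normal forms can be compared letter by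
  letter. Powers are considered because a subgroup of finite index is only known to contain powers
  of basis elements.\<close>

lemma basis_pow_noncommute:
  assumes "a \<in> S" "b \<in> S" "a \<noteq> b" "n > 0"
  shows "a [^] (n::nat) \<otimes> b [^] n \<noteq> b [^] n \<otimes> a [^] n"
proof -
  have cl: "a \<in> carrier G" "b \<in> carrier G" using assms basis_subset by auto
  have key: "nf (s [^] n \<otimes> t [^] m) = replicate m (t, True) @ replicate n (s, True)"
    if "s \<in> S" "t \<in> S" "s \<noteq> t" for s t and m :: nat
  proof (induction m)
    case 0
    then show ?case using that basis_subset by (auto simp: nf_pow subset_iff)
  next
    case (Suc m)
    have st: "s \<in> carrier G" "t \<in> carrier G" using that basis_subset by auto
    have "nf (s [^] n \<otimes> t [^] Suc m) = push (nf (s [^] n \<otimes> t [^] m)) (t, True)"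
      using nf_mult_letter[of "s [^] n \<otimes> t [^] m" "(t, True)"] st that
      by (simp add: letter_value_def m_assoc)
    also have "\<dots> = (t, True) # replicate m (t, True) @ replicate n (s, True)"
      unfolding Suc using \<open>n > 0\<close> that by (cases m; cases n) auto
    finally show ?case by simp
  qed
  show ?thesis
  proof
    assume "a [^] n \<otimes> b [^] n = b [^] n \<otimes> a [^] n"
    then have "replicate n (b, True) @ replicate n (a, True) = replicate n (a, True) @ replicate n (b, True)"
      using key[of a b n] key[of b a n] assms by simp
    then show False using assms by (cases n) auto
  qed
qed

text \<open>With at most one basis element all generators commute; commutation spreads from the
  generators to the group in one factor at a time.\<close>

lemma basis_two_elements:
  assumes "\<not> comm_group G"
  obtains a b where "a \<in> S" "b \<in> S" "a \<noteq> b"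
proof (rule ccontr)
  assume "\<not> thesis"
  then have one: "\<And>a b. a \<in> S \<Longrightarrow> b \<in> S \<Longrightarrow> a = b" using that by blast
  have "x \<otimes> y = y \<otimes> x" if "x \<in> S" "y \<in> S" for x y
    using one[OF that] by simp
  then have "x \<otimes> y = y \<otimes> x" if "x \<in> generate G S" "y \<in> S" for x y
    using generate_commutes[of S y x] that by auto
  then have "x \<otimes> y = y \<otimes> x" if "x \<in> generate G S" "y \<in> generate G S" for x y
    using generate_commutes[of S x y] that generate_in_carrier[of S] by auto
  then have "comm_group G"
    using basis_generates by (intro group_comm_groupI) (auto simp: generates_def)
  with assms show False ..
qed

end

section \<open>Free groups are not one-ended\<close>

context free_basis
begin

text \<open>Finiteness of these sets says that the branch is almost invariant under right
  multiplication, the property that detects more than one end.\<close>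

definition boundary :: "'a \<times> bool \<Rightarrow> 'a \<Rightarrow> 'a set" where
  "boundary x h = {g \<in> carrier G. (g \<in> branch x) \<noteq> (g \<otimes> h \<in> branch x)}"

text \<open>For a basis letter only the two endpoints of the defining edge are exceptional. A
  product adds a translate of the boundary of its second factor to that of the first. General
  \<open>h\<close> is required because the generating set in \<open>one_ended\<close> is unrelated
  to the basis.\<close>

lemma finite_boundary:
  assumes x: "x \<in> letters" and h: "h \<in> carrier G"
  shows "finite (boundary x h)"
proof -
  obtain w where w: "w \<in> lists letters" "word_value G w = h"
    using word_value_surj[OF basis_generates h] .
  from w(1) have "finite (boundary x (word_value G w))"
  proof (induction w rule: list.induct)
    case Nil
    have "boundary x \<one> = {}" by (auto simp: boundary_def)
    then show ?case by simp
  next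
    case (Cons y w)
    then have y: "y \<in> letters" and w: "w \<in> lists letters" by auto
    let ?y = "letter_value G y" and ?w = "word_value G w"
    have cl: "?y \<in> carrier G" "?w \<in> carrier G"
      using letter_value_closed[OF basis_subset y] word_value_closed[OF basis_subset w] .
    have "boundary x ?y \<subseteq> {\<one>, letter_value G x}"
      using branch_step[OF _ y x] by (auto simp: boundary_def)
    then have "finite (boundary x ?y)" by (rule finite_subset) simp
    moreover have "boundary x (?y \<otimes> ?w) \<subseteq> boundary x ?y \<union> (\<lambda>g. g \<otimes> inv ?y) ` boundary x ?w"
    proof
      fix g assume g: "g \<in> boundary x (?y \<otimes> ?w)"
      then have "g \<in> carrier G" by (simp add: boundary_def)
      moreover from this have "g = g \<otimes> ?y \<otimes> inv ?y" using cl by (simp add: m_assoc)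
      ultimately show "g \<in> boundary x ?y \<union> (\<lambda>g. g \<otimes> inv ?y) ` boundary x ?w"
        using g cl by (auto simp: boundary_def m_assoc intro!: image_eqI[of g _ "g \<otimes> ?y"])
    qed
    ultimately show ?case
      using Cons.IH[OF w] by (auto intro: finite_subset)
  qed
  then show ?thesis using w by simp
qed

lemma cayley_path_avoiding:
  assumes T: "T \<subseteq> carrier G" and p: "p \<in> lists (T \<times> UNIV)" and g: "g \<in> carrier G"
    and K: "\<forall>i\<le>length p. g \<otimes> word_value G (take i p) \<notin> K"
  shows "(g, g \<otimes> word_value G p) \<in> (Restr (cayley_adj G T) (carrier G - K))\<^sup>*"
  using p g K
proof (induction p arbitrary: g rule: list.induct)
  case (Cons x p)
  then have x: "x \<in> T \<times> UNIV" and p: "p \<in> lists (T \<times> UNIV)" by auto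
  let ?x = "letter_value G x"
  have cl: "?x \<in> carrier G" "word_value G p \<in> carrier G"
    using letter_value_closed[OF T x] word_value_closed[OF T p] .
  have take_cl: "word_value G (take i p) \<in> carrier G" for i
    by (rule word_value_closed[OF T]) (use p in \<open>auto dest: in_set_takeD\<close>)
  have "g \<notin> K" "g \<otimes> ?x \<notin> K"
    using spec[OF Cons.prems(3), of 0] spec[OF Cons.prems(3), of 1] Cons.prems(2) cl by auto
  then have "(g, g \<otimes> ?x) \<in> Restr (cayley_adj G T) (carrier G - K)"
    using Cons.prems(2) x cl by (auto simp: cayley_adj_def)
  moreover have "(g \<otimes> ?x, g \<otimes> ?x \<otimes> word_value G p) \<in> (Restr (cayley_adj G T) (carrier G - K))\<^sup>*"
    using Cons.prems(2) cl take_cl spec[OF Cons.prems(3), of "Suc i" for i]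
    by (intro Cons.IH[OF p]) (auto simp: m_assoc)
  ultimately show ?case
    using Cons.prems(2) cl by (simp add: m_assoc del: Int_iff)
qed auto

text \<open>A fixed path from \<open>\<one>\<close> to \<open>s\<close>, translated by a high power
  of \<open>s\<close>, avoids the finite set \<open>K\<close>. These translates chain all high
  powers of \<open>s\<close> together in one component.\<close>

lemma infinite_component_of_powers:
  assumes T: "generates G T" and K: "finite K" and s: "s \<in> S"
  obtains n where "n > 0" "s [^] (n::nat) \<in> carrier G - K"
    "infinite ((Restr (cayley_adj G T) (carrier G - K))\<^sup>* `` {s [^] n})"
proof -
  let ?R = "Restr (cayley_adj G T) (carrier G - K)"
  have T': "T \<subseteq> carrier G" using T by (simp add: generates_def)
  obtain p where p: "p \<in> lists (T \<times> UNIV)" "word_value G p = s"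
    using word_value_surj[OF T basis_closed[OF s]] .
  let ?P = "\<lambda>i. word_value G (take i p)"
  have take_cl: "?P i \<in> carrier G" for i
    by (rule word_value_closed[OF T']) (use p in \<open>auto dest: in_set_takeD\<close>)
  \<comment> \<open>The starting points from which a translate of the path \<open>p\<close> meets
    \<open>K\<close>.\<close>
  define bad where "bad = (\<Union>i\<le>length p. (\<lambda>k. k \<otimes> inv ?P i) ` K)"
  have "finite bad" unfolding bad_def using K by simp
  then have "finite {n. s [^] (n::nat) \<in> bad}"
    using basis_pow_inj[OF s] finite_vimageI[of bad "\<lambda>n. s [^] (n::nat)"]
    by (auto simp: inj_def vimage_def)
  then obtain N where N: "\<And>n. s [^] (n::nat) \<in> bad \<Longrightarrow> n < N"
    unfolding finite_nat_set_iff_bounded by auto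
  have good: "s [^] n \<otimes> ?P i \<notin> K" if "n \<ge> N" "i \<le> length p" for n i
  proof
    assume "s [^] n \<otimes> ?P i \<in> K"
    moreover have "s [^] n = s [^] n \<otimes> ?P i \<otimes> inv ?P i"
      using take_cl[of i] s by (simp add: m_assoc)
    ultimately have "s [^] n \<in> bad" unfolding bad_def using that(2) by auto
    then show False using N that(1) by fastforce
  qed
  have step: "(s [^] n, s [^] Suc n) \<in> ?R\<^sup>*" if "n \<ge> N" for n
    using cayley_path_avoiding[OF T' p(1), of "s [^] n" K] good[OF that] s p(2) by simp
  \<comment> \<open>The successor makes the exponent positive, since \<open>\<one>\<close> lies in
    no branch.\<close>
  let ?n = "Suc N"
  have "(s [^] ?n, s [^] (?n + m)) \<in> ?R\<^sup>*" for m
  proof (induction m)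
    case (Suc m)
    then show ?case using step[of "?n + m"] by (auto simp del: nat_pow_Suc)
  qed simp
  then have "range (\<lambda>m. s [^] (?n + m)) \<subseteq> ?R\<^sup>* `` {s [^] ?n}" by auto
  moreover have "infinite (range (\<lambda>m. s [^] (?n + m)))"
    using basis_pow_inj[OF s, of "?n + m" "?n + k" for m k]
    by (intro range_inj_infinite) (simp add: inj_def del: nat_pow_Suc add_Suc)
  ultimately have "infinite (?R\<^sup>* `` {s [^] ?n})" using finite_subset by blast
  moreover have "s [^] ?n \<in> carrier G - K"
    using good[of ?n 0] s by simp
  ultimately show ?thesis using that[of ?n] by blast
qed

text \<open>Once the finitely many crossing points of the branch of \<open>a\<close> are removed, no
  path changes sides. The powers of \<open>a\<close> give an infinite component inside the branch,
  those of \<open>b\<close> one outside.\<close>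

lemma not_one_ended:
  assumes "a \<in> S" "b \<in> S" "a \<noteq> b"
  shows "\<not> one_ended G"
proof
  assume "one_ended G"
  then obtain T where "finite T \<and> generates G T \<and>
     (\<forall>K. finite K \<and> K \<subseteq> carrier G \<longrightarrow>
      (\<exists>!C. C \<in> (carrier G - K) // (Restr (cayley_adj G T) (carrier G - K))\<^sup>* \<and> infinite C))"
    unfolding one_ended_def by (elim exE) rule
  then have T: "finite T" "generates G T" and
    ends: "\<And>K. finite K \<Longrightarrow> K \<subseteq> carrier G \<Longrightarrow>
      \<exists>!C. C \<in> (carrier G - K) // (Restr (cayley_adj G T) (carrier G - K))\<^sup>* \<and> infinite C"
    by simp_all
  have T': "T \<subseteq> carrier G" using T by (simp add: generates_def)
  define K where "K = (\<Union>y\<in>T \<times> UNIV. boundary (a, True) (letter_value G y))"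
  let ?R = "Restr (cayley_adj G T) (carrier G - K)"
  have "finite (boundary (a, True) (letter_value G y))" if "y \<in> T \<times> UNIV" for y
    using letter_value_closed[OF T' that] assms(1) by (intro finite_boundary) auto
  then have "finite K" unfolding K_def using T(1) by (intro finite_UN_I) auto
  moreover have "K \<subseteq> carrier G" unfolding K_def boundary_def by (intro UN_least) simp
  ultimately have K: "finite K" "K \<subseteq> carrier G" by auto
  obtain n :: nat where n: "n > 0" "a [^] n \<in> carrier G - K" "infinite (?R\<^sup>* `` {a [^] n})"
    using infinite_component_of_powers[OF T(2) K(1) assms(1)] .
  obtain m :: nat where m: "m > 0" "b [^] m \<in> carrier G - K" "infinite (?R\<^sup>* `` {b [^] m})"
    using infinite_component_of_powers[OF T(2) K(1) assms(2)] .
  have uniq: "C = C'" if "\<exists>!C. P C" "P C" "P C'" for P and C C' :: "'a set"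
    using that by blast
  have "?R\<^sup>* `` {a [^] n} = ?R\<^sup>* `` {b [^] m}"
    using quotientI[OF n(2), of "?R\<^sup>*"] quotientI[OF m(2), of "?R\<^sup>*"] n(3) m(3)
    by (intro uniq[OF ends[OF K]]) (rule conjI; assumption)+
  moreover have "b [^] m \<in> ?R\<^sup>* `` {b [^] m}" by (rule ImageI[OF rtrancl_refl]) simp
  ultimately have "b [^] m \<in> ?R\<^sup>* `` {a [^] n}" by (simp only:)
  then have "(a [^] n, b [^] m) \<in> ?R\<^sup>*" by (simp only: Image_singleton_iff)
  then have "a [^] n \<in> branch (a, True) \<longleftrightarrow> b [^] m \<in> branch (a, True)"
  proof induction
    case (step y z)
    have "y \<in> branch (a, True) \<longleftrightarrow> z \<in> branch (a, True)"
      using step(2) by (auto simp: cayley_adj_def K_def boundary_def)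
    then show ?case using step by simp
  qed simp
  then show False
    using basis_pow_in_branch[OF assms(1), of n a] basis_pow_in_branch[OF assms(2), of m a] assms n(1)
    by simp
qed

end

section \<open>Subgroups of finite index\<close>

lemma word_eq_refl [simp]: "word_eq A i R u u"
  by (simp add: word_eq_def)

lemma word_eq_sym: "word_eq A i R u v \<Longrightarrow> word_eq A i R v u"
  by (simp add: word_eq_def equivclp_sym)

lemma word_eq_trans [trans]: "word_eq A i R u v \<Longrightarrow> word_eq A i R v w \<Longrightarrow> word_eq A i R u w"
  unfolding word_eq_def by (rule equivclp_trans)

lemma word_eq_context:
  assumes "word_eq A i R u v"
  shows "word_eq A i R (p @ u @ q) (p @ v @ q)"
proof -
  have ctx: "word_step A i R (p @ u @ q) (p @ v @ q)" if "word_step A i R u v" for u v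
    using that
  proof cases
    case (cancel x u' v')
    show ?thesis using word_step.cancel[OF cancel(3), of i R "p @ u'" "v' @ q"] cancel by simp
  next
    case (relator r u' v')
    show ?thesis using word_step.relator[OF relator(3), of A i "p @ u'" "v' @ q"] relator by simp
  qed
  show ?thesis
    using assms unfolding word_eq_def
  proof (induction rule: equivclp_induct)
    case (step y z)
    then show ?case using ctx equivclp_into_equivclp by metis
  qed simp
qed

lemma word_eq_append:
  assumes "word_eq A i R u u'" "word_eq A i R v v'"
  shows "word_eq A i R (u @ v) (u' @ v')"
proof -
  have "word_eq A i R (u @ v) (u' @ v)" using word_eq_context[OF assms(1), of "[]" v] by simp
  also have "word_eq A i R (u' @ v) (u' @ v')" using word_eq_context[OF assms(2), of u' "[]"] by simp
  finally show ?thesis .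
qed

lemma word_eq_cancel: "x \<in> A \<Longrightarrow> word_eq A i R [x, i x] []"
  unfolding word_eq_def using word_step.cancel[of x A i R "[]" "[]"] by auto

lemma word_eq_relator: "r \<in> R \<Longrightarrow> word_eq A i R r []"
  unfolding word_eq_def using word_step.relator[of r R A i "[]" "[]"] by auto

lemma word_eq_inverse:
  "u \<in> lists (A \<times> UNIV) \<Longrightarrow> word_eq (A \<times> UNIV) linv R (u @ rev (map linv u)) []"
proof (induction u)
  case (Cons x u)
  then have "word_eq (A \<times> UNIV) linv R ([x] @ (u @ rev (map linv u)) @ [linv x]) ([x] @ [] @ [linv x])"
    by (intro word_eq_context) simp
  also have "word_eq (A \<times> UNIV) linv R ([x] @ [] @ [linv x]) []"
    using Cons.prems word_eq_cancel[of x "A \<times> UNIV" linv] by auto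
  finally show ?case by simp
qed simp

context group
begin

lemma letter_value_subgroup:
  assumes "subgroup K G" "A \<subseteq> K" "x \<in> A \<times> UNIV"
  shows "letter_value (G\<lparr>carrier := K\<rparr>) x = letter_value G x"
  using assms m_inv_consistent[OF assms(1)] by (auto simp: letter_value_def)

lemma word_value_subgroup:
  assumes "subgroup K G" "A \<subseteq> K" "w \<in> lists (A \<times> UNIV)"
  shows "word_value (G\<lparr>carrier := K\<rparr>) w = word_value G w"
  using assms(3)
  by (induction w rule: lists.induct) (auto simp: letter_value_subgroup[OF assms(1,2)])

lemma generates_subgroupI:
  assumes K: "subgroup K G" and A: "A \<subseteq> K"
    and "\<And>k. k \<in> K \<Longrightarrow> \<exists>w \<in> lists (A \<times> UNIV). word_value G w = k"
  shows "generates (G\<lparr>carrier := K\<rparr>) A"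
proof -
  interpret K: group "G\<lparr>carrier := K\<rparr>" using K by (rule subgroup_imp_group)
  have "K \<subseteq> generate (G\<lparr>carrier := K\<rparr>) A"
  proof
    fix k assume "k \<in> K"
    then obtain w where w: "w \<in> lists (A \<times> UNIV)" "word_value G w = k" using assms(3) by blast
    then show "k \<in> generate (G\<lparr>carrier := K\<rparr>) A"
      using K.word_value_in_generate[of A w] A by (simp add: word_value_subgroup[OF K A])
  qed
  moreover have "generate (G\<lparr>carrier := K\<rparr>) A \<subseteq> K"
    using K.generate_in_carrier[of A] A by auto
  ultimately show ?thesis using A by (auto simp: generates_def)
qed

end

section \<open>Reidemeister-Schreier rewriting for a subgroup of finite index\<close>

locale finite_index = group G for G (structure) +
  fixes K S
  assumes K: "subgroup K G" and finite_cosets: "finite (rcosets K)" and S: "generates G S"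
begin

sublocale K: subgroup K G by (rule K)

lemma S_subset: "S \<subseteq> carrier G" using S by (simp add: generates_def)

lemma S_closed [simp]: "s \<in> S \<Longrightarrow> s \<in> carrier G" using S_subset by blast

text \<open>The coset \<open>K\<close> gets the representative \<open>\<one>\<close>, so that
  rewriting a word with value in \<open>K\<close>, started at \<open>\<one>\<close>, preserves its
  value.\<close>

definition rep :: "'a \<Rightarrow> 'a" where
  "rep g = (if K #> g = K then \<one> else SOME h. h \<in> K #> g)"

lemma coset_mult: "k \<in> K \<Longrightarrow> g \<in> carrier G \<Longrightarrow> K #> (k \<otimes> g) = K #> g"
  using coset_join2[of k K] K by (simp add: coset_mult_assoc[symmetric] K.subset)

lemma rep_mult: "k \<in> K \<Longrightarrow> g \<in> carrier G \<Longrightarrow> rep (k \<otimes> g) = rep g"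
  by (simp add: rep_def coset_mult)

lemma rep_K [simp]: "k \<in> K \<Longrightarrow> rep k = \<one>"
  using coset_join2[of k K] K by (simp add: rep_def)

lemma rep_in: "g \<in> carrier G \<Longrightarrow> rep g \<in> K #> g"
  unfolding rep_def using someI_ex[of "\<lambda>h. h \<in> K #> g"] rcos_self[of g K] K by auto

lemma rep_closed [simp]: "g \<in> carrier G \<Longrightarrow> rep g \<in> carrier G"
  using rep_in r_coset_subset_G[OF K.subset] by blast

lemma rep_inv: "g \<in> carrier G \<Longrightarrow> g \<otimes> inv (rep g) \<in> K"
proof -
  assume g: "g \<in> carrier G"
  obtain k where k: "k \<in> K" "rep g = k \<otimes> g" using rep_in[OF g] by (auto simp: r_coset_def)
  then show ?thesis using g by (simp add: inv_mult_group m_assoc[symmetric])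
qed

lemma rep_eq: "g \<in> carrier G \<Longrightarrow> \<exists>k\<in>K. g = k \<otimes> rep g"
  by (rule bexI[OF _ rep_inv]) (auto simp: m_assoc)

definition transversal :: "'a set" where "transversal = rep ` carrier G"

lemma finite_transversal: "finite transversal"
proof -
  have "transversal = (\<lambda>C. if C = K then \<one> else SOME h. h \<in> C) ` (rcosets K)"
    unfolding transversal_def RCOSETS_def rep_def by auto
  then show ?thesis using finite_cosets by simp
qed

text \<open>The classical Schreier generator attached to the edge from the coset of \<open>g\<close>
  to the coset of \<open>g \<otimes> s\<close>.\<close>

definition sgen :: "'a \<Rightarrow> 'a \<Rightarrow> 'a" where
  "sgen g s = rep g \<otimes> s \<otimes> inv (rep (g \<otimes> s))"

definition schreier :: "'a set" where
  "schreier = (\<lambda>(g, s). sgen g s) ` (transversal \<times> S)"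

lemma rep_mult_right: "g \<in> carrier G \<Longrightarrow> s \<in> carrier G \<Longrightarrow> rep (rep g \<otimes> s) = rep (g \<otimes> s)"
proof -
  assume gs: "g \<in> carrier G" "s \<in> carrier G"
  obtain k where "k \<in> K" "g = k \<otimes> rep g" using rep_eq[OF gs(1)] by blast
  then show ?thesis using rep_mult[of k "rep g \<otimes> s"] gs by (metis K.mem_carrier m_assoc m_closed rep_closed)
qed

lemma rep_rep [simp]: "g \<in> carrier G \<Longrightarrow> rep (rep g) = rep g"
  using rep_mult_right[of g \<one>] by simp

lemma sgen_in_schreier: "g \<in> carrier G \<Longrightarrow> s \<in> S \<Longrightarrow> sgen g s \<in> schreier"
  unfolding schreier_def transversal_def
  by (rule image_eqI[of _ _ "(rep g, s)"]) (auto simp: sgen_def rep_mult_right)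

lemma finite_schreier: "finite S \<Longrightarrow> finite schreier"
  unfolding schreier_def using finite_transversal by simp

lemma schreier_subset: "schreier \<subseteq> K"
proof -
  have "sgen g s \<in> K" if g: "g \<in> carrier G" and s: "s \<in> S" for g s
    using rep_inv[of "rep g \<otimes> s"] g s by (simp add: sgen_def rep_mult_right)
  then show ?thesis by (auto simp: schreier_def transversal_def)
qed

text \<open>An inverse letter runs backwards along the Schreier edge that starts at
  \<open>g \<otimes> inv s\<close>; this makes rewriting compatible with inversion, see
  \<open>rletter_linv\<close>.\<close>

definition rletter :: "'a \<Rightarrow> 'a \<times> bool \<Rightarrow> 'a \<times> bool" where
  "rletter g x = (if snd x then (sgen g (fst x), True) else (sgen (g \<otimes> inv (fst x)) (fst x), False))"

primrec rewrite :: "'a \<Rightarrow> ('a \<times> bool) list \<Rightarrow> ('a \<times> bool) list" where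
  "rewrite g [] = []"
| "rewrite g (x # w) = rletter g x # rewrite (g \<otimes> letter_value G x) w"

lemma rletter_in: "g \<in> carrier G \<Longrightarrow> x \<in> S \<times> UNIV \<Longrightarrow> rletter g x \<in> schreier \<times> UNIV"
  by (cases x) (auto simp: rletter_def sgen_in_schreier)

lemma rletter_value:
  assumes g: "g \<in> carrier G" and x: "x \<in> S \<times> UNIV"
  shows "letter_value G (rletter g x) = rep g \<otimes> letter_value G x \<otimes> inv (rep (g \<otimes> letter_value G x))"
proof -
  obtain s b where sb: "x = (s, b)" "s \<in> carrier G" using x by (cases x) auto
  then show ?thesis using g
    by (cases b) (simp_all add: rletter_def letter_value_def sgen_def inv_mult_group m_assoc)
qed

lemma rletter_linv:
  assumes g: "g \<in> carrier G" and x: "x \<in> S \<times> UNIV"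
  shows "rletter (g \<otimes> letter_value G x) (linv x) = linv (rletter g x)"
proof -
  obtain s b where sb: "x = (s, b)" "s \<in> carrier G" using x by (cases x) auto
  then show ?thesis using g
    by (cases b) (simp_all add: rletter_def letter_value_def m_assoc)
qed

lemma rletter_mult:
  assumes k: "k \<in> K" and g: "g \<in> carrier G" and x: "x \<in> S \<times> UNIV"
  shows "rletter (k \<otimes> g) x = rletter g x"
proof -
  obtain s b where sb: "x = (s, b)" "s \<in> carrier G" using x by (cases x) auto
  then show ?thesis using g k
    by (simp add: rletter_def sgen_def m_assoc rep_mult)
qed

lemma rewrite_in: "w \<in> lists (S \<times> UNIV) \<Longrightarrow> g \<in> carrier G \<Longrightarrow> rewrite g w \<in> lists (schreier \<times> UNIV)"
proof (induction w arbitrary: g rule: list.induct)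
  case (Cons x w)
  then have x: "x \<in> S \<times> UNIV" by auto
  from Cons show ?case
    using rletter_in[OF Cons.prems(2) x] letter_value_closed[OF S_subset x] by auto
qed simp

lemma rewrite_append:
  assumes "u \<in> lists (S \<times> UNIV)" "w \<in> lists (S \<times> UNIV)" "g \<in> carrier G"
  shows "rewrite g (u @ w) = rewrite g u @ rewrite (g \<otimes> word_value G u) w"
  using assms(1,3)
proof (induction u arbitrary: g rule: list.induct)
  case (Cons x u)
  then have x: "x \<in> S \<times> UNIV" and u: "u \<in> lists (S \<times> UNIV)" by auto
  note cl = letter_value_closed[OF S_subset x] word_value_closed[OF S_subset u]
  have "rewrite (g \<otimes> letter_value G x) (u @ w) =
      rewrite (g \<otimes> letter_value G x) u @ rewrite (g \<otimes> letter_value G x \<otimes> word_value G u) w"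
    by (rule Cons.IH[OF u]) (use Cons.prems(2) cl in simp)
  then show ?case using Cons.prems(2) cl by (simp add: m_assoc)
qed simp

lemma rewrite_mult:
  assumes "w \<in> lists (S \<times> UNIV)" "g \<in> carrier G" "k \<in> K"
  shows "rewrite (k \<otimes> g) w = rewrite g w"
  using assms(1,2)
proof (induction w arbitrary: g rule: list.induct)
  case (Cons x w)
  then have x: "x \<in> S \<times> UNIV" and w: "w \<in> lists (S \<times> UNIV)" by auto
  note cl = letter_value_closed[OF S_subset x]
  then show ?case
    using Cons.IH[OF w, of "g \<otimes> letter_value G x"] Cons.prems(2) assms(3) rletter_mult[OF assms(3) Cons.prems(2) x]
    by (simp add: m_assoc)
qed simp

lemma rewrite_rep:
  assumes "w \<in> lists (S \<times> UNIV)" "g \<in> carrier G"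
  shows "rewrite (rep g) w = rewrite g w"
proof -
  obtain k where "k \<in> K" "g = k \<otimes> rep g" using rep_eq[OF assms(2)] by blast
  then show ?thesis using rewrite_mult[OF assms(1) rep_closed[OF assms(2)]] by metis
qed

text \<open>The product of Schreier generators telescopes, leaving only the representatives at both
  ends.\<close>

lemma rewrite_value:
  assumes "w \<in> lists (S \<times> UNIV)" "g \<in> carrier G"
  shows "word_value G (rewrite g w) = rep g \<otimes> word_value G w \<otimes> inv (rep (g \<otimes> word_value G w))"
  using assms
proof (induction w arbitrary: g rule: list.induct)
  case (Cons x w)
  then have x: "x \<in> S \<times> UNIV" and w: "w \<in> lists (S \<times> UNIV)" by auto
  note cl = letter_value_closed[OF S_subset x] word_value_closed[OF S_subset w]
  have g: "g \<in> carrier G" using Cons.prems by simp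
  have r: "inv (rep (g \<otimes> letter_value G x)) \<otimes> (rep (g \<otimes> letter_value G x) \<otimes> z) = z"
    if "z \<in> carrier G" for z
    using cl g that by (simp add: m_assoc[symmetric])
  show ?case
    using cl g Cons.IH[OF w, of "g \<otimes> letter_value G x"] rletter_value[OF g x]
    by (simp add: m_assoc r)
qed simp

lemma rewrite_one_value:
  assumes "w \<in> lists (S \<times> UNIV)" "word_value G w \<in> K"
  shows "word_value G (rewrite \<one> w) = word_value G w"
  using rewrite_value[OF assms(1), of \<one>] assms(2) by simp

lemma schreier_generates: "generates (G\<lparr>carrier := K\<rparr>) schreier"
proof (rule generates_subgroupI[OF K schreier_subset])
  fix k assume k: "k \<in> K"
  obtain w where w: "w \<in> lists (S \<times> UNIV)" "word_value G w = k"
    using word_value_surj[OF S, of k] k by auto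
  then show "\<exists>w\<in>lists (schreier \<times> UNIV). word_value G w = k"
    using rewrite_in[OF w(1)] rewrite_one_value[OF w(1)] k by auto
qed

definition spell :: "'a \<Rightarrow> ('a \<times> bool) list" where
  "spell a = (SOME w. w \<in> lists (S \<times> UNIV) \<and> word_value G w = a)"

lemma spell: "a \<in> carrier G \<Longrightarrow> spell a \<in> lists (S \<times> UNIV) \<and> word_value G (spell a) = a"
  unfolding spell_def by (rule someI_ex) (metis word_value_surj[OF S])

definition respell :: "'a \<times> bool \<Rightarrow> ('a \<times> bool) list" where
  "respell x = (if snd x then spell (fst x) else rev (map linv (spell (fst x))))"

lemma respell:
  assumes "x \<in> schreier \<times> UNIV"
  shows "respell x \<in> lists (S \<times> UNIV) \<and> word_value G (respell x) = letter_value G x"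
proof -
  have "fst x \<in> carrier G" using assms schreier_subset K.subset by auto
  note sp = spell[OF this]
  then have "rev (map linv (spell (fst x))) \<in> lists (S \<times> UNIV)" by auto
  then show ?thesis using sp word_value_rev[OF S_subset, of "spell (fst x)"]
    by (simp add: respell_def letter_value_def del: in_lists_conv_set)
qed

text \<open>The second family of relators expresses each Schreier generator through its own
  rewriting, so no transversal closed under prefixes is needed.\<close>

definition relators :: "('a \<times> bool) list set \<Rightarrow> ('a \<times> bool) list set" where
  "relators R = (\<lambda>(g, r). rewrite g r) ` (transversal \<times> R) \<union>
    (\<lambda>a. (a, False) # rewrite \<one> (spell a)) ` schreier"

lemma rewrite_linv:
  "w \<in> lists (S \<times> UNIV) \<Longrightarrow> g \<in> carrier G \<Longrightarrow>
    rewrite (g \<otimes> word_value G w) (rev (map linv w)) = rev (map linv (rewrite g w))"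
proof (induction w arbitrary: g rule: list.induct)
  case (Cons x w)
  then have x: "x \<in> S \<times> UNIV" "[linv x] \<in> lists (S \<times> UNIV)" and w: "w \<in> lists (S \<times> UNIV)"
    "rev (map linv w) \<in> lists (S \<times> UNIV)" by auto
  note cl = letter_value_closed[OF S_subset x(1)] word_value_closed[OF S_subset w(1)]
  have g: "g \<in> carrier G" using Cons.prems by simp
  have "rewrite (g \<otimes> word_value G (x # w)) (rev (map linv (x # w))) =
    rewrite (g \<otimes> letter_value G x \<otimes> word_value G w) (rev (map linv w)) @
    rewrite (g \<otimes> letter_value G x \<otimes> word_value G w \<otimes> word_value G (rev (map linv w))) [linv x]"
    using rewrite_append[OF w(2) x(2), of "g \<otimes> word_value G (x # w)"] cl g
    by (simp add: m_assoc)
  also have "g \<otimes> letter_value G x \<otimes> word_value G w \<otimes> word_value G (rev (map linv w)) = g \<otimes> letter_value G x"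
    using word_value_rev[OF S_subset w(1)] cl g by (simp add: m_assoc)
  also have "rewrite (g \<otimes> letter_value G x) [linv x] = [linv (rletter g x)]"
    using rletter_linv[OF g x(1)] by simp
  finally show ?case
    using Cons.IH[OF w(1), of "g \<otimes> letter_value G x"] cl g by simp
qed simp

text \<open>For a positive letter this is a relator of the second family. For an inverse letter the
  rewritten word is inverted, and starting it at \<open>a\<close> rather than at
  \<open>\<one>\<close> makes no difference because \<open>a \<in> K\<close>.\<close>

lemma word_eq_respell:
  assumes x: "x \<in> schreier \<times> UNIV"
  shows "word_eq (schreier \<times> UNIV) linv (relators R) [x] (rewrite \<one> (respell x))"
proof -
  obtain a b where ab: "x = (a, b)" "a \<in> schreier" using x by auto
  then have a: "a \<in> K" "a \<in> carrier G" using schreier_subset K.subset by auto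
  let ?eq = "word_eq (schreier \<times> UNIV) linv (relators R)"
  let ?u = "rewrite \<one> (spell a)"
  have rel: "?eq ([(a, False)] @ ?u) []"
    using ab by (intro word_eq_relator) (auto simp: relators_def)
  have u: "?u \<in> lists (schreier \<times> UNIV)" using rewrite_in spell[OF a(2)] by blast
  show ?thesis
  proof (cases b)
    case True
    have "?eq [(a, True)] ([(a, True)] @ ([(a, False)] @ ?u))"
      using word_eq_append[OF word_eq_refl word_eq_sym[OF rel], of "[(a, True)]"] by simp
    also have "?eq \<dots> ([] @ ?u)"
    proof -
      have "?eq [(a, True), linv (a, True)] []" using ab by (intro word_eq_cancel) simp
      from word_eq_append[OF this word_eq_refl, of ?u] show ?thesis by simp
    qed
    finally show ?thesis using True ab by (simp add: respell_def)
  next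
    case False
    have "?eq [(a, False)] ([(a, False)] @ (?u @ rev (map linv ?u)))"
      using word_eq_append[OF word_eq_refl[of "schreier \<times> UNIV" linv "relators R" "[(a, False)]"]
          word_eq_sym[OF word_eq_inverse[OF u]]] by simp
    also have "?eq \<dots> ([] @ rev (map linv ?u))"
      using word_eq_append[OF rel word_eq_refl, of "rev (map linv ?u)"] by simp
    also have "[] @ rev (map linv ?u) = rewrite \<one> (rev (map linv (spell a)))"
    proof -
      have sp: "rev (map linv (spell a)) \<in> lists (S \<times> UNIV)" using spell[OF a(2)] by auto
      have "rewrite (a \<otimes> \<one>) (rev (map linv (spell a))) = rewrite \<one> (rev (map linv (spell a)))"
        by (rule rewrite_mult[OF sp _ a(1)]) simp
      then show ?thesis using rewrite_linv[of "spell a" \<one>] spell[OF a(2)] a by simp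
    qed
    finally show ?thesis using False ab by (simp add: respell_def)
  qed
qed

lemma respell_word:
  assumes "w \<in> lists (schreier \<times> UNIV)"
  shows "concat (map respell w) \<in> lists (S \<times> UNIV)"
    and "word_value G (concat (map respell w)) = word_value G w"
    and "word_eq (schreier \<times> UNIV) linv (relators R) w (rewrite \<one> (concat (map respell w)))"
proof -
  have "concat (map respell w) \<in> lists (S \<times> UNIV) \<and>
    word_value G (concat (map respell w)) = word_value G w \<and>
    word_eq (schreier \<times> UNIV) linv (relators R) w (rewrite \<one> (concat (map respell w)))"
    using assms
  proof (induction w rule: list.induct)
    case (Cons x w)
    then have x: "x \<in> schreier \<times> UNIV" and w: "w \<in> lists (schreier \<times> UNIV)" by auto
    note IH = Cons.IH[OF w] and rx = respell[OF x]
    have "letter_value G x \<in> K"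
      using x schreier_subset by (cases x) (auto simp: letter_value_def)
    then have "rewrite (letter_value G x \<otimes> \<one>) (concat (map respell w)) = rewrite \<one> (concat (map respell w))"
      using IH by (intro rewrite_mult) auto
    moreover have "letter_value G x \<in> carrier G" using \<open>letter_value G x \<in> K\<close> by simp
    ultimately have "rewrite \<one> (concat (map respell (x # w))) =
        rewrite \<one> (respell x) @ rewrite \<one> (concat (map respell w))"
      using rewrite_append[of "respell x" "concat (map respell w)" \<one>] IH rx
      by (simp del: in_lists_conv_set)
    moreover have "word_eq (schreier \<times> UNIV) linv (relators R) ([x] @ w)
        (rewrite \<one> (respell x) @ rewrite \<one> (concat (map respell w)))"
      using IH by (intro word_eq_append word_eq_respell[OF x]) auto
    ultimately show ?case
      using IH rx word_value_append[OF S_subset, of "respell x" "concat (map respell w)"]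
      by (auto simp del: in_lists_conv_set simp: in_listsI)
  qed simp
  then show "concat (map respell w) \<in> lists (S \<times> UNIV)"
    and "word_value G (concat (map respell w)) = word_value G w"
    and "word_eq (schreier \<times> UNIV) linv (relators R) w (rewrite \<one> (concat (map respell w)))"
    by blast+
qed

text \<open>Rewriting turns a cancelling pair into a cancelling pair and a relator into a relator of
  the first family, up to replacing the base point by its representative. The hypothesis
  \<open>uv\<close> is a disjunction because steps are used in both directions along a chain, where
  only the word already reached is known to be over \<open>S\<close>.\<close>

lemma rewrite_word_step:
  assumes R: "\<And>r. r \<in> R \<Longrightarrow> r \<in> lists (S \<times> UNIV) \<and> word_value G r = \<one>"
    and step: "word_step (S \<times> UNIV) linv R u v" and uv: "u \<in> lists (S \<times> UNIV) \<or> v \<in> lists (S \<times> UNIV)"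
    and g: "g \<in> carrier G"
  shows "u \<in> lists (S \<times> UNIV) \<and> v \<in> lists (S \<times> UNIV) \<and>
    word_eq (schreier \<times> UNIV) linv (relators R) (rewrite g u) (rewrite g v)"
proof -
  have main: "p \<in> lists (S \<times> UNIV) \<Longrightarrow> q \<in> lists (S \<times> UNIV) \<Longrightarrow>
    word_eq (schreier \<times> UNIV) linv (relators R) (rewrite g (p @ r @ q)) (rewrite g (p @ q))"
    if r: "r \<in> lists (S \<times> UNIV)" "word_value G r = \<one>"
      "\<And>h. h \<in> carrier G \<Longrightarrow> word_eq (schreier \<times> UNIV) linv (relators R) (rewrite h r) []" for p q r
  proof -
    assume p: "p \<in> lists (S \<times> UNIV)" and q: "q \<in> lists (S \<times> UNIV)"
    let ?h = "g \<otimes> word_value G p"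
    have h: "?h \<in> carrier G" using g word_value_closed[OF S_subset p] by simp
    have rq: "r @ q \<in> lists (S \<times> UNIV)" using r q by auto
    have "rewrite g (p @ r @ q) = rewrite g p @ rewrite ?h r @ rewrite ?h q"
      using rewrite_append[OF p rq g] rewrite_append[OF r(1) q h] r(2) h by simp
    moreover have "rewrite g (p @ q) = rewrite g p @ [] @ rewrite ?h q"
      using rewrite_append[OF p q g] by simp
    ultimately show ?thesis using word_eq_context[OF r(3)[OF h]] by simp
  qed
  from step show ?thesis
  proof cases
    case (cancel x p q)
    have x: "x \<in> S \<times> UNIV" "[x] \<in> lists (S \<times> UNIV)" "[x, linv x] \<in> lists (S \<times> UNIV)" using cancel by auto
    have "word_value G [x, linv x] = \<one>"
      using letter_value_linv[OF S_subset x(1)] letter_value_closed[OF S_subset x(1)] by simp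
    moreover have "word_eq (schreier \<times> UNIV) linv (relators R) (rewrite h [x, linv x]) []"
      if "h \<in> carrier G" for h
      using rletter_linv[OF that x(1)] word_eq_cancel[OF rletter_in[OF that x(1)], of linv] by simp
    ultimately show ?thesis using main[OF x(3), of p q] uv cancel by auto
  next
    case (relator r p q)
    have r: "r \<in> lists (S \<times> UNIV)" "word_value G r = \<one>" using R relator by auto
    have "word_eq (schreier \<times> UNIV) linv (relators R) (rewrite h r) []" if h: "h \<in> carrier G" for h
    proof (rule word_eq_relator)
      show "rewrite h r \<in> relators R"
        using rewrite_rep[OF r(1) h] relator h unfolding relators_def transversal_def
        by (intro UnI1 image_eqI[of _ _ "(rep h, r)"]) auto
    qed
    then show ?thesis using main[OF r, of p q] uv relator r by auto
  qed
qed

text \<open>A trivial word in the Schreier generators equals, by the second family of relators, the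
  rewriting of its respelling over \<open>S\<close>. The respelling is null in \<open>G\<close>, and
  rewriting its derivation step by step from \<open>\<one>\<close> uses only
  \<open>relators R\<close>.\<close>

lemma presented_by_schreier:
  assumes "presented_by G S R"
  shows "presented_by (G\<lparr>carrier := K\<rparr>) schreier (relators R)"
proof -
  let ?L = "lists (S \<times> UNIV)" and ?L' = "lists (schreier \<times> UNIV)"
  let ?eq = "word_eq (schreier \<times> UNIV) linv (relators R)"
  have R: "r \<in> ?L \<and> word_value G r = \<one>" if "r \<in> R" for r
    using assms that by (simp add: presented_by_def del: in_lists_conv_set)
  have vK: "word_value (G\<lparr>carrier := K\<rparr>) w = word_value G w" if "w \<in> ?L'" for w
    by (rule word_value_subgroup[OF K schreier_subset that])
  have rel: "r \<in> ?L' \<and> word_value G r = \<one>" if r: "r \<in> relators R" for r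
    using r unfolding relators_def
  proof
    assume "r \<in> (\<lambda>(g, r). rewrite g r) ` (transversal \<times> R)"
    then obtain g q where gq: "g \<in> carrier G" "q \<in> R" "r = rewrite (rep g) q"
      by (auto simp: transversal_def)
    then show ?thesis
      using rewrite_in[of q "rep g"] rewrite_value[of q "rep g"] R[OF gq(2)]
      by (simp del: in_lists_conv_set)
  next
    assume "r \<in> (\<lambda>a. (a, False) # rewrite \<one> (spell a)) ` schreier"
    then obtain a where a: "a \<in> schreier" "r = (a, False) # rewrite \<one> (spell a)" by auto
    then have aK: "a \<in> K" "a \<in> carrier G" using schreier_subset K.subset by auto
    note sp = spell[OF aK(2)]
    have "rewrite \<one> (spell a) \<in> ?L'" using rewrite_in sp by blast
    then show ?thesis
      using a aK rewrite_one_value[of "spell a"] sp by (simp add: letter_value_def)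
  qed
  have eq: "?eq w []" if w: "w \<in> ?L'" "word_value G w = \<one>" for w
  proof -
    note rs = respell_word[OF w(1)]
    let ?v = "concat (map respell w)"
    have "equivclp (word_step (S \<times> UNIV) linv R) ?v []"
      using assms rs(1,2) w(2) unfolding presented_by_def word_eq_def by (simp del: in_lists_conv_set)
    moreover have "z \<in> ?L \<and> ?eq (rewrite \<one> ?v) (rewrite \<one> z)"
      if "equivclp (word_step (S \<times> UNIV) linv R) ?v z" for z
      using that
    proof (induction rule: equivclp_induct)
      case base
      then show ?case using rs(1) by simp
    next
      case (step y z)
      have IH: "y \<in> ?L" "?eq (rewrite \<one> ?v) (rewrite \<one> y)"
        using step.IH by (simp_all only: conjunct1 conjunct2)
      from step(2) have "z \<in> ?L \<and> ?eq (rewrite \<one> y) (rewrite \<one> z)"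
      proof
        assume "word_step (S \<times> UNIV) linv R y z"
        from rewrite_word_step[OF R this disjI1[OF IH(1)] one_closed] show ?thesis by blast
      next
        assume "word_step (S \<times> UNIV) linv R z y"
        from rewrite_word_step[OF R this disjI2[OF IH(1)] one_closed] show ?thesis
          using word_eq_sym by blast
      qed
      with IH(2) show ?case using word_eq_trans by blast
    qed
    ultimately have "?eq (rewrite \<one> ?v) (rewrite \<one> [])" by blast
    then show ?thesis using word_eq_trans[OF rs(3)] by simp
  qed
  show ?thesis
    unfolding presented_by_def using schreier_generates rel eq vK
    by (simp del: in_lists_conv_set)
qed

end

lemma (in group) finite_index_fg:
  assumes "subgroup K G" "finite (rcosets K)" "finite S" "generates G S"
  obtains A where "finite A" "generates (G\<lparr>carrier := K\<rparr>) A"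
proof -
  interpret finite_index G K S by (intro finite_index.intro finite_index_axioms.intro group_axioms assms)
  show ?thesis using that[OF finite_schreier[OF assms(3)] schreier_generates] .
qed

lemma (in group) finite_index_finitely_presented:
  assumes "subgroup K G" "finite (rcosets K)" "finite S" "finite R" "presented_by G S R"
  shows "finitely_presented (G\<lparr>carrier := K\<rparr>)"
proof -
  interpret finite_index G K S 
    by (intro finite_index.intro finite_index_axioms.intro group_axioms assms(1,2))
      (use assms(5) in \<open>simp add: presented_by_def\<close>)
  have "finite (relators R)"
    unfolding relators_def using assms finite_transversal finite_schreier by auto
  then show ?thesis
    unfolding finitely_presented_def
    using subgroup_imp_group[OF K] finite_schreier[OF assms(3)] presented_by_schreier[OF assms(5)] by blast
qed

section \<open>Limits over normal subgroups of finite index\<close>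

context group
begin

lemma coset_eq_iff:
  assumes "subgroup K G" "g \<in> carrier G" "h \<in> carrier G"
  shows "K #> g = K #> h \<longleftrightarrow> g \<otimes> inv h \<in> K"
proof
  note sub = subgroup.subset[OF assms(1)]
  assume "K #> g = K #> h"
  from coset_mult_inv2[OF this assms(2,3) sub] show "g \<otimes> inv h \<in> K"
    by (rule coset_join1) (use assms in simp_all)
next
  note sub = subgroup.subset[OF assms(1)]
  assume "g \<otimes> inv h \<in> K"
  then have "K #> (g \<otimes> inv h) = K" by (intro coset_join2) (use assms in simp_all)
  from coset_mult_inv1[OF this assms(2,3) sub] show "K #> g = K #> h" .
qed

text \<open>Choosing one preimage for each value of \<open>f\<close> meets every coset. The index
  estimates below are obtained by finding a suitable \<open>f\<close>.\<close>

lemma rcosets_bound: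
  assumes K: "subgroup K G" and fin: "finite (f ` carrier G)"
    and f: "\<And>g h. g \<in> carrier G \<Longrightarrow> h \<in> carrier G \<Longrightarrow> f g = f h \<Longrightarrow> g \<otimes> inv h \<in> K"
  shows "finite (rcosets K)" "card (rcosets K) \<le> card (f ` carrier G)"
proof -
  have "rcosets K \<subseteq> (\<lambda>y. K #> inv_into (carrier G) f y) ` (f ` carrier G)"
  proof
    fix C assume "C \<in> rcosets K"
    then obtain g where g: "g \<in> carrier G" "C = K #> g" by (auto simp: RCOSETS_def)
    let ?h = "inv_into (carrier G) f (f g)"
    have "?h \<in> carrier G" "f ?h = f g"
      using g by (auto intro: inv_into_into f_inv_into_f)
    then have "C = K #> ?h" using g f coset_eq_iff[OF K] by simp
    then show "C \<in> (\<lambda>y. K #> inv_into (carrier G) f y) ` (f ` carrier G)" using g by blast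
  qed
  then show "finite (rcosets K)" "card (rcosets K) \<le> card (f ` carrier G)"
    using fin by (auto intro: finite_subset dest: surj_card_le[rotated])
qed

lemma fin_index_normalD:
  assumes "N \<in> fin_index_normal G"
  shows "N \<lhd> G" "subgroup N G" "finite (rcosets N)" "index G N > 0"
proof -
  show N: "N \<lhd> G" and fin: "finite (rcosets N)" using assms by (auto simp: fin_index_normal_def)
  then show sub: "subgroup N G" using normal_imp_subgroup by blast
  then show "index G N > 0"
    using fin subgroup.subgroup_in_rcosets[OF sub is_group] by (auto simp: index_def card_gt_0_iff)
qed

lemma carrier_fin_index: "carrier G \<in> fin_index_normal G"
proof -
  have "rcosets (carrier G) \<subseteq> {carrier G}"
    using coset_join2[OF _ subgroup_self] by (auto simp: RCOSETS_def)
  then show ?thesis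
    using finite_subset normal_self by (auto simp: fin_index_normal_def)
qed

lemma fin_index_normal_inter:
  assumes "N \<in> fin_index_normal G" "M \<in> fin_index_normal G"
  shows "N \<inter> M \<in> fin_index_normal G"
proof -
  note N = fin_index_normalD[OF assms(1)] and M = fin_index_normalD[OF assms(2)]
  have NM: "N \<inter> M \<lhd> G" using normal_subgroup_intersect N M by blast
  have "finite (rcosets (N \<inter> M))"
  proof (rule rcosets_bound(1)[where f = "\<lambda>g. (N #> g, M #> g)"])
    show "subgroup (N \<inter> M) G" using NM normal_imp_subgroup by blast
    show "finite ((\<lambda>g. (N #> g, M #> g)) ` carrier G)"
      by (rule finite_subset[of _ "(rcosets N) \<times> (rcosets M)"]) (use N M in \<open>auto simp: RCOSETS_def\<close>)
  qed (use coset_eq_iff N M in auto)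
  with NM show ?thesis by (simp add: fin_index_normal_def)
qed

lemma countable_carrier:
  assumes "finite S" "generates G S"
  shows "countable (carrier G)"
proof -
  have "carrier G \<subseteq> word_value G ` lists (S \<times> UNIV)"
    using word_value_surj[OF assms(2)] by blast
  moreover have "countable (word_value G ` lists (S \<times> UNIV))"
    using assms(1) by (intro countable_image countable_lists countable_finite) simp
  ultimately show ?thesis by (rule countable_subset)
qed

text \<open>Subgroups of finite index are finitely generated, hence determined by finite subsets of
  a countable set.\<close>

lemma countable_fin_index_normal:
  assumes "finite S" "generates G S"
  shows "countable (fin_index_normal G)"
proof -
  have "fin_index_normal G \<subseteq> (\<lambda>A. word_value G ` lists (A \<times> UNIV)) ` {A. finite A \<and> A \<subseteq> carrier G}"
  proof
    fix N assume "N \<in> fin_index_normal G"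
    note N = fin_index_normalD[OF this]
    obtain A where A: "finite A" "generates (G\<lparr>carrier := N\<rparr>) A"
      using finite_index_fg[OF N(2,3) assms] .
    interpret N: group "G\<lparr>carrier := N\<rparr>" using subgroup_imp_group[OF N(2)] .
    have AN: "A \<subseteq> N" using A by (simp add: generates_def)
    have "N = word_value G ` lists (A \<times> UNIV)"
    proof (intro equalityI subsetI)
      fix n assume "n \<in> N"
      then have "n \<in> carrier (G\<lparr>carrier := N\<rparr>)" by simp
      then obtain w where w: "w \<in> lists (A \<times> UNIV)" "word_value (G\<lparr>carrier := N\<rparr>) w = n"
        by (rule N.word_value_surj[OF A(2)])
      then have "n = word_value G w" using word_value_subgroup[OF N(2) AN w(1)] by simp
      then show "n \<in> word_value G ` lists (A \<times> UNIV)" using w(1) by (rule image_eqI)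
    next
      fix n assume "n \<in> word_value G ` lists (A \<times> UNIV)"
      then obtain w where w: "n = word_value G w" "w \<in> lists (A \<times> UNIV)" by (rule imageE)
      then show "n \<in> N"
        using N.word_value_closed[of A w] AN word_value_subgroup[OF N(2) AN w(2)] by simp
    qed
    moreover have "A \<in> {A. finite A \<and> A \<subseteq> carrier G}"
      using A AN subgroup.subset[OF N(2)] by simp
    ultimately show "N \<in> (\<lambda>A. word_value G ` lists (A \<times> UNIV)) ` {A. finite A \<and> A \<subseteq> carrier G}"
      by (rule image_eqI)
  qed
  moreover have "countable ((\<lambda>A. word_value G ` lists (A \<times> UNIV)) ` {A. finite A \<and> A \<subseteq> carrier G})"
    by (rule countable_image[OF countable_Collect_finite_subset[OF countable_carrier[OF assms]]])
  ultimately show ?thesis by (rule countable_subset)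
qed

text \<open>There are only countably many subgroups of finite index, so some chain is cofinal; along
  it a subsequence converges by compactness.\<close>

lemma normal_limsup_lower_bound:
  assumes S: "finite S" "generates G S"
    and bound: "\<And>N. N \<in> fin_index_normal G \<Longrightarrow> c \<le> C N / of_nat (index G N)"
  shows "c \<le> normal_limsup G C"
proof -
  let ?F = "fin_index_normal G"
  define N where "N = from_nat_into ?F"
  define K where "K n = (\<Inter>i\<le>n. N i)" for n :: nat
  define a where "a n = C (K n) / of_nat (index G (K n))" for n
  have ne: "?F \<noteq> {}" using carrier_fin_index by blast
  have N: "N i \<in> ?F" for i using from_nat_into[OF ne] by (simp add: N_def)
  have surj: "\<exists>i. M = N i" if "M \<in> ?F" for M
    using from_nat_into_surj[OF countable_fin_index_normal[OF S] that] by (auto simp: N_def)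
  have K: "K n \<in> ?F" for n
  proof (induction n)
    case (Suc n)
    have "K (Suc n) = N (Suc n) \<inter> K n" by (auto simp: K_def atMost_Suc)
    then show ?case using fin_index_normal_inter[OF N Suc] by simp
  qed (simp add: K_def N)
  have anti: "K n \<subseteq> K m" if "m \<le> n" for m n using that by (force simp: K_def)
  obtain l r where r: "strict_mono r" and l: "(a \<circ> r) \<longlonglongrightarrow> l"
    using compact_complete_linorder[of a] by blast
  define KK where "KK = range (K \<circ> r)"
  have cof: "cofinal_family G KK"
    unfolding cofinal_family_def
  proof (intro conjI ballI)
    show "KK \<subseteq> ?F" using K by (auto simp: KK_def)
    fix M assume "M \<in> ?F"
    then obtain i where "M = N i" using surj by blast
    \<comment> \<open>A strictly increasing sequence satisfies \<open>i \<le> r i\<close>, so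
      \<open>N i\<close> occurs in the intersection \<open>K (r i)\<close>.\<close>
    moreover have "K (r i) \<subseteq> N i" using seq_suble[OF r, of i] by (auto simp: K_def)
    ultimately show "\<exists>L\<in>KK. L \<subseteq> M" by (auto simp: KK_def)
  qed
  have lim: "((\<lambda>L. C L / of_nat (index G L)) \<longlongrightarrow> l) (deep_subgroups KK)"
  proof (rule topological_tendstoI)
    fix U assume U: "open U" "l \<in> U"
    then obtain J where J: "\<And>j. j \<ge> J \<Longrightarrow> a (r j) \<in> U"
      using topological_tendstoD[OF l] by (auto simp: eventually_sequentially)
    have "C L / of_nat (index G L) \<in> U" if L: "L \<in> KK" "L \<subseteq> K (r J)" for L
    proof -
      obtain j where j: "L = K (r j)" using L by (auto simp: KK_def)
      \<comment> \<open>If \<open>j < J\<close>, then \<open>L\<close> contains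
        \<open>K (r J)\<close> because the chain decreases and is contained in it by assumption, so
        the two agree and the index may be raised to \<open>J\<close>.\<close>
      have "L = K (r (max j J))"
      proof (cases "J \<le> j")
        case False
        then have "K (r J) \<subseteq> K (r j)" using strict_mono_less_eq[OF r] by (intro anti) simp
        then show ?thesis using j L(2) False by (simp add: max_def)
      qed (simp add: j max_def)
      then show ?thesis using J[of "max j J"] by (simp add: a_def)
    qed
    then have "eventually (\<lambda>L. C L / of_nat (index G L) \<in> U) (principal {L \<in> KK. L \<subseteq> K (r J)})"
      by (simp add: eventually_principal)
    then show "eventually (\<lambda>L. C L / of_nat (index G L) \<in> U) (deep_subgroups KK)"
      unfolding deep_subgroups_def by (rule eventually_INF1[rotated]) (auto simp: KK_def)
  qed
  have "c \<le> l"
    by (rule LIMSEQ_le_const[OF l]) (use bound K in \<open>auto simp: a_def\<close>)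
  also have "l \<le> normal_limsup G C"
    unfolding normal_limsup_def using cof lim by (intro Sup_upper) auto
  finally show ?thesis .
qed

end

section \<open>Trees\<close>

text \<open>Reachability within an edge set is expressed by closures of this relation rather than by
  walks, because deleting, translating and adding edges then only changes \<open>A\<close>.\<close>

definition steps :: "('v, 'e) pre_digraph \<Rightarrow> 'e set \<Rightarrow> ('v \<times> 'v) set" where
  "steps X A = {(tail X e, head X e) | e. e \<in> A}"

lemma steps_mono: "A \<subseteq> B \<Longrightarrow> steps X A \<subseteq> steps X B"
  by (auto simp: steps_def)

lemma steps_rtrancl_mono: "(x, y) \<in> (steps X A)\<^sup>* \<Longrightarrow> A \<subseteq> B \<Longrightarrow> (x, y) \<in> (steps X B)\<^sup>*"
  using rtrancl_mono[OF steps_mono] by blast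

lemma stepsI: "e \<in> A \<Longrightarrow> (tail X e, head X e) \<in> steps X A"
  by (auto simp: steps_def)

lemma steps_rtranclI: "e \<in> A \<Longrightarrow> (tail X e, head X e) \<in> (steps X A)\<^sup>*"
  by (auto simp: steps_def)

text \<open>A connected graph is a tree iff every edge separates its endpoints.\<close>

locale tree = bidirected_digraph X \<iota> for X :: "('v, 'e) pre_digraph" and \<iota> +
  assumes nonempty: "verts X \<noteq> {}"
    and connected: "\<And>x y. x \<in> verts X \<Longrightarrow> y \<in> verts X \<Longrightarrow> (x, y) \<in> (steps X (arcs X))\<^sup>*"
    and separating: "\<And>e. e \<in> arcs X \<Longrightarrow> (head X e, tail X e) \<notin> (steps X (arcs X - {e, \<iota> e}))\<^sup>*"

lemma reduced_walk_iff: "reduced_walk \<iota> p \<longleftrightarrow> successively (\<lambda>x y. y \<noteq> \<iota> x) p"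
  unfolding reduced_walk_def successively_conv_nth by auto

context wf_digraph
begin

lemma steps_iff_awalk:
  assumes "A \<subseteq> arcs G" "u \<in> verts G"
  shows "(u, v) \<in> (steps G A)\<^sup>* \<longleftrightarrow> (\<exists>p. awalk u p v \<and> set p \<subseteq> A)"
proof
  assume "(u, v) \<in> (steps G A)\<^sup>*"
  then show "\<exists>p. awalk u p v \<and> set p \<subseteq> A"
    using assms(2)
  proof (induction rule: converse_rtrancl_induct)
    case base
    then show ?case by (intro exI[of _ "[]"]) (auto simp: awalk_Nil_iff)
  next
    case (step x y)
    then obtain e where e: "e \<in> A" "x = tail G e" "y = head G e" by (auto simp: steps_def)
    moreover have "y \<in> verts G" using e assms(1) by auto
    ultimately obtain p where "awalk y p v" "set p \<subseteq> A" using step by blast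
    then show ?case using e assms(1) by (intro exI[of _ "e # p"]) (auto simp: awalk_Cons_iff)
  qed
next
  assume "\<exists>p. awalk u p v \<and> set p \<subseteq> A"
  then obtain p where "awalk u p v" "set p \<subseteq> A" by blast
  then show "(u, v) \<in> (steps G A)\<^sup>*"
  proof (induction p arbitrary: u)
    case Nil
    then show ?case by (simp add: awalk_Nil_iff)
  next
    case (Cons e p)
    then have "(head G e, v) \<in> (steps G A)\<^sup>*" "e \<in> A" "u = tail G e" by (auto simp: awalk_Cons_iff)
    then show ?case using stepsI[of e A G] by (auto intro: converse_rtrancl_into_rtrancl)
  qed
qed

end

context bidirected_digraph
begin

lemma awalk_reduce:
  assumes "awalk u p v"
  shows "\<exists>q. awalk u q v \<and> set q \<subseteq> set p \<and> reduced_walk arev q"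
  using assms
proof (induction "length p" arbitrary: p rule: less_induct)
  case less
  show ?case
  proof (cases "reduced_walk arev p")
    case False
    then obtain i where i: "Suc i < length p" "p ! Suc i = arev (p ! i)"
      by (auto simp: reduced_walk_def)
    let ?e = "p ! i"
    have p: "p = take i p @ ?e # arev ?e # drop (Suc (Suc i)) p"
      using i by (metis Cons_nth_drop_Suc Suc_lessD append_take_drop_id)
    let ?q = "take i p @ drop (Suc (Suc i)) p"
    have "?e \<in> arcs G" using less.prems i nth_mem[of i p] by (auto simp: awalk_def)
    then have "awalk u ?q v"
      using less.prems by (subst (asm) p) (auto simp: awalk_simps)
    moreover have "length ?q < length p" using i by auto
    moreover have "set ?q \<subseteq> set p" by (auto dest: in_set_takeD in_set_dropD)
    ultimately show ?thesis using less.hyps[of ?q] by blast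
  qed (use less in blast)
qed

end

text \<open>If the endpoints of \<open>e\<close> stay connected after deleting \<open>e\<close>, a
  reduced path between them closes up with \<open>e\<close> to a reduced circuit. Conversely, a
  reduced circuit starting with \<open>e\<close> must use \<open>e\<close> or its inverse a second
  time, and cutting at that place gives a shorter reduced circuit.\<close>

lemma is_tree_iff: "is_tree X \<iota> \<longleftrightarrow> tree X \<iota>"
proof
  assume t: "is_tree X \<iota>"
  then interpret bidirected_digraph X \<iota> by (simp add: is_tree_def)
  show "tree X \<iota>"
  proof unfold_locales
    show "verts X \<noteq> {}" using t by (simp add: is_tree_def strongly_connected_def)
    show "(x, y) \<in> (steps X (arcs X))\<^sup>*" if "x \<in> verts X" "y \<in> verts X" for x y
    proof -
      have "x \<rightarrow>\<^sup>*\<^bsub>X\<^esub> y" using t that by (auto simp: is_tree_def)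
      then obtain p where "awalk x p y" by (auto simp: reachable_awalk)
      moreover from this have "set p \<subseteq> arcs X" by (simp add: awalk_def)
      ultimately show ?thesis using steps_iff_awalk[of "arcs X" x y] that by blast
    qed
    show "(head X e, tail X e) \<notin> (steps X (arcs X - {e, \<iota> e}))\<^sup>*" if e: "e \<in> arcs X" for e
    proof
      assume "(head X e, tail X e) \<in> (steps X (arcs X - {e, \<iota> e}))\<^sup>*"
      then obtain p where p: "awalk (head X e) p (tail X e)" "set p \<subseteq> arcs X - {e, \<iota> e}"
        using steps_iff_awalk[of "arcs X - {e, \<iota> e}" "head X e"] e by auto
      obtain q where q: "awalk (head X e) q (tail X e)" "set q \<subseteq> set p" "reduced_walk \<iota> q"
        using awalk_reduce[OF p(1)] by blast
      have "reduced_walk \<iota> (e # q)"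
        using q p by (cases q) (auto simp: reduced_walk_iff)
      moreover have "awalk (tail X e) (e # q) (tail X e)" using q e by (simp add: awalk_Cons_iff)
      ultimately show False using t by (auto simp: is_tree_def)
    qed
  qed
next
  assume "tree X \<iota>"
  then interpret tree X \<iota> .
  have "p = []" if "awalk v p v" "reduced_walk \<iota> p" for v p
    using that
  proof (induction "length p" arbitrary: v p rule: less_induct)
    case less
    show ?case
    proof (rule ccontr)
      assume "p \<noteq> []"
      then obtain e q where p: "p = e # q" by (cases p) auto
      then have e: "e \<in> arcs X" "v = tail X e" and q: "awalk (head X e) q (tail X e)"
        using less.prems by (auto simp: awalk_Cons_iff)
      have "\<exists>f \<in> {e, \<iota> e}. f \<in> set q"
        using separating[OF e(1)] steps_iff_awalk[of "arcs X - {e, \<iota> e}" "head X e" "tail X e"] q e by auto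
      then obtain f q1 q2 where f: "f \<in> {e, \<iota> e}" "q = q1 @ f # q2" by (meson split_list)
      then have q1: "awalk (head X e) q1 (tail X f)" using q by (auto simp: awalk_simps)
      show False
      proof (cases "f = e")
        case True
        then have "awalk v (e # q1) v" using q1 e by (simp add: awalk_Cons_iff)
        moreover have "reduced_walk \<iota> (e # q1)"
          using less.prems(2) p f unfolding reduced_walk_iff
          by (simp add: successively_append_iff flip: append_Cons)
        ultimately show False using less.hyps[of "e # q1" v] p f by simp
      next
        case False
        then have "f = \<iota> e" using f by simp
        then have "awalk (head X e) q1 (head X e)" using q1 e by simp
        \<comment> \<open>The piece is non-empty because \<open>e\<close> is not directly followed
          by its inverse.\<close>
        moreover have "reduced_walk \<iota> q1" "q1 \<noteq> []"
          using less.prems(2) p f \<open>f = \<iota> e\<close> unfolding reduced_walk_iff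
          by (auto simp: successively_append_iff successively_Cons)
        ultimately show False using less.hyps[of q1 "head X e"] p f by simp
      qed
    qed
  qed
  moreover have "strongly_connected X"
    using nonempty connected steps_iff_awalk[of "arcs X"] reachable_awalk
    by (intro strongly_connectedI) auto
  ultimately show "is_tree X \<iota>" by (auto simp: is_tree_def)
qed

context tree
begin

abbreviation "V \<equiv> verts X"
abbreviation "E \<equiv> arcs X"

lemma no_loop: "e \<in> E \<Longrightarrow> head X e \<noteq> tail X e"
  using separating by force

lemma steps_sym:
  assumes "A \<subseteq> E" "\<iota> ` A \<subseteq> A" "(x, y) \<in> (steps X A)\<^sup>*"
  shows "(y, x) \<in> (steps X A)\<^sup>*"
proof -
  have "sym (steps X A)"
  proof (rule symI)
    fix x y assume "(x, y) \<in> steps X A"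
    then obtain e where "e \<in> A" "x = tail X e" "y = head X e" by (auto simp: steps_def)
    then show "(y, x) \<in> steps X A" using stepsI[of "\<iota> e" A X] assms(1,2) by (auto simp: subset_iff)
  qed
  then show ?thesis using assms(3) sym_rtrancl symD by metis
qed

lemma steps_verts: "(x, y) \<in> (steps X A)\<^sup>* \<Longrightarrow> A \<subseteq> E \<Longrightarrow> x \<in> V \<Longrightarrow> y \<in> V"
  by (induction rule: rtrancl_induct) (auto simp: steps_def)

section \<open>Directions at a vertex of a tree\<close>

definition avoiding :: "'v \<Rightarrow> 'e set" where
  "avoiding v = {e \<in> E. tail X e \<noteq> v \<and> head X e \<noteq> v}"

lemma avoiding_sym: "(x, y) \<in> (steps X (avoiding v))\<^sup>* \<Longrightarrow> (y, x) \<in> (steps X (avoiding v))\<^sup>*"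
  by (rule steps_sym[rotated 2]) (auto simp: avoiding_def)

lemma avoiding_neq: "(x, y) \<in> (steps X (avoiding v))\<^sup>* \<Longrightarrow> x \<noteq> v \<Longrightarrow> y \<noteq> v"
  by (induction rule: rtrancl_induct) (auto simp: steps_def avoiding_def)

text \<open>The first edge of the path from \<open>v\<close> to \<open>x\<close>.\<close>

definition towards :: "'v \<Rightarrow> 'v \<Rightarrow> 'e" where
  "towards v x = (SOME e. e \<in> E \<and> tail X e = v \<and> (head X e, x) \<in> (steps X (avoiding v))\<^sup>*)"

text \<open>Along a path from \<open>v\<close>, the edge sought is the one by which the path last
  left \<open>v\<close>; it is reset at every return.\<close>

lemma towards_ex:
  assumes "v \<in> V" "x \<in> V" "x \<noteq> v"
  shows "\<exists>e. e \<in> E \<and> tail X e = v \<and> (head X e, x) \<in> (steps X (avoiding v))\<^sup>*"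
proof -
  have "x = v \<or> (\<exists>e. e \<in> E \<and> tail X e = v \<and> (head X e, x) \<in> (steps X (avoiding v))\<^sup>*)"
    using connected[OF assms(1,2)]
  proof (induction rule: rtrancl_induct)
    case (step y z)
    then obtain a where a: "a \<in> E" "y = tail X a" "z = head X a" by (auto simp: steps_def)
    consider "z = v" | "z \<noteq> v" "y = v" | "z \<noteq> v" "y \<noteq> v" by blast
    then show ?case
    proof cases
      case 2
      then show ?thesis using a by blast
    next
      case 3
      then have "(y, z) \<in> steps X (avoiding v)" using a by (auto simp: steps_def avoiding_def)
      then show ?thesis using step.IH 3 rtrancl_into_rtrancl by metis
    qed simp
  qed simp
  then show ?thesis using assms by simp
qed

text \<open>Two different edges at \<open>v\<close> from which \<open>x\<close> is reached without
  returning to \<open>v\<close> would form a detour around one of them, contradicting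
  separation.\<close>

lemma towards_eqI:
  assumes e: "e \<in> E" "tail X e = v" "(head X e, x) \<in> (steps X (avoiding v))\<^sup>*"
  shows "towards v x = e"
proof -
  have "\<And>e. e \<in> E \<and> tail X e = v \<and> (head X e, x) \<in> (steps X (avoiding v))\<^sup>* \<Longrightarrow> e = e'"
    if e': "e' \<in> E" "tail X e' = v" "(head X e', x) \<in> (steps X (avoiding v))\<^sup>*" for e'
  proof (rule ccontr, elim conjE)
    fix e assume e: "e \<in> E" "tail X e = v" "(head X e, x) \<in> (steps X (avoiding v))\<^sup>*" and ne: "e \<noteq> e'"
    have "(head X e, head X e') \<in> (steps X (avoiding v))\<^sup>*"
      using e(3) avoiding_sym[OF e'(3)] by (rule rtrancl_trans)
    moreover have "avoiding v \<subseteq> E - {e, \<iota> e}" using e by (auto simp: avoiding_def)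
    ultimately have "(head X e, head X e') \<in> (steps X (E - {e, \<iota> e}))\<^sup>*" by (rule steps_rtrancl_mono)
    moreover have "\<iota> e' \<noteq> e" using e e' no_loop[of e'] by auto
    then have "\<iota> e' \<in> E - {e, \<iota> e}" using e'(1) ne arev_eq_iff[of e e'] by auto
    then have "(head X e', v) \<in> (steps X (E - {e, \<iota> e}))\<^sup>*"
      using steps_rtranclI[of "\<iota> e'" "E - {e, \<iota> e}" X] e' by simp
    ultimately have "(head X e, tail X e) \<in> (steps X (E - {e, \<iota> e}))\<^sup>*"
      using e(2) by (auto intro: rtrancl_trans)
    with separating[OF e(1)] show False ..
  qed
  then show ?thesis unfolding towards_def
    using e by (intro some_equality) blast+
qed

lemma towards:
  assumes "v \<in> V" "x \<in> V" "x \<noteq> v"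
  shows "towards v x \<in> E" "tail X (towards v x) = v"
    "(head X (towards v x), x) \<in> (steps X (avoiding v))\<^sup>*"
  using towards_ex[OF assms] towards_eqI by metis+

lemma towards_steps:
  assumes "v \<in> V" "x \<in> V" "x \<noteq> v" "(x, y) \<in> (steps X (avoiding v))\<^sup>*"
  shows "towards v x = towards v y"
  using towards_eqI[OF towards(1,2)[OF assms(1-3)] rtrancl_trans[OF towards(3)[OF assms(1-3)] assms(4)]] ..

text \<open>The direction seen from \<open>w\<close> stays constant while a path avoids
  \<open>w\<close>, so a change of direction forces a visit to \<open>w\<close>. Path lengths are
  recorded for later use with distances.\<close>

lemma relpow_through:
  assumes "(x, y) \<in> steps X E ^^ n" "w \<in> V" "x \<in> V" "x = w \<or> y = w \<or> towards w x \<noteq> towards w y"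
  shows "\<exists>i\<le>n. (x, w) \<in> steps X E ^^ i \<and> (w, y) \<in> steps X E ^^ (n - i)"
  using assms
proof (induction n arbitrary: x)
  case 0
  then show ?case by auto
next
  case (Suc n)
  show ?case
  proof (cases "x = w")
    case True
    then show ?thesis using Suc.prems by (intro exI[of _ 0]) auto
  next
    case False
    obtain z where z: "(x, z) \<in> steps X E" "(z, y) \<in> steps X E ^^ n"
      using Suc.prems(1) relpow_Suc_D2 by metis
    obtain e where e: "e \<in> E" "x = tail X e" "z = head X e" using z by (auto simp: steps_def)
    have "z \<in> V" using e by auto
    moreover have "z = w \<or> y = w \<or> towards w z \<noteq> towards w y"
    proof (cases "z = w")
      case zw: False
      have "(x, z) \<in> (steps X (avoiding w))\<^sup>*"
        using e False zw by (auto simp: steps_def avoiding_def)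
      then have "towards w x = towards w z"
        using towards_steps Suc.prems False by blast
      then show ?thesis using Suc.prems False by auto
    qed simp
    ultimately obtain i where i: "i \<le> n" "(z, w) \<in> steps X E ^^ i" "(w, y) \<in> steps X E ^^ (n - i)"
      using Suc.IH[OF z(2) Suc.prems(2)] by blast
    then show ?thesis using relpow_Suc_I2[OF z(1) i(2)] by (intro exI[of _ "Suc i"]) auto
  qed
qed

end

section \<open>Actions on trees\<close>

text \<open>Bijectivity follows from the action of inverses; \<open>ext\<close> is present because
  the elements of \<open>BijGroup\<close> are extensional maps.\<close>

lemma group_actionI:
  assumes "group G"
    and closed: "\<And>g x. g \<in> carrier G \<Longrightarrow> x \<in> A \<Longrightarrow> \<phi> g x \<in> A"
    and one: "\<And>x. x \<in> A \<Longrightarrow> \<phi> \<one>\<^bsub>G\<^esub> x = x"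
    and mult: "\<And>g h x. g \<in> carrier G \<Longrightarrow> h \<in> carrier G \<Longrightarrow> x \<in> A \<Longrightarrow> \<phi> (g \<otimes>\<^bsub>G\<^esub> h) x = \<phi> g (\<phi> h x)"
    and ext: "\<And>g. g \<in> carrier G \<Longrightarrow> \<phi> g \<in> extensional A"
  shows "group_action G A \<phi>"
proof -
  interpret group G by fact
  have inv: "\<phi> (inv\<^bsub>G\<^esub> g) (\<phi> g x) = x" "\<phi> g (\<phi> (inv\<^bsub>G\<^esub> g) x) = x"
    if "g \<in> carrier G" "x \<in> A" for g x
    using that mult[of "inv\<^bsub>G\<^esub> g" g x] mult[of g "inv\<^bsub>G\<^esub> g" x] one by simp_all
  have bij: "\<phi> g \<in> Bij A" if "g \<in> carrier G" for g
    unfolding Bij_def using that inv closed ext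
    by (auto intro!: bij_betwI[of _ _ _ "\<phi> (inv\<^bsub>G\<^esub> g)"])
  have "\<phi> \<in> hom G (BijGroup A)"
  proof (rule homI)
    fix g h assume gh: "g \<in> carrier G" "h \<in> carrier G"
    show "\<phi> (g \<otimes>\<^bsub>G\<^esub> h) = \<phi> g \<otimes>\<^bsub>BijGroup A\<^esub> \<phi> h"
      using gh bij mult ext[of "g \<otimes>\<^bsub>G\<^esub> h"]
      by (auto simp: BijGroup_def compose_def fun_eq_iff extensional_def restrict_def)
  qed (use bij in \<open>auto simp: BijGroup_def\<close>)
  then show ?thesis
    by (intro group_action.intro group_hom.intro group_hom_axioms.intro group_BijGroup is_group)
qed

lemma (in group_action) ext_prop: "g \<in> carrier G \<Longrightarrow> \<phi> g \<in> extensional E"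
  using bij_prop0 by (simp add: Bij_def)

locale tree_action = group G for G (structure) and X :: "('a, 'v, 'e) graph_action" +
  assumes splitting: "splitting G X"
begin

sublocale tree "space X" "flip X"
  using splitting by (simp add: splitting_def is_tree_iff)

sublocale vertex: group_action G "vertices X" "vact X"
  using splitting by (simp add: splitting_def)

sublocale edge: group_action G "edges X" "eact X"
  using splitting by (simp add: splitting_def)

abbreviation "va \<equiv> vact X"
abbreviation "ea \<equiv> eact X"
abbreviation "ini \<equiv> tail (space X)"
abbreviation "ter \<equiv> head (space X)"
abbreviation "fl \<equiv> flip X"
abbreviation "st \<equiv> steps (space X)"

lemma va_closed [simp]: "g \<in> carrier G \<Longrightarrow> x \<in> V \<Longrightarrow> va g x \<in> V"
  using vertex.element_image by blast

lemma ea_closed [simp]: "g \<in> carrier G \<Longrightarrow> e \<in> E \<Longrightarrow> ea g e \<in> E"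
  using edge.element_image by blast

lemma va_mult: "g \<in> carrier G \<Longrightarrow> h \<in> carrier G \<Longrightarrow> x \<in> V \<Longrightarrow> va (g \<otimes> h) x = va g (va h x)"
  using vertex.composition_rule by blast

lemma ea_mult: "g \<in> carrier G \<Longrightarrow> h \<in> carrier G \<Longrightarrow> e \<in> E \<Longrightarrow> ea (g \<otimes> h) e = ea g (ea h e)"
  using edge.composition_rule by blast

lemma va_one [simp]: "x \<in> V \<Longrightarrow> va \<one> x = x"
  using vertex.id_eq_one by (metis restrict_apply)

lemma ea_one [simp]: "e \<in> E \<Longrightarrow> ea \<one> e = e"
  using edge.id_eq_one by (metis restrict_apply)

lemma va_inv [simp]: "g \<in> carrier G \<Longrightarrow> x \<in> V \<Longrightarrow> va (inv g) (va g x) = x"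
    "g \<in> carrier G \<Longrightarrow> x \<in> V \<Longrightarrow> va g (va (inv g) x) = x"
  using va_mult[of "inv g" g x] va_mult[of g "inv g" x] by auto

lemma ea_inv [simp]: "g \<in> carrier G \<Longrightarrow> e \<in> E \<Longrightarrow> ea (inv g) (ea g e) = e"
    "g \<in> carrier G \<Longrightarrow> e \<in> E \<Longrightarrow> ea g (ea (inv g) e) = e"
  using ea_mult[of "inv g" g e] ea_mult[of g "inv g" e] by auto

lemma va_eq_iff: "g \<in> carrier G \<Longrightarrow> x \<in> V \<Longrightarrow> y \<in> V \<Longrightarrow> va g x = va g y \<longleftrightarrow> x = y"
  by (metis va_inv(1))

lemma equivariant [simp]:
  assumes "g \<in> carrier G" "e \<in> E"
  shows "ini (ea g e) = va g (ini e)" "ter (ea g e) = va g (ter e)" "ea g (fl e) = fl (ea g e)" "ea g e \<noteq> fl e"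
  using splitting assms by (auto simp: splitting_def)

lemma ini_ter_closed [simp]: "e \<in> E \<Longrightarrow> ini e \<in> V" "e \<in> E \<Longrightarrow> ter e \<in> V"
  by auto

lemma steps_va:
  assumes "g \<in> carrier G" "A \<subseteq> E" "\<And>e. e \<in> A \<Longrightarrow> ea g e \<in> B" "(x, y) \<in> (st A)\<^sup>*"
  shows "(va g x, va g y) \<in> (st B)\<^sup>*"
  using assms(4)
proof (induction rule: rtrancl_induct)
  case (step y z)
  then obtain e where e: "e \<in> A" "y = ini e" "z = ter e" by (auto simp: steps_def)
  then have "(va g y, va g z) \<in> st B"
    using stepsI[of "ea g e" B "space X"] assms(1-3) by auto
  with step.IH show ?case by (rule rtrancl_into_rtrancl)
qed simp

lemma towards_va:
  assumes "g \<in> carrier G" "v \<in> V" "x \<in> V" "x \<noteq> v"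
  shows "towards (va g v) (va g x) = ea g (towards v x)"
proof (rule towards_eqI)
  note t = towards[OF assms(2-4)]
  show "ea g (towards v x) \<in> E" "ini (ea g (towards v x)) = va g v" using t assms by auto
  have "(va g (ter (towards v x)), va g x) \<in> (st (avoiding (va g v)))\<^sup>*"
    by (rule steps_va[OF assms(1) _ _ t(3)]) (use assms in \<open>auto simp: avoiding_def va_eq_iff\<close>)
  then show "(ter (ea g (towards v x)), va g x) \<in> (st (avoiding (va g v)))\<^sup>*"
    using t assms by simp
qed

lemma vertex_group_subgroup: "v \<in> V \<Longrightarrow> subgroup (vertex_group G X v) G"
  using vertex.stabilizer_subgroup by blast

lemma edge_group_subgroup: "e \<in> E \<Longrightarrow> subgroup (edge_group G X e) G"
  using edge.stabilizer_subgroup by blast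

lemma vertex_groupD: "g \<in> vertex_group G X v \<Longrightarrow> g \<in> carrier G \<and> va g v = v"
  by (simp add: stabilizer_def)

lemma edge_group_le_tail: "e \<in> E \<Longrightarrow> edge_group G X e \<subseteq> vertex_group G X (ini e)"
  by (auto simp: stabilizer_def simp flip: equivariant(1))

lemma edge_group_flip: "e \<in> E \<Longrightarrow> edge_group G X (fl e) = edge_group G X e"
  by (auto simp: stabilizer_def arev_eq_iff)

lemma vertex_group_inter_towards:
  assumes "v \<in> V" "x \<in> V" "x \<noteq> v" "g \<in> vertex_group G X v" "g \<in> vertex_group G X x"
  shows "g \<in> edge_group G X (towards v x)"
  using towards_va[of g v x] assms by (auto simp: stabilizer_def)

end

section \<open>Vertex groups are finitely generated\<close>

lemma (in tree) finite_connection: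
  assumes "(x, y) \<in> (steps X E)\<^sup>*" "x \<in> V"
  shows "\<exists>U. finite U \<and> U \<subseteq> V \<and> x \<in> U \<and> y \<in> U \<and> (x, y) \<in> (steps X {e \<in> E. tail X e \<in> U \<and> head X e \<in> U})\<^sup>*"
  using assms(1)
proof (induction rule: rtrancl_induct)
  case base
  then show ?case using assms by (intro exI[of _ "{x}"]) auto
next
  case (step y z)
  then obtain U where U: "finite U" "U \<subseteq> V" "x \<in> U" "y \<in> U"
    "(x, y) \<in> (steps X {e \<in> E. tail X e \<in> U \<and> head X e \<in> U})\<^sup>*" by blast
  obtain e where e: "e \<in> E" "y = tail X e" "z = head X e" using step by (auto simp: steps_def)
  let ?U = "insert z U"
  have "(x, y) \<in> (steps X {e \<in> E. tail X e \<in> ?U \<and> head X e \<in> ?U})\<^sup>*"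
    using U(5) by (rule steps_rtrancl_mono) auto
  moreover have "(y, z) \<in> steps X {e \<in> E. tail X e \<in> ?U \<and> head X e \<in> ?U}"
    using e U by (auto simp: steps_def)
  ultimately have "(x, z) \<in> (steps X {e \<in> E. tail X e \<in> ?U \<and> head X e \<in> ?U})\<^sup>*"
    by (rule rtrancl_into_rtrancl)
  then show ?case using U e by (intro exI[of _ ?U]) auto
qed

context tree_action
begin

lemma finite_connections:
  assumes "finite Y" "Y \<subseteq> V" "v \<in> V"
  shows "\<exists>U. finite U \<and> U \<subseteq> V \<and> v \<in> U \<and>
    (\<forall>y\<in>Y. y \<in> U \<and> (v, y) \<in> (st {e \<in> E. ini e \<in> U \<and> ter e \<in> U})\<^sup>*)"
  using assms(1,2)
proof induction
  case empty
  then show ?case using assms(3) by (intro exI[of _ "{v}"]) auto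
next
  case (insert y Y)
  have mono: "(v, z) \<in> (st {e \<in> E. ini e \<in> U \<union> U' \<and> ter e \<in> U \<union> U'})\<^sup>*"
    if "(v, z) \<in> (st {e \<in> E. ini e \<in> U \<and> ter e \<in> U})\<^sup>* \<or> (v, z) \<in> (st {e \<in> E. ini e \<in> U' \<and> ter e \<in> U'})\<^sup>*"
    for z U U'
    using that
  proof
    assume "(v, z) \<in> (st {e \<in> E. ini e \<in> U \<and> ter e \<in> U})\<^sup>*"
    then show ?thesis by (rule steps_rtrancl_mono) blast
  next
    assume "(v, z) \<in> (st {e \<in> E. ini e \<in> U' \<and> ter e \<in> U'})\<^sup>*"
    then show ?thesis by (rule steps_rtrancl_mono) blast
  qed
  obtain U where U: "finite U" "U \<subseteq> V" "v \<in> U"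
    "\<And>z. z \<in> Y \<Longrightarrow> z \<in> U \<and> (v, z) \<in> (st {e \<in> E. ini e \<in> U \<and> ter e \<in> U})\<^sup>*"
    using insert by auto
  have "y \<in> V" using insert by simp
  obtain U' where U': "finite U'" "U' \<subseteq> V" "v \<in> U'" "y \<in> U'"
    "(v, y) \<in> (st {e \<in> E. ini e \<in> U' \<and> ter e \<in> U'})\<^sup>*"
    using finite_connection[OF connected[OF assms(3) \<open>y \<in> V\<close>] assms(3)] by (elim exE conjE) (rule that)
  have "\<forall>z\<in>insert y Y. z \<in> U \<union> U' \<and> (v, z) \<in> (st {e \<in> E. ini e \<in> U \<union> U' \<and> ter e \<in> U \<union> U'})\<^sup>*"
  proof
    fix z assume "z \<in> insert y Y"
    then show "z \<in> U \<union> U' \<and> (v, z) \<in> (st {e \<in> E. ini e \<in> U \<union> U' \<and> ter e \<in> U \<union> U'})\<^sup>*"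
      using mono[of z U U'] U(4) U'(4,5) by blast
  qed
  then show ?case using U(1-3) U'(1,2) by (intro exI[of _ "U \<union> U'"]) (simp only: finite_Un Un_subset_iff, blast)
qed

text \<open>Multiply an element out letter by letter and watch the vertex \<open>h v\<close> from
  \<open>v\<close>. Its direction can change only when the translate \<open>h U\<close> of a fixed
  finite set contains \<open>v\<close>, and up to \<open>G_v\<close> there are finitely many such
  events. Generators of the edge groups met, elements permuting the finitely many directions, and
  the finitely many elements of \<open>M\<close> fixing \<open>v\<close> then generate
  \<open>G_v\<close>.\<close>

lemma vertex_group_fg:
  assumes S: "finite S" "generates G S"
    and edge_fg: "\<And>e. e \<in> E \<Longrightarrow> \<exists>Z. finite Z \<and> generates (G\<lparr>carrier := edge_group G X e\<rparr>) Z"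
    and v: "v \<in> V"
  shows "\<exists>Z. finite Z \<and> generates (G\<lparr>carrier := vertex_group G X v\<rparr>) Z"
proof -
  let ?Gv = "vertex_group G X v"
  let ?L = "S \<times> (UNIV :: bool set)"
  let ?l = "letter_value G"
  have S': "S \<subseteq> carrier G" using S by (simp add: generates_def)
  note l_closed = letter_value_closed[OF S']
  have finL: "finite ?L" using S by simp
  have lv: "va (?l y) v \<in> V" if "y \<in> ?L" for y using l_closed[OF that] v by simp
  have fin: "finite ((\<lambda>y. va (?l y) v) ` ?L)" using finL by (rule finite_imageI)
  have sub: "(\<lambda>y. va (?l y) v) ` ?L \<subseteq> V" using lv by (rule image_subsetI)
  obtain U where U: "finite U" "U \<subseteq> V" "v \<in> U" and
    conn': "\<forall>z\<in>(\<lambda>y. va (?l y) v) ` ?L. z \<in> U \<and> (v, z) \<in> (st {e \<in> E. ini e \<in> U \<and> ter e \<in> U})\<^sup>*"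
    using finite_connections[OF fin sub v] by (elim exE conjE) (rule that)
  have conn: "(v, va (?l y) v) \<in> (st {e \<in> E. ini e \<in> U \<and> ter e \<in> U})\<^sup>*" if "y \<in> ?L" for y
    using bspec[OF conn' imageI[OF that]] by (rule conjunct2)
  define k where "k u = (SOME g. g \<in> carrier G \<and> va g u = v)" for u
  define U' where "U' = {u \<in> U. \<exists>g \<in> carrier G. va g u = v}"
  have k: "k u \<in> carrier G \<and> va (k u) u = v" if "u \<in> U'" for u
    unfolding k_def by (rule someI_ex) (use that in \<open>auto simp: U'_def\<close>)
  have U': "finite U'" "U' \<subseteq> V" using U by (auto simp: U'_def)
  \<comment> \<open>If \<open>v = h u\<close> with \<open>u \<in> U\<close>, then \<open>h\<close>
    lies in \<open>G_v k u\<close>. So \<open>M\<close> lists, up to left multiplication by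
    \<open>G_v\<close>, the positions just before and just after a letter that may pass
    \<open>v\<close>.\<close>
  define M where "M = k ` U' \<union> (\<lambda>(u, y). k u \<otimes> ?l y) ` (U' \<times> ?L)"
  have M1: "k u \<in> M" if "u \<in> U'" for u using that by (simp add: M_def)
  have M2: "k u \<otimes> ?l y \<in> M" if "u \<in> U'" "y \<in> ?L" for u y
    unfolding M_def using that by (intro UnI2 image_eqI[of _ _ "(u, y)"]) simp_all
  have finM: "finite M" unfolding M_def using U'(1) finL by simp
  have M: "g \<in> carrier G" if "g \<in> M" for g
    using that k l_closed unfolding M_def by (elim UnE imageE) (auto simp del: mem_Sigma_iff elim!: SigmaE2)
  define E1 where "E1 = (\<lambda>g. towards v (va g v)) ` {g \<in> M. va g v \<noteq> v}"
  have finE1: "finite E1" unfolding E1_def using finM by simp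
  have E1I: "towards v (va g v) \<in> E1" if "g \<in> M" "va g v \<noteq> v" for g
    using that by (simp add: E1_def)
  have E1: "\<epsilon> \<in> E \<and> ini \<epsilon> = v" if "\<epsilon> \<in> E1" for \<epsilon>
    using that towards(1,2)[OF v] v M unfolding E1_def by (elim imageE) simp
  obtain Z where Z: "\<forall>\<epsilon>\<in>E. finite (Z \<epsilon>) \<and> generates (G\<lparr>carrier := edge_group G X \<epsilon>\<rparr>) (Z \<epsilon>)"
  proof -
    have "\<forall>\<epsilon>\<in>E. \<exists>Z. finite Z \<and> generates (G\<lparr>carrier := edge_group G X \<epsilon>\<rparr>) Z"
      using edge_fg by simp
    from bchoice[OF this] show ?thesis by (elim exE) (rule that)
  qed
  define b where "b \<epsilon> \<epsilon>' = (SOME a. a \<in> ?Gv \<and> ea a \<epsilon> = \<epsilon>')" for \<epsilon> \<epsilon>'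
  define ZZ where "ZZ = ?Gv \<inter> ((\<Union>\<epsilon>\<in>E1. Z \<epsilon>) \<union> (\<lambda>(\<epsilon>, \<epsilon>'). b \<epsilon> \<epsilon>') ` (E1 \<times> E1) \<union> M)"
  have "finite (\<Union>\<epsilon>\<in>E1. Z \<epsilon>)" using finE1 E1 Z by (intro finite_UN_I) simp_all
  then have finZZ: "finite ZZ" unfolding ZZ_def using finE1 finM by simp
  have Gv_subset: "?Gv \<subseteq> carrier G" using subgroup.subset[OF vertex_group_subgroup[OF v]] .
  have ZZ: "ZZ \<subseteq> ?Gv" "ZZ \<subseteq> carrier G" unfolding ZZ_def using Gv_subset by auto
  define A where "A = generate G ZZ"
  interpret A: subgroup A G unfolding A_def by (rule generate_is_subgroup[OF ZZ(2)])
  have A_Gv: "A \<subseteq> ?Gv" unfolding A_def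
    by (rule generate_subgroup_incl[OF ZZ(1)]) (rule vertex_group_subgroup[OF v])
  have incl: "z \<in> A" if "z \<in> ZZ" for z using that unfolding A_def by (rule generate.incl)
  have edge_A: "edge_group G X \<epsilon> \<subseteq> A" if "\<epsilon> \<in> E1" for \<epsilon>
  proof
    fix a assume a: "a \<in> edge_group G X \<epsilon>"
    have \<epsilon>: "\<epsilon> \<in> E" "ini \<epsilon> = v" using E1[OF that] by simp_all
    interpret Ge: group "G\<lparr>carrier := edge_group G X \<epsilon>\<rparr>"
      by (rule subgroup_imp_group[OF edge_group_subgroup[OF \<epsilon>(1)]])
    have Z\<epsilon>: "generates (G\<lparr>carrier := edge_group G X \<epsilon>\<rparr>) (Z \<epsilon>)" using Z \<epsilon> by simp
    then have sub: "Z \<epsilon> \<subseteq> edge_group G X \<epsilon>" by (simp add: generates_def)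
    then have "Z \<epsilon> \<subseteq> ZZ" using that edge_group_le_tail[OF \<epsilon>(1)] \<epsilon>(2) by (auto simp: ZZ_def)
    obtain w where w: "w \<in> lists (Z \<epsilon> \<times> UNIV)" "word_value (G\<lparr>carrier := edge_group G X \<epsilon>\<rparr>) w = a"
      by (rule Ge.word_value_surj[OF Z\<epsilon>, of a]) (use a in simp_all)
    then have "word_value G w = a"
      using word_value_subgroup[OF edge_group_subgroup[OF \<epsilon>(1)] sub w(1)] by simp
    moreover have "w \<in> lists (ZZ \<times> UNIV)" using w(1) \<open>Z \<epsilon> \<subseteq> ZZ\<close> by auto
    ultimately show "a \<in> A" using word_value_in_generate[OF ZZ(2)] unfolding A_def by blast
  qed
  \<comment> \<open>Two elements carrying \<open>\<epsilon>\<close> to \<open>\<epsilon>'\<close>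
    differ by an element of the edge group of \<open>\<epsilon>\<close>, which is already in
    \<open>A\<close>.\<close>
  have trans_A: "a \<in> A" if a: "a \<in> ?Gv" and \<epsilon>: "\<epsilon> \<in> E1" "\<epsilon>' \<in> E1" and "ea a \<epsilon> = \<epsilon>'" for a \<epsilon> \<epsilon>'
  proof -
    have b: "b \<epsilon> \<epsilon>' \<in> ?Gv \<and> ea (b \<epsilon> \<epsilon>') \<epsilon> = \<epsilon>'"
      unfolding b_def by (rule someI_ex) (use that in blast)
    then have "b \<epsilon> \<epsilon>' \<in> ZZ" using \<epsilon> by (auto simp: ZZ_def)
    then have bA: "b \<epsilon> \<epsilon>' \<in> A" by (rule incl)
    have bG: "b \<epsilon> \<epsilon>' \<in> carrier G" and aG: "a \<in> carrier G" using b a Gv_subset by blast+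
    have \<epsilon>E: "\<epsilon> \<in> E" using E1[OF \<epsilon>(1)] by simp
    have "ea (inv (b \<epsilon> \<epsilon>') \<otimes> a) \<epsilon> = ea (inv (b \<epsilon> \<epsilon>')) (ea a \<epsilon>)"
      by (rule ea_mult[OF inv_closed[OF bG] aG \<epsilon>E])
    also have "ea a \<epsilon> = ea (b \<epsilon> \<epsilon>') \<epsilon>" using b that(4) by metis
    also have "ea (inv (b \<epsilon> \<epsilon>')) \<dots> = \<epsilon>" by (rule ea_inv(1)[OF bG \<epsilon>E])
    finally have "inv (b \<epsilon> \<epsilon>') \<otimes> a \<in> edge_group G X \<epsilon>"
      using bG aG unfolding stabilizer_def by simp
    then have "inv (b \<epsilon> \<epsilon>') \<otimes> a \<in> A" by (rule subsetD[OF edge_A[OF \<epsilon>(1)]])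
    then have "b \<epsilon> \<epsilon>' \<otimes> (inv (b \<epsilon> \<epsilon>') \<otimes> a) \<in> A" by (rule A.m_closed[OF bA])
    then show ?thesis using bG aG by (simp add: m_assoc[symmetric])
  qed
  \<comment> \<open>The invariant of the induction on words. On elements of \<open>G_v\<close> it is
    the desired membership in \<open>A\<close>; elsewhere it controls the direction of
    \<open>h v\<close> modulo \<open>A\<close>.\<close>
  define B where "B h \<longleftrightarrow> (if va h v = v then h \<in> A else
      (\<exists>a\<in>A. \<exists>\<epsilon>\<in>E1. towards v (va h v) = ea a \<epsilon>))" for h
  have step: "B (h \<otimes> ?l y)" if h: "h \<in> carrier G" and B: "B h" and y: "y \<in> ?L" for h y
  proof -
    let ?h' = "h \<otimes> ?l y"
    note ly = l_closed[OF y]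
    have hV: "va h v \<in> V" "va ?h' v \<in> V" using h v ly by auto
    show ?thesis
    proof (cases "\<exists>u\<in>U. va h u = v")
      \<comment> \<open>Here \<open>v\<close> is outside \<open>h U\<close>, so the path from
        \<open>h v\<close> to the next vertex, which stays in \<open>h U\<close>, keeps its
        direction at \<open>v\<close>.\<close>
      case False
      have "(va h v, va h (va (?l y) v)) \<in> (st (avoiding v))\<^sup>*"
        by (rule steps_va[OF h _ _ conn[OF y]]) (use False h in \<open>auto simp: avoiding_def\<close>)
      then have *: "(va h v, va ?h' v) \<in> (st (avoiding v))\<^sup>*" using va_mult h ly v by simp
      have "va h v \<noteq> v" using False U(3) by blast
      then show ?thesis
        using B towards_steps[OF v hV(1) _ *] avoiding_neq[OF *] by (simp add: B_def)
    next
      case True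
      then obtain u where u: "u \<in> U" "va h u = v" by blast
      then have u': "u \<in> U'" using h by (auto simp: U'_def)
      note ku = k[OF u']
      have uV: "u \<in> V" using u U by blast
      define a where "a = h \<otimes> inv (k u)"
      have a: "a \<in> ?Gv"
      proof -
        have "va (inv (k u)) v = u" using ku va_inv(1)[of "k u" u] uV by simp
        then have "va a v = v"
          unfolding a_def using va_mult[OF h inv_closed v, of "k u"] ku u(2) by simp
        then show ?thesis using h ku unfolding stabilizer_def a_def by simp
      qed
      then have aG: "a \<in> carrier G" "va a v = v" unfolding stabilizer_def by blast+
      have kuG: "k u \<in> carrier G" using ku by blast
      have ha: "a \<otimes> k u = h" unfolding a_def using h kuG by (simp add: m_assoc)
      have hv: "va h v = va a (va (k u) v)"
        using va_mult[OF aG(1) kuG v] unfolding ha .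
      have "a \<otimes> (k u \<otimes> ?l y) = ?h'" using m_assoc[OF aG(1) kuG ly] unfolding ha by simp
      then have h'v: "va ?h' v = va a (va (k u \<otimes> ?l y) v)"
        using va_mult[OF aG(1) m_closed[OF kuG ly] v] by simp
      have E1V: "\<And>\<epsilon>. \<epsilon> \<in> E1 \<Longrightarrow> \<epsilon> \<in> E" using E1 by blast
      have kuV: "va (k u) v \<in> V" "va (k u \<otimes> ?l y) v \<in> V" using ku ly v by simp_all
      \<comment> \<open>Before the letter, \<open>h\<close> is \<open>a\<close> times an element of
        \<open>M\<close>; comparing the direction \<open>a\<close> produces with the one granted by
        the invariant places \<open>a\<close> in \<open>A\<close>. After the letter, the invariant
        is then read off from \<open>a\<close> and the next element of \<open>M\<close>.\<close>
      have aA: "a \<in> A"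
      proof (cases "va h v = v")
        case True
        then have "va (k u) v = v"
          using va_eq_iff[OF aG(1) kuV(1) v] unfolding hv aG(2) by simp
        then have "k u \<in> ZZ" using kuG M1[OF u'] by (simp add: ZZ_def stabilizer_def)
        then have "k u \<in> A" by (rule incl)
        moreover have "h \<in> A" using B True by (simp add: B_def)
        ultimately show ?thesis unfolding a_def by (intro A.m_closed A.m_inv_closed)
      next
        case False
        then have kv: "va (k u) v \<noteq> v" using hv aG(2) by metis
        let ?\<epsilon> = "towards v (va (k u) v)"
        have \<epsilon>: "?\<epsilon> \<in> E1" by (rule E1I[OF M1[OF u'] kv])
        obtain a' \<epsilon>' where a': "a' \<in> A" "\<epsilon>' \<in> E1" "towards v (va h v) = ea a' \<epsilon>'"
          using B False by (auto simp: B_def)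
        have a'G: "a' \<in> ?Gv" "a' \<in> carrier G" using a'(1) A_Gv Gv_subset by blast+
        have "towards v (va h v) = ea a ?\<epsilon>"
          using towards_va[OF aG(1) v kuV(1) kv] unfolding hv aG(2) .
        then have "ea (inv a' \<otimes> a) ?\<epsilon> = \<epsilon>'"
          using a'(3) ea_mult[OF inv_closed[OF a'G(2)] aG(1) E1V[OF \<epsilon>]]
            ea_inv(1)[OF a'G(2) E1V[OF a'(2)]] by simp
        then have "inv a' \<otimes> a \<in> A"
          by (intro trans_A[OF _ \<epsilon> a'(2)] subgroup.m_closed[OF vertex_group_subgroup[OF v]]
              subgroup.m_inv_closed[OF vertex_group_subgroup[OF v]] a a'G(1))
        then have "a' \<otimes> (inv a' \<otimes> a) \<in> A" by (rule A.m_closed[OF a'(1)])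
        then show ?thesis using aG a'G by (simp add: m_assoc[symmetric])
      qed
      show ?thesis
      proof (cases "va ?h' v = v")
        case True
        then have "va (k u \<otimes> ?l y) v = v"
          using va_eq_iff[OF aG(1) kuV(2) v] unfolding h'v aG(2) by simp
        then have "k u \<otimes> ?l y \<in> ZZ"
          using kuG M2[OF u' y] ly by (simp add: ZZ_def stabilizer_def)
        then have "k u \<otimes> ?l y \<in> A" by (rule incl)
        then have "a \<otimes> (k u \<otimes> ?l y) \<in> A" by (rule A.m_closed[OF aA])
        then show ?thesis using True m_assoc[OF aG(1) kuG ly] unfolding ha by (simp add: B_def)
      next
        case False
        then have kv: "va (k u \<otimes> ?l y) v \<noteq> v" using h'v aG(2) by metis
        let ?\<epsilon> = "towards v (va (k u \<otimes> ?l y) v)"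
        have "?\<epsilon> \<in> E1" by (rule E1I[OF M2[OF u' y] kv])
        moreover have "towards v (va ?h' v) = ea a ?\<epsilon>"
          using towards_va[OF aG(1) v kuV(2) kv] unfolding h'v aG(2) .
        ultimately show ?thesis using False aA by (auto simp: B_def)
      qed
    qed
  qed
  have "?Gv \<subseteq> A"
  proof
    fix g assume g: "g \<in> ?Gv"
    have "B g"
      by (rule word_induct[OF S(2)]) (use step g v in \<open>auto simp: stabilizer_def B_def[of \<one>]\<close>)
    then show "g \<in> A" using g by (auto simp: B_def stabilizer_def)
  qed
  then have "generates (G\<lparr>carrier := ?Gv\<rparr>) ZZ"
    using generate_word[OF ZZ(2)] vertex_group_subgroup[OF v] ZZ(1) unfolding A_def
    by (intro generates_subgroupI) blast+
  then show ?thesis using finZZ by blast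
qed

end

lemma orbit_eq_image: "orbit G \<phi> x = (\<lambda>g. \<phi> g x) ` carrier G"
  by (auto simp: orbit_def)

lemma orbits_eq_image: "orbits G A \<phi> = orbit G \<phi> ` A"
  by (auto simp: orbits_def)

lemma (in group_action) orbit_image:
  assumes "g \<in> carrier G" "x \<in> E"
  shows "orbit G \<phi> (\<phi> g x) = orbit G \<phi> x"
proof -
  interpret group G using group_hom group_hom.axioms(1) by auto
  have sub: "orbit G \<phi> (\<phi> g x) \<subseteq> orbit G \<phi> x" if "g \<in> carrier G" "x \<in> E" for g x
  proof
    fix z assume "z \<in> orbit G \<phi> (\<phi> g x)"
    then obtain h where "h \<in> carrier G" "z = \<phi> h (\<phi> g x)" by (auto simp: orbit_def)
    then have "h \<otimes> g \<in> carrier G" "z = \<phi> (h \<otimes> g) x" using that composition_rule[of x h g] by auto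
    then show "z \<in> orbit G \<phi> x" unfolding orbit_def by blast
  qed
  have "\<phi> (inv g) (\<phi> g x) = x" using orbit_sym_aux[OF assms refl] .
  then show ?thesis
    using sub[OF assms] sub[of "inv g" "\<phi> g x"] element_image[OF assms refl] assms(1) by auto
qed

section \<open>Invariant subtrees of finite type\<close>

lemma (in tree_action) subgroup_splitting:
  assumes H: "subgroup H G"
  shows "splitting (G\<lparr>carrier := H\<rparr>) X"
proof -
  have HG: "H \<subseteq> carrier G" using subgroup.subset[OF H] .
  have H': "group (G\<lparr>carrier := H\<rparr>)" using subgroup_imp_group[OF H] .
  have "group_action (G\<lparr>carrier := H\<rparr>) V va"
    by (rule group_actionI[OF H']) (auto simp: subsetD[OF HG] va_mult vertex.ext_prop)
  moreover have "group_action (G\<lparr>carrier := H\<rparr>) E ea"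
    by (rule group_actionI[OF H']) (auto simp: subsetD[OF HG] ea_mult edge.ext_prop)
  ultimately show ?thesis
    using splitting subsetD[OF HG] H' unfolding splitting_def by simp
qed

lemma stabilizer_subgroup_carrier [simp]:
  "H \<subseteq> carrier G \<Longrightarrow> stabilizer (G\<lparr>carrier := H\<rparr>) \<phi> x = H \<inter> stabilizer G \<phi> x"
  by (auto simp: stabilizer_def)

text \<open>Off \<open>E'\<close> the flip is the identity, as arc reversal in
  \<open>bidirected_digraph\<close> requires, and the actions are restricted to be
  extensional.\<close>

definition sub_action :: "('a, 'v, 'e) graph_action \<Rightarrow> 'v set \<Rightarrow> 'e set \<Rightarrow> ('a, 'v, 'e) graph_action" where
  "sub_action X V' E' =
     \<lparr>space = \<lparr>verts = V', arcs = E', tail = tail (space X), head = head (space X)\<rparr>,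
      flip = (\<lambda>e. if e \<in> E' then flip X e else e),
      vact = (\<lambda>g. restrict (vact X g) V'), eact = (\<lambda>g. restrict (eact X g) E')\<rparr>"

context tree_action
begin

lemma sub_action_splitting:
  assumes V': "V' \<subseteq> V" "V' \<noteq> {}" "\<And>g x. g \<in> carrier G \<Longrightarrow> x \<in> V' \<Longrightarrow> va g x \<in> V'"
    and E': "E' \<subseteq> E" "\<And>e. e \<in> E' \<Longrightarrow> fl e \<in> E'" "\<And>g e. g \<in> carrier G \<Longrightarrow> e \<in> E' \<Longrightarrow> ea g e \<in> E'"
    and ends: "\<And>e. e \<in> E' \<Longrightarrow> ini e \<in> V' \<and> ter e \<in> V'"
    and conn: "\<And>x y. x \<in> V' \<Longrightarrow> y \<in> V' \<Longrightarrow> (x, y) \<in> (st E')\<^sup>*"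
  shows "splitting G (sub_action X V' E')"
proof -
  let ?Y = "sub_action X V' E'"
  have steps: "steps (space ?Y) A = st A" for A by (simp add: steps_def sub_action_def)
  have "tree (space ?Y) (flip ?Y)"
  proof unfold_locales
    show "tail (space ?Y) e \<in> vertices ?Y" "head (space ?Y) e \<in> vertices ?Y" if "e \<in> edges ?Y" for e
      using that ends by (auto simp: sub_action_def)
    show "e \<in> edges ?Y \<longleftrightarrow> flip ?Y e \<noteq> e" for e
      using E'(1) arev_neq by (auto simp: sub_action_def)
    show "flip ?Y (flip ?Y e) = e" if "e \<in> edges ?Y" for e
      using that E'(2) by (auto simp: sub_action_def)
    show "tail (space ?Y) (flip ?Y e) = head (space ?Y) e" if "e \<in> edges ?Y" for e
      using that E'(1) by (auto simp: sub_action_def)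
    show "vertices ?Y \<noteq> {}" using V'(2) by (simp add: sub_action_def)
    show "(x, y) \<in> (steps (space ?Y) (edges ?Y))\<^sup>*" if "x \<in> vertices ?Y" "y \<in> vertices ?Y" for x y
      using conn that unfolding steps by (simp add: sub_action_def)
    show "(head (space ?Y) e, tail (space ?Y) e) \<notin> (steps (space ?Y) (edges ?Y - {e, flip ?Y e}))\<^sup>*"
      if e: "e \<in> edges ?Y" for e
    proof
      assume "(head (space ?Y) e, tail (space ?Y) e) \<in> (steps (space ?Y) (edges ?Y - {e, flip ?Y e}))\<^sup>*"
      then have "(ter e, ini e) \<in> (st (E' - {e, fl e}))\<^sup>*"
        using e unfolding steps by (simp add: sub_action_def)
      then have "(ter e, ini e) \<in> (st (E - {e, fl e}))\<^sup>*"
        by (rule steps_rtrancl_mono) (use E' in auto)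
      then show False using separating[of e] e E' by (auto simp: sub_action_def)
    qed
  qed
  moreover have "group_action G (vertices ?Y) (vact ?Y)"
    using V' va_mult by (intro group_actionI is_group) (auto simp: sub_action_def subset_iff)
  moreover have "group_action G (edges ?Y) (eact ?Y)"
    using E' ea_mult by (intro group_actionI is_group) (auto simp: sub_action_def subset_iff)
  ultimately show ?thesis
    unfolding splitting_def is_tree_iff using is_group E' ends
    by (auto simp: sub_action_def subset_iff)
qed

text \<open>The translates of a finite piece that joins \<open>v\<close> to its images under the
  generators connect the whole orbit of \<open>v\<close>. The component of \<open>v\<close> in their
  union is an invariant subtree, and each of its vertices is a translate of a point of the finite
  set \<open>U\<close>.\<close>

lemma cofinite_subtree:
  assumes S: "finite S" "generates G S" and v: "v \<in> V"
  obtains V' E' where "splitting G (sub_action X V' E')" "v \<in> V'" "V' \<subseteq> V" "E' \<subseteq> E"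
    "countable V'" "countable E'" "finite (orbits G V' va)"
proof -
  let ?L = "S \<times> (UNIV :: bool set)"
  let ?l = "letter_value G"
  have S': "S \<subseteq> carrier G" using S by (simp add: generates_def)
  note l_closed = letter_value_closed[OF S']
  have "finite ?L" using S by simp
  then have fin: "finite ((\<lambda>y. va (?l y) v) ` ?L)" by (rule finite_imageI)
  have "va (?l y) v \<in> V" if "y \<in> ?L" for y using l_closed[OF that] v by simp
  then have sub: "(\<lambda>y. va (?l y) v) ` ?L \<subseteq> V" by (rule image_subsetI)
  obtain U where U: "finite U" "U \<subseteq> V" "v \<in> U" and
    conn': "\<forall>z\<in>(\<lambda>y. va (?l y) v) ` ?L. z \<in> U \<and> (v, z) \<in> (st {e \<in> E. ini e \<in> U \<and> ter e \<in> U})\<^sup>*"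
    using finite_connections[OF fin sub v] by (elim exE conjE) (rule that)
  define E0 where "E0 = {e \<in> E. ini e \<in> U \<and> ter e \<in> U}"
  define E1 where "E1 = {ea g e | g e. g \<in> carrier G \<and> e \<in> E0}"
  define V' where "V' = {x. (v, x) \<in> (st E1)\<^sup>*}"
  define E' where "E' = {e \<in> E1. ini e \<in> V'}"
  have E1I: "ea g e \<in> E1" if "g \<in> carrier G" "e \<in> E0" for g e
    unfolding E1_def using that by blast
  have E1E: "\<exists>g e0. e = ea g e0 \<and> g \<in> carrier G \<and> e0 \<in> E \<and> ini e0 \<in> U \<and> ter e0 \<in> U" if "e \<in> E1" for e
    using that unfolding E1_def E0_def by blast
  have E1: "E1 \<subseteq> E"
  proof
    fix e assume "e \<in> E1"
    from E1E[OF this] show "e \<in> E" by (elim exE conjE) simp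
  qed
  have E1_fl: "fl e \<in> E1" if e: "e \<in> E1" for e
  proof -
    obtain g e0 where *: "e = ea g e0" "g \<in> carrier G" "e0 \<in> E0"
      using e unfolding E1_def by blast
    then have "ea g (fl e0) \<in> E1" by (intro E1I) (simp_all add: E0_def)
    then show ?thesis using * by (simp add: E0_def)
  qed
  have E1_ea: "ea g e \<in> E1" if g: "g \<in> carrier G" and e: "e \<in> E1" for g e
  proof -
    obtain h e0 where *: "e = ea h e0" "h \<in> carrier G" "e0 \<in> E0"
      using e unfolding E1_def by blast
    then have "ea (g \<otimes> h) e0 \<in> E1" using g by (intro E1I) simp_all
    then show ?thesis using * g by (simp add: E0_def ea_mult)
  qed
  have orb: "(v, va g v) \<in> (st E1)\<^sup>*" if "g \<in> carrier G" for g
  proof (rule word_induct[OF S(2) that])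
    fix h y assume h: "h \<in> carrier G" "(v, va h v) \<in> (st E1)\<^sup>*" and y: "y \<in> ?L"
    have "(v, va (?l y) v) \<in> (st E0)\<^sup>*"
      unfolding E0_def using bspec[OF conn' imageI[OF y]] by (rule conjunct2)
    from steps_va[OF h(1) _ E1I[OF h(1)] this]
    have "(va h v, va h (va (?l y) v)) \<in> (st E1)\<^sup>*" by (simp add: E0_def)
    from rtrancl_trans[OF h(2) this]
    show "(v, va (h \<otimes> ?l y) v) \<in> (st E1)\<^sup>*" using va_mult[OF h(1) l_closed[OF y] v] by simp
  qed (use v in simp)
  have V': "V' \<subseteq> V" unfolding V'_def using steps_verts[OF _ E1 v] by blast
  have V'_va: "va g x \<in> V'" if "g \<in> carrier G" "x \<in> V'" for g x
  proof -
    have "(va g v, va g x) \<in> (st E1)\<^sup>*"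
      by (rule steps_va[OF that(1) E1 E1_ea[OF that(1)]]) (use that(2) in \<open>simp_all add: V'_def\<close>)
    from rtrancl_trans[OF orb[OF that(1)] this] show ?thesis unfolding V'_def by simp
  qed
  have ends: "ini e \<in> V' \<and> ter e \<in> V'" if "e \<in> E'" for e
    using that rtrancl_into_rtrancl[OF _ stepsI[of e E1 "space X"], of v]
    unfolding E'_def V'_def by blast
  have E': "E' \<subseteq> E" using E1 by (auto simp: E'_def)
  have E'_fl: "fl e \<in> E'" if "e \<in> E'" for e
    using that ends[OF that] E1_fl[of e] subsetD[OF E' that] by (simp add: E'_def)
  have E'_ea: "ea g e \<in> E'" if "g \<in> carrier G" "e \<in> E'" for g e
    using that E1_ea[of g e] V'_va[of g "ini e"] subsetD[OF E' that(2)] by (simp add: E'_def)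
  have vx: "(v, x) \<in> (st E')\<^sup>*" if "x \<in> V'" for x
    using that unfolding V'_def mem_Collect_eq
  proof (induction rule: rtrancl_induct)
    case (step y z)
    then obtain e where "e \<in> E1" "y = ini e" "z = ter e" by (auto simp: steps_def)
    then have "(y, z) \<in> st E'" using step.hyps(1) by (auto simp: steps_def E'_def V'_def)
    with step.IH show ?case by (rule rtrancl_into_rtrancl)
  qed simp
  have conn: "(x, y) \<in> (st E')\<^sup>*" if "x \<in> V'" "y \<in> V'" for x y
    by (rule rtrancl_trans[OF steps_sym[OF E' image_subsetI[OF E'_fl] vx[OF that(1)]] vx[OF that(2)]])
  have vV': "v \<in> V'" by (simp add: V'_def)
  have sp: "splitting G (sub_action X V' E')"
    by (rule sub_action_splitting[OF V' _ V'_va E' E'_fl E'_ea ends conn]) (use vV' in auto)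
  have GU: "\<exists>g\<in>carrier G. \<exists>u\<in>U. x = va g u" if "x \<in> V'" for x
    using that unfolding V'_def mem_Collect_eq
  proof (cases rule: rtranclE)
    case base
    then show ?thesis using U v by (intro bexI[of _ \<one>] bexI[of _ v]) auto
  next
    case (step y)
    then obtain e where "e \<in> E1" "x = ter e" by (auto simp: steps_def)
    from E1E[OF this(1)] \<open>x = ter e\<close> show ?thesis by (elim exE conjE) auto
  qed
  have "V' \<subseteq> (\<lambda>(g, u). va g u) ` (carrier G \<times> U)"
  proof
    fix x assume "x \<in> V'"
    from GU[OF this] obtain g u where "g \<in> carrier G" "u \<in> U" "x = va g u" by (elim bexE) (rule that)
    then show "x \<in> (\<lambda>(g, u). va g u) ` (carrier G \<times> U)" by (intro image_eqI[of _ _ "(g, u)"]) simp_all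
  qed
  moreover have "countable ((\<lambda>(g, u). va g u) ` (carrier G \<times> U))"
    using countable_carrier[OF S] countable_finite[OF U(1)] by (intro countable_image countable_SIGMA)
  ultimately have cV: "countable V'" by (rule countable_subset)
  \<comment> \<open>A tree has no multiple edges, so countably many vertices leave room for
    countably many edges only.\<close>
  have "inj_on (\<lambda>e. (ini e, ter e)) E'"
  proof (rule inj_onI)
    fix e f assume "e \<in> E'" "f \<in> E'" "(ini e, ter e) = (ini f, ter f)"
    then show "e = f"
      using towards_eqI[of e "ini e" "ter e"] towards_eqI[of f "ini e" "ter e"] E' by auto
  qed
  moreover have "countable ((\<lambda>e. (ini e, ter e)) ` E')"
    by (rule countable_subset[of _ "V' \<times> V'"]) (use ends cV in auto)
  ultimately have cE: "countable E'" using countable_image_inj_on by blast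
  have "orbits G V' va \<subseteq> orbit G va ` U"
  proof
    fix O' assume "O' \<in> orbits G V' va"
    then obtain x where x: "x \<in> V'" "O' = orbit G va x" by (auto simp: orbits_def)
    obtain g u where gu: "g \<in> carrier G" "u \<in> U" "x = va g u" using GU[OF x(1)] by blast
    have "orbit G va x = orbit G va u" using vertex.orbit_image[of g u] gu U(2) by blast
    then show "O' \<in> orbit G va ` U" using x gu by blast
  qed
  then have "finite (orbits G V' va)" using U(1) finite_surj by blast
  then show ?thesis using that sp vV' V' E' cV cE by blast
qed

end

section \<open>Collapsing forests\<close>

lemma card_quotient_less:
  assumes r: "equiv A r" and r': "equiv A r'" and sub: "r \<subseteq> r'" and fin: "finite (A // r)"
    and ab: "(a, b) \<in> r'" "(a, b) \<notin> r" "a \<in> A" "b \<in> A"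
  shows "card (A // r') < card (A // r)"
proof -
  have "A // r' \<subseteq> (\<lambda>C. r' `` C) ` (A // r - {r `` {a}})"
  proof
    fix C assume "C \<in> A // r'"
    then obtain x where x: "x \<in> A" "C = r' `` {x}" by (auto simp: quotient_def)
    have cls: "r' `` (r `` {y}) = r' `` {y}" if "y \<in> A" for y
      using sub r r' that equiv_class_self[OF r that] by (auto simp: equiv_def dest: transD symD)
    show "C \<in> (\<lambda>C. r' `` C) ` (A // r - {r `` {a}})"
    proof (cases "r `` {x} = r `` {a}")
      case True
      then have "(x, a) \<in> r" using eq_equiv_class[OF True r] ab by blast
      then have "(x, b) \<in> r'" using sub ab(1) r' by (auto simp: equiv_def dest: transD)
      then have "C = r' `` {b}" using x equiv_class_eq[OF r'] by blast
      moreover have "r `` {b} \<noteq> r `` {a}" using eq_equiv_class[of r b a, OF _ r] ab r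
        by (auto simp: equiv_def dest: symD)
      ultimately show ?thesis using cls[OF ab(4)] quotientI[OF ab(4)] by blast
    next
      case False
      then show ?thesis using cls[OF x(1)] quotientI[OF x(1)] x(2) by blast
    qed
  qed
  then have "card (A // r') \<le> card (A // r - {r `` {a}})"
    using fin by (auto intro: surj_card_le)
  also have "\<dots> < card (A // r)" using fin quotientI[OF ab(3)] by (rule card_Diff1_less)
  finally show ?thesis .
qed

context tree_action
begin

text \<open>Acyclicity is inherited from the tree, so only invariance under reversal and under the
  group is demanded.\<close>

definition forest :: "'e set \<Rightarrow> bool" where
  "forest F \<longleftrightarrow> F \<subseteq> E \<and> (\<forall>e\<in>F. fl e \<in> F) \<and> (\<forall>g\<in>carrier G. \<forall>e\<in>F. ea g e \<in> F)"

text \<open>Its classes correspond to the vertices of the quotient graph after collapsing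
  \<open>F\<close>; for \<open>F = {}\<close> they are the orbits of vertices.\<close>

definition orbit_rel :: "'e set \<Rightarrow> ('v \<times> 'v) set" where
  "orbit_rel F = {(x, y). x \<in> V \<and> y \<in> V \<and> (\<exists>g\<in>carrier G. (x, va g y) \<in> (st F)\<^sup>*)}"

context
  fixes F assumes F: "forest F"
begin

lemma forest_sym: "(x, y) \<in> (st F)\<^sup>* \<Longrightarrow> (y, x) \<in> (st F)\<^sup>*"
  by (rule steps_sym[rotated 2]) (use F in \<open>auto simp: forest_def\<close>)

lemma forest_va: "g \<in> carrier G \<Longrightarrow> (x, y) \<in> (st F)\<^sup>* \<Longrightarrow> (va g x, va g y) \<in> (st F)\<^sup>*"
  by (rule steps_va) (use F in \<open>auto simp: forest_def\<close>)

lemma forest_va_iff: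
  assumes "g \<in> carrier G" "x \<in> V" "y \<in> V"
  shows "(va g x, y) \<in> (st F)\<^sup>* \<longleftrightarrow> (x, va (inv g) y) \<in> (st F)\<^sup>*"
  using forest_va[of "inv g" "va g x" y] forest_va[of g x "va (inv g) y"] assms by auto

lemma orbit_rel_equiv: "equiv V (orbit_rel F)"
proof (rule equivI)
  show "orbit_rel F \<subseteq> V \<times> V" by (auto simp: orbit_rel_def)
  show "refl_on V (orbit_rel F)"
    by (auto simp: refl_on_def orbit_rel_def intro!: bexI[of _ \<one>])
  show "sym (orbit_rel F)"
  proof (rule symI)
    fix x y assume "(x, y) \<in> orbit_rel F"
    then obtain g where g: "x \<in> V" "y \<in> V" "g \<in> carrier G" "(x, va g y) \<in> (st F)\<^sup>*"
      by (auto simp: orbit_rel_def)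
    then have "(y, va (inv g) x) \<in> (st F)\<^sup>*"
      using forest_va_iff[of g y x] forest_sym by blast
    then show "(y, x) \<in> orbit_rel F" using g by (auto simp: orbit_rel_def)
  qed
  show "trans (orbit_rel F)"
  proof (rule transI)
    fix x y z assume "(x, y) \<in> orbit_rel F" "(y, z) \<in> orbit_rel F"
    then obtain g h where g: "x \<in> V" "y \<in> V" "z \<in> V" "g \<in> carrier G" "(x, va g y) \<in> (st F)\<^sup>*"
      "h \<in> carrier G" "(y, va h z) \<in> (st F)\<^sup>*"
      by (auto simp: orbit_rel_def)
    then have "(x, va (g \<otimes> h) z) \<in> (st F)\<^sup>*"
      using forest_va[of g y "va h z"] va_mult[of g h z] by (auto intro: rtrancl_trans)
    then show "(x, z) \<in> orbit_rel F" using g by (auto simp: orbit_rel_def)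
  qed
qed

end

text \<open>Each component of a good forest contains a vertex with the same stabilizer as the
  component, and the Euler characteristic of the quotient is unchanged by the collapse.\<close>

definition good_forest :: "'e set \<Rightarrow> bool" where
  "good_forest F \<longleftrightarrow> forest F \<and>
     (\<forall>x\<in>V. \<exists>u\<in>V. (x, u) \<in> (st F)\<^sup>* \<and> (\<forall>g\<in>carrier G. (va g u, u) \<in> (st F)\<^sup>* \<longrightarrow> va g u = u)) \<and>
     finite (orbit G ea ` F) \<and>
     card (orbit G ea ` F) + 2 * card (V // orbit_rel F) \<le> 2 * card (V // orbit_rel {})"

lemma good_forest_empty: "good_forest {}"
  by (auto simp: good_forest_def forest_def steps_def)

text \<open>By \<open>stab\<close> the stabilizer of the component of \<open>ini e\<close> fixes
  \<open>e\<close>, so adding the orbit of \<open>e\<close> hangs such components as dead ends on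
  translates of the component of \<open>ter e\<close>. The distinguished vertex of the latter
  component therefore still carries the stabilizer of the enlarged one.\<close>

lemma good_forest_extend:
  assumes good: "good_forest F" and fin: "finite (V // orbit_rel F)"
    and e: "e \<in> E" and nonloop: "\<And>g. g \<in> carrier G \<Longrightarrow> (ini e, va g (ter e)) \<notin> (st F)\<^sup>*"
    and stab: "\<And>g. g \<in> carrier G \<Longrightarrow> (va g (ini e), ini e) \<in> (st F)\<^sup>* \<Longrightarrow> ea g e = e"
  shows "\<exists>F'. good_forest F' \<and> finite (V // orbit_rel F') \<and> card (V // orbit_rel F') < card (V // orbit_rel F)"
proof -
  have F: "forest F" using good by (simp add: good_forest_def)
  note sym = forest_sym[OF F] and va = forest_va[OF F] and va_iff = forest_va_iff[OF F]
  let ?a = "ini e" and ?b = "ter e"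
  have abV: "?a \<in> V" "?b \<in> V" using e by auto
  define F' where "F' = F \<union> (\<lambda>g. ea g e) ` carrier G \<union> (\<lambda>g. ea g (fl e)) ` carrier G"
  have F'cases: "f \<in> F \<or> (\<exists>g\<in>carrier G. f = ea g e) \<or> (\<exists>g\<in>carrier G. f = ea g (fl e))" if "f \<in> F'" for f
    using that unfolding F'_def by blast
  have F': "forest F'"
    unfolding forest_def
  proof (intro conjI ballI)
    show "F' \<subseteq> E" using F e by (auto simp: F'_def forest_def)
    fix f assume f: "f \<in> F'"
    show "fl f \<in> F'"
      using F'cases[OF f] F e unfolding F'_def forest_def
      by (elim disjE bexE) (auto simp flip: equivariant(3))
    fix g assume g: "g \<in> carrier G"
    show "ea g f \<in> F'"
      using F'cases[OF f] F e g unfolding F'_def forest_def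
      by (elim disjE bexE) (auto simp flip: ea_mult)
  qed
  have FF': "F \<subseteq> F'" by (auto simp: F'_def)
  note mono = steps_rtrancl_mono[OF _ FF']
  note sym' = forest_sym[OF F'] and va' = forest_va[OF F']
  have nonloop': "(va h ?a, va g ?b) \<notin> (st F)\<^sup>*" if "h \<in> carrier G" "g \<in> carrier G" for g h
  proof
    assume "(va h ?a, va g ?b) \<in> (st F)\<^sup>*"
    then have "(?a, va (inv h) (va g ?b)) \<in> (st F)\<^sup>*" using va_iff that abV by simp
    then show False using nonloop[of "inv h \<otimes> g"] va_mult[of "inv h" g ?b] that abV by simp
  qed
  \<comment> \<open>Describes the new component of \<open>ter e\<close>: the old one, plus the
    components of those translates of \<open>ini e\<close> that are attached to it.\<close>
  have comp_b: "(?b, y) \<in> (st F)\<^sup>* \<or> (\<exists>h\<in>carrier G. (va h ?b, ?b) \<in> (st F)\<^sup>* \<and> (va h ?a, y) \<in> (st F)\<^sup>*)"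
    if "(?b, y) \<in> (st F')\<^sup>*" for y
    using that
  proof (induction rule: rtrancl_induct)
    case (step y z)
    then obtain f where f: "f \<in> F'" "y = ini f" "z = ter f" by (auto simp: steps_def)
    from F'cases[OF f(1)] show ?case
    proof (elim disjE bexE)
      assume "f \<in> F"
      then have "(y, z) \<in> (st F)\<^sup>*" using f steps_rtranclI[of f F] by simp
      then show ?thesis using step.IH by (auto intro: rtrancl_trans)
    next
      fix g assume g: "g \<in> carrier G" and fg: "f = ea g e"
      then have yz: "y = va g ?a" "z = va g ?b" using f e by auto
      from step.IH show ?thesis
      proof (elim disjE bexE conjE)
        assume "(?b, y) \<in> (st F)\<^sup>*"
        then show ?thesis using nonloop'[OF g one_closed] sym abV yz by fastforce
      next
        \<comment> \<open>An edge \<open>g e\<close> leaving the component of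
          \<open>h (ini e)\<close> must be \<open>h e\<close>, since
          \<open>inv h \<otimes> g\<close> stabilizes the component of \<open>ini e\<close> and so
          fixes \<open>e\<close>. It leads back to the component of \<open>ter e\<close>.\<close>
        fix h assume h: "h \<in> carrier G" "(va h ?b, ?b) \<in> (st F)\<^sup>*" "(va h ?a, y) \<in> (st F)\<^sup>*"
        then have "(?a, va (inv h) (va g ?a)) \<in> (st F)\<^sup>*" using va_iff[OF h(1)] yz g abV by simp
        then have "(va (inv h \<otimes> g) ?a, ?a) \<in> (st F)\<^sup>*"
          using sym va_mult[of "inv h" g ?a] h g abV by simp
        then have "ea (inv h \<otimes> g) e = e" using stab[of "inv h \<otimes> g"] h g by simp
        then have "ea h (ea (inv h) (ea g e)) = ea h e" using ea_mult[of "inv h" g e] h g e by simp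
        then have "ea g e = ea h e" using h g e by simp
        then have "va g ?b = va h ?b" using e g h(1) by (metis equivariant(2))
        then show ?thesis using yz sym[OF h(2)] by simp
      qed
    next
      fix g assume g: "g \<in> carrier G" and fg: "f = ea g (fl e)"
      then have yz: "y = va g ?b" "z = va g ?a" using f e by auto
      from step.IH show ?thesis
      proof (elim disjE bexE conjE)
        assume "(?b, y) \<in> (st F)\<^sup>*"
        then show ?thesis using g yz sym by blast
      next
        fix h assume h: "h \<in> carrier G" "(va h ?a, y) \<in> (st F)\<^sup>*"
        then show ?thesis using nonloop'[OF h(1) g] yz by blast
      qed
    qed
  qed simp
  have special: "\<exists>u\<in>V. (x, u) \<in> (st F')\<^sup>* \<and> (\<forall>g\<in>carrier G. (va g u, u) \<in> (st F')\<^sup>* \<longrightarrow> va g u = u)"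
    if x: "x \<in> V" for x
  proof (cases "\<exists>g\<in>carrier G. (x, va g ?b) \<in> (st F')\<^sup>*")
    case True
    then obtain g where g: "g \<in> carrier G" "(x, va g ?b) \<in> (st F')\<^sup>*" by blast
    obtain u where u: "u \<in> V" "(?b, u) \<in> (st F)\<^sup>*"
      "\<And>g. g \<in> carrier G \<Longrightarrow> (va g u, u) \<in> (st F)\<^sup>* \<Longrightarrow> va g u = u"
      using good abV unfolding good_forest_def by blast
    have key: "va h u = u" if h: "h \<in> carrier G" "(va h u, u) \<in> (st F')\<^sup>*" for h
    proof -
      have hb: "(va h ?b, va h u) \<in> (st F)\<^sup>*" using va[OF h(1) u(2)] .
      have "(?b, va h u) \<in> (st F')\<^sup>*"
        using mono[OF u(2)] sym'[OF h(2)] by (rule rtrancl_trans)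
      from comp_b[OF this] show ?thesis
      proof (elim disjE bexE conjE)
        assume "(?b, va h u) \<in> (st F)\<^sup>*"
        then have "(va h u, u) \<in> (st F)\<^sup>*" using rtrancl_trans[OF sym u(2)] by blast
        then show ?thesis using u(3) h(1) by blast
      next
        fix k assume k: "k \<in> carrier G" "(va k ?a, va h u) \<in> (st F)\<^sup>*"
        then have "(va k ?a, va h ?b) \<in> (st F)\<^sup>*" using rtrancl_trans[OF k(2) sym[OF hb]] by blast
        then show ?thesis using nonloop'[OF k(1) h(1)] by blast
      qed
    qed
    have "(x, va g u) \<in> (st F')\<^sup>*" using g(2) va'[OF g(1) mono[OF u(2)]] by (rule rtrancl_trans)
    moreover have "va k (va g u) = va g u" if k: "k \<in> carrier G" "(va k (va g u), va g u) \<in> (st F')\<^sup>*" for k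
    proof -
      let ?h = "inv g \<otimes> (k \<otimes> g)"
      have h: "va ?h u = va (inv g) (va k (va g u))" using k g u(1) by (simp add: va_mult)
      have "(va (inv g) (va k (va g u)), va (inv g) (va g u)) \<in> (st F')\<^sup>*"
        using va'[OF inv_closed[OF g(1)] k(2)] .
      then have "va ?h u = u" using key[of ?h] h k g u(1) by simp
      then have "va g (va (inv g) (va k (va g u))) = va g u" using h by simp
      then show ?thesis using k g u(1) by simp
    qed
    ultimately show ?thesis using u(1) g(1) by (intro bexI[of _ "va g u"]) auto
  next
    case False
    \<comment> \<open>A component without any translate of \<open>ter e\<close> meets no new edge,
      so its distinguished vertex can be kept.\<close>
    have old: "(x, y) \<in> (st F)\<^sup>*" if "(x, y) \<in> (st F')\<^sup>*" for y
      using that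
    proof (induction rule: rtrancl_induct)
      case (step y z)
      then obtain f where f: "f \<in> F'" "y = ini f" "z = ter f" by (auto simp: steps_def)
      from F'cases[OF f(1)] show ?case
      proof (elim disjE bexE)
        assume "f \<in> F"
        then have "(y, z) \<in> (st F)\<^sup>*" using f steps_rtranclI[of f F] by simp
        then show ?thesis using step.IH by (auto intro: rtrancl_trans)
      next
        fix g assume g: "g \<in> carrier G" "f = ea g e"
        then have "(x, va g ?b) \<in> (st F')\<^sup>*"
          using rtrancl_into_rtrancl[OF step.hyps(1,2)] f e by simp
        then show ?thesis using False g by blast
      next
        fix g assume g: "g \<in> carrier G" "f = ea g (fl e)"
        then show ?thesis using step.hyps(1) False f e by simp
      qed
    qed simp
    obtain u where u: "u \<in> V" "(x, u) \<in> (st F)\<^sup>*"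
      "\<And>g. g \<in> carrier G \<Longrightarrow> (va g u, u) \<in> (st F)\<^sup>* \<Longrightarrow> va g u = u"
      using good x unfolding good_forest_def by blast
    have "va g u = u" if g: "g \<in> carrier G" "(va g u, u) \<in> (st F')\<^sup>*" for g
    proof -
      have "(x, va g u) \<in> (st F)\<^sup>*" using rtrancl_trans[OF mono[OF u(2)] sym'[OF g(2)]] by (rule old)
      then have "(va g u, u) \<in> (st F)\<^sup>*" using rtrancl_trans[OF sym u(2)] by blast
      then show ?thesis using u(3) g by blast
    qed
    then show ?thesis by (intro bexI[of _ u] conjI ballI impI mono[OF u(2)] u(1))
  qed
  have sub: "orbit_rel F \<subseteq> orbit_rel F'"
  proof (rule subrelI)
    fix x y assume "(x, y) \<in> orbit_rel F"
    then obtain g where "x \<in> V" "y \<in> V" "g \<in> carrier G" "(x, va g y) \<in> (st F)\<^sup>*"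
      unfolding orbit_rel_def by blast
    then show "(x, y) \<in> orbit_rel F'" using mono[of x "va g y"] unfolding orbit_rel_def by blast
  qed
  have eF': "e \<in> F'" using e by (auto simp: F'_def intro!: image_eqI[of _ _ \<one>])
  have ab: "(?a, ?b) \<in> orbit_rel F'"
    using steps_rtranclI[OF eF', of "space X"] abV by (auto simp: orbit_rel_def intro!: bexI[of _ \<one>])
  have nab: "(?a, ?b) \<notin> orbit_rel F" using nonloop by (auto simp: orbit_rel_def)
  have less: "card (V // orbit_rel F') < card (V // orbit_rel F)"
    by (rule card_quotient_less[OF orbit_rel_equiv[OF F] orbit_rel_equiv[OF F'] sub fin ab nab abV])
  have fin': "finite (V // orbit_rel F')"
  proof -
    have "V // orbit_rel F' \<subseteq> (\<lambda>C. orbit_rel F' `` C) ` (V // orbit_rel F)"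
    proof
      fix C assume "C \<in> V // orbit_rel F'"
      then obtain x where x: "x \<in> V" "C = orbit_rel F' `` {x}" by (auto simp: quotient_def)
      have "orbit_rel F' `` (orbit_rel F `` {x}) = orbit_rel F' `` {x}"
        using sub orbit_rel_equiv[OF F'] equiv_class_self[OF orbit_rel_equiv[OF F] x(1)]
        by (auto simp: equiv_def dest: transD symD)
      then show "C \<in> (\<lambda>C. orbit_rel F' `` C) ` (V // orbit_rel F)"
        using quotientI[OF x(1), of "orbit_rel F"] x(2) by blast
    qed
    then show ?thesis using fin finite_surj by blast
  qed
  have orbs: "orbit G ea ` F' \<subseteq> insert (orbit G ea e) (insert (orbit G ea (fl e)) (orbit G ea ` F))"
  proof (rule image_subsetI)
    fix f assume "f \<in> F'"
    from F'cases[OF this]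
    show "orbit G ea f \<in> insert (orbit G ea e) (insert (orbit G ea (fl e)) (orbit G ea ` F))"
      by (elim disjE bexE) (use edge.orbit_image[of _ e] edge.orbit_image[of _ "fl e"] e in simp_all)
  qed
  have finF: "finite (orbit G ea ` F)" using good by (simp add: good_forest_def)
  \<comment> \<open>One geometric edge contributes at most two orbits of arcs, paid for by the loss
    of at least one vertex class; hence the factor 2 in \<open>good_forest\<close>.\<close>
  have "card (orbit G ea ` F') \<le> card (insert (orbit G ea e) (insert (orbit G ea (fl e)) (orbit G ea ` F)))"
    by (rule card_mono[OF _ orbs]) (use finF in simp)
  also have "\<dots> \<le> card (orbit G ea ` F) + 2" using finF by (simp add: card_insert_if)
  finally have "card (orbit G ea ` F') \<le> card (orbit G ea ` F) + 2" .
  moreover have "card (orbit G ea ` F) + 2 * card (V // orbit_rel F) \<le> 2 * card (V // orbit_rel {})"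
    using good by (simp add: good_forest_def)
  ultimately have "card (orbit G ea ` F') + 2 * card (V // orbit_rel F') \<le> 2 * card (V // orbit_rel {})"
    using less by linarith
  moreover have "finite (orbit G ea ` F')" using finite_subset[OF orbs] finF by simp
  ultimately have "good_forest F'"
    unfolding good_forest_def using F' special by simp
  with fin' less show ?thesis by blast
qed

text \<open>Each extension lowers the number of vertex classes, so the process stops. Its stopping
  condition says that the group of every remaining non-loop edge is proper in the stabilizer of the
  component at its tail, which is reducedness of the collapse.\<close>

lemma maximal_good_forest:
  assumes fin: "finite (V // orbit_rel {})"
  obtains F where "good_forest F" "finite (V // orbit_rel F)"
    "\<forall>e\<in>E. (\<forall>g\<in>carrier G. (ini e, va g (ter e)) \<notin> (st F)\<^sup>*) \<longrightarrow>
      (\<exists>g\<in>carrier G. (va g (ini e), ini e) \<in> (st F)\<^sup>* \<and> ea g e \<noteq> e)"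
proof -
  have "\<exists>F. good_forest F \<and> finite (V // orbit_rel F) \<and> (\<forall>e\<in>E. (\<forall>g\<in>carrier G. (ini e, va g (ter e)) \<notin> (st F)\<^sup>*) \<longrightarrow>
      (\<exists>g\<in>carrier G. (va g (ini e), ini e) \<in> (st F)\<^sup>* \<and> ea g e \<noteq> e))"
    if "good_forest F" "finite (V // orbit_rel F)" for F
    using that
  proof (induction "card (V // orbit_rel F)" arbitrary: F rule: less_induct)
    case less
    show ?case
    proof (cases "\<forall>e\<in>E. (\<forall>g\<in>carrier G. (ini e, va g (ter e)) \<notin> (st F)\<^sup>*) \<longrightarrow>
      (\<exists>g\<in>carrier G. (va g (ini e), ini e) \<in> (st F)\<^sup>* \<and> ea g e \<noteq> e)")
      case True
      then show ?thesis using less.prems by blast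
    next
      case False
      then obtain e where "e \<in> E" "\<And>g. g \<in> carrier G \<Longrightarrow> (ini e, va g (ter e)) \<notin> (st F)\<^sup>*"
        "\<And>g. g \<in> carrier G \<Longrightarrow> (va g (ini e), ini e) \<in> (st F)\<^sup>* \<Longrightarrow> ea g e = e"
        by blast
      then obtain F' where "good_forest F'" "finite (V // orbit_rel F')"
        "card (V // orbit_rel F') < card (V // orbit_rel F)"
        using good_forest_extend[OF less.prems] by metis
      then show ?thesis using less.hyps by blast
    qed
  qed
  from this[OF good_forest_empty fin] obtain F where "good_forest F" "finite (V // orbit_rel F)" and
    "\<forall>e\<in>E. (\<forall>g\<in>carrier G. (ini e, va g (ter e)) \<notin> (st F)\<^sup>*) \<longrightarrow>
      (\<exists>g\<in>carrier G. (va g (ini e), ini e) \<in> (st F)\<^sup>* \<and> ea g e \<noteq> e)" by (elim exE conjE) (rule that)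
  then show ?thesis by (rule that)
qed

end

section \<open>The tree obtained by collapsing a forest\<close>

definition collapse ::
    "('a, 'v, 'e) graph_action \<Rightarrow> 'e set \<Rightarrow> ('v \<Rightarrow> 'w) \<Rightarrow> ('e \<Rightarrow> 'f) \<Rightarrow> ('a, 'w, 'f) graph_action" where
  "collapse X F c d =
     (let V = vertices X; E = edges X - F in
      \<lparr>space = \<lparr>verts = c ` V, arcs = d ` E,
         tail = (\<lambda>e. c (tail (space X) (inv_into E d e))), head = (\<lambda>e. c (head (space X) (inv_into E d e)))\<rparr>,
       flip = (\<lambda>e. if e \<in> d ` E then d (flip X (inv_into E d e)) else e),
       vact = (\<lambda>g. restrict (\<lambda>y. c (vact X g (inv_into V c y))) (c ` V)),
       eact = (\<lambda>g. restrict (\<lambda>e. d (eact X g (inv_into E d e))) (d ` E))\<rparr>)"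

text \<open>The vertices of the collapse are named by \<open>c\<close>, whose fibres are the components of the
  forest, and its edges by \<open>d\<close>; this makes it possible to use natural numbers as names.\<close>

locale tree_collapse = tree_action G X for G (structure) and X :: "('a, 'v, 'e) graph_action" +
  fixes F and c :: "'v \<Rightarrow> 'w" and d :: "'e \<Rightarrow> 'f"
  assumes F: "forest F"
    and c: "\<And>x y. x \<in> V \<Longrightarrow> y \<in> V \<Longrightarrow> c x = c y \<longleftrightarrow> (x, y) \<in> (st F)\<^sup>*"
    and d: "inj_on d (E - F)"
begin

definition Y :: "('a, 'w, 'f) graph_action" where "Y = collapse X F c d"

lemma d_eq_iff: "e \<in> E - F \<Longrightarrow> f \<in> E - F \<Longrightarrow> d e = d f \<longleftrightarrow> e = f"
  using d by (auto simp: inj_on_def)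

lemma fl_remaining: "e \<in> E - F \<Longrightarrow> fl e \<in> E - F"
proof -
  assume e: "e \<in> E - F"
  have "fl e \<notin> F"
  proof
    assume "fl e \<in> F"
    then have "fl (fl e) \<in> F" using F unfolding forest_def by blast
    then show False using e by simp
  qed
  then show ?thesis using e by simp
qed

lemma ea_remaining: "g \<in> carrier G \<Longrightarrow> e \<in> E - F \<Longrightarrow> ea g e \<in> E - F"
proof -
  assume g: "g \<in> carrier G" and e: "e \<in> E - F"
  have "ea g e \<notin> F"
  proof
    assume "ea g e \<in> F"
    then have "ea (inv g) (ea g e) \<in> F" using F inv_closed[OF g] unfolding forest_def by blast
    then show False using e g by simp
  qed
  then show ?thesis using e g by simp
qed

lemma inv_d: "e \<in> E - F \<Longrightarrow> inv_into (E - F) d (d e) = e"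
  by (rule inv_into_f_f[OF d])

lemma verts_Y: "vertices Y = c ` V" and edges_Y: "edges Y = d ` (E - F)"
  by (simp_all add: Y_def collapse_def Let_def)

lemma tail_Y: "e \<in> E - F \<Longrightarrow> tail (space Y) (d e) = c (ini e)"
  and head_Y: "e \<in> E - F \<Longrightarrow> head (space Y) (d e) = c (ter e)"
  and flip_Y: "e \<in> E - F \<Longrightarrow> flip Y (d e) = d (fl e)"
  and eact_Y: "e \<in> E - F \<Longrightarrow> eact Y g (d e) = d (ea g e)"
  using inv_d[of e] unfolding Y_def collapse_def Let_def by simp_all

lemma vact_Y:
  assumes g: "g \<in> carrier G" and x: "x \<in> V"
  shows "vact Y g (c x) = c (va g x)"
proof -
  let ?x = "inv_into V c (c x)"
  have x': "?x \<in> V" "c ?x = c x" using x by (simp_all add: inv_into_into f_inv_into_f)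
  then have "(?x, x) \<in> (st F)\<^sup>*" using c x by blast
  then have "(va g ?x, va g x) \<in> (st F)\<^sup>*" by (rule forest_va[OF F g])
  then have "c (va g ?x) = c (va g x)" using c[of "va g ?x" "va g x"] g x x' by simp
  then show ?thesis using x unfolding Y_def collapse_def Let_def by simp
qed

lemma steps_to_Y:
  assumes "(x, y) \<in> (st E)\<^sup>*" "x \<in> V"
  shows "(c x, c y) \<in> (steps (space Y) (edges Y))\<^sup>*"
  using assms(1)
proof (induction rule: rtrancl_induct)
  case (step y z)
  then obtain e where e: "e \<in> E" "y = ini e" "z = ter e" by (auto simp: steps_def)
  show ?case
  proof (cases "e \<in> F")
    case True
    then have "c y = c z" using c[of y z] steps_rtranclI[of e F "space X"] e by simp
    with step.IH show ?thesis by simp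
  next
    case False
    then have "(c y, c z) \<in> steps (space Y) (edges Y)"
      using stepsI[of "d e" "edges Y" "space Y"] e tail_Y[of e] head_Y[of e] by (simp add: edges_Y)
    with step.IH show ?thesis by (rule rtrancl_into_rtrancl)
  qed
qed simp

text \<open>A path in the collapse lifts once paths inside components of \<open>F\<close> are
  inserted between consecutive edges. With \<open>A\<close> lacking one geometric edge, separation
  in the tree passes to the collapse.\<close>

lemma steps_from_Y:
  assumes "(c x, w) \<in> (steps (space Y) (d ` A))\<^sup>*" "A \<subseteq> E - F" "x \<in> V" "y \<in> V" "c y = w"
  shows "(x, y) \<in> (st (A \<union> F))\<^sup>*"
  using assms(1,4,5)
proof (induction arbitrary: y rule: rtrancl_induct)
  case base
  then have "(x, y) \<in> (st F)\<^sup>*" using c[OF \<open>x \<in> V\<close> base(1)] by simp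
  then show ?case by (rule steps_rtrancl_mono) simp
next
  case (step w w')
  then obtain e where e: "e \<in> A" "w = tail (space Y) (d e)" "w' = head (space Y) (d e)"
    by (auto simp: steps_def)
  have eE: "e \<in> E - F" using e assms(2) by blast
  have "(x, ini e) \<in> (st (A \<union> F))\<^sup>*" using step.IH[of "ini e"] eE e tail_Y[OF eE] by simp
  also have "(ini e, ter e) \<in> (st (A \<union> F))\<^sup>*" using e by (intro steps_rtranclI) simp
  also have "(ter e, y) \<in> (st (A \<union> F))\<^sup>*"
  proof -
    have "(ter e, y) \<in> (st F)\<^sup>*" using c[of "ter e" y] eE step.prems e head_Y[OF eE] by simp
    then show ?thesis by (rule steps_rtrancl_mono) simp
  qed
  finally show ?case .
qed

lemma collapse_splitting: "splitting G Y"
proof -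
  have "tree (space Y) (flip Y)"
  proof unfold_locales
    show "tail (space Y) e \<in> vertices Y" "head (space Y) e \<in> vertices Y" if "e \<in> edges Y" for e
      using that tail_Y head_Y by (auto simp: edges_Y verts_Y)
    show "e \<in> edges Y \<longleftrightarrow> flip Y e \<noteq> e" for e
    proof (cases "e \<in> edges Y")
      case True
      then obtain f where f: "f \<in> E - F" "e = d f" by (auto simp: edges_Y)
      then have "d (fl f) \<noteq> d f" using d_eq_iff[OF fl_remaining f(1)] arev_neq by simp
      then show ?thesis using True f flip_Y by simp
    next
      case False
      then show ?thesis by (simp add: Y_def collapse_def Let_def)
    qed
    show "flip Y (flip Y e) = e" "tail (space Y) (flip Y e) = head (space Y) e" if e: "e \<in> edges Y" for e
    proof -
      obtain f where f: "f \<in> E - F" "e = d f" using e by (auto simp: edges_Y)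
      then show "flip Y (flip Y e) = e" "tail (space Y) (flip Y e) = head (space Y) e"
        using fl_remaining[of f] flip_Y[of f] flip_Y[of "fl f"] tail_Y[of "fl f"] head_Y[of f] by auto
    qed
    show "vertices Y \<noteq> {}" using nonempty by (simp add: verts_Y)
    show "(x, y) \<in> (steps (space Y) (edges Y))\<^sup>*" if "x \<in> vertices Y" "y \<in> vertices Y" for x y
      using that steps_to_Y connected by (auto simp: verts_Y)
    show "(head (space Y) e, tail (space Y) e) \<notin> (steps (space Y) (edges Y - {e, flip Y e}))\<^sup>*"
      if e: "e \<in> edges Y" for e
    proof
      assume *: "(head (space Y) e, tail (space Y) e) \<in> (steps (space Y) (edges Y - {e, flip Y e}))\<^sup>*"
      obtain f where f: "f \<in> E - F" "e = d f" using e by (auto simp: edges_Y)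
      let ?A = "E - F - {f, fl f}"
      have "edges Y - {e, flip Y e} = d ` ?A"
        using f flip_Y[OF f(1)] d_eq_iff fl_remaining[OF f(1)] by (auto simp: edges_Y)
      then have "(ter f, ini f) \<in> (st (?A \<union> F))\<^sup>*"
        using * f tail_Y[OF f(1)] head_Y[OF f(1)] by (intro steps_from_Y) auto
      moreover have "?A \<union> F \<subseteq> E - {f, fl f}"
        using f fl_remaining[OF f(1)] F by (auto simp: forest_def)
      ultimately have "(ter f, ini f) \<in> (st (E - {f, fl f}))\<^sup>*" by (rule steps_rtrancl_mono)
      then show False using separating[of f] f by simp
    qed
  qed
  moreover have "group_action G (vertices Y) (vact Y)"
  proof (rule group_actionI[OF is_group])
    show "vact Y g \<in> extensional (vertices Y)" for g
      by (simp add: Y_def collapse_def Let_def)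
  qed (auto simp: verts_Y vact_Y va_mult)
  moreover have "group_action G (edges Y) (eact Y)"
  proof (rule group_actionI[OF is_group])
    show "eact Y g \<in> extensional (edges Y)" for g
      by (simp add: Y_def collapse_def Let_def)
    show "eact Y g x \<in> edges Y" if "g \<in> carrier G" "x \<in> edges Y" for g x
      using that eact_Y ea_remaining by (auto simp: edges_Y)
    show "eact Y \<one> x = x" if "x \<in> edges Y" for x
      using that eact_Y by (auto simp: edges_Y)
    show "eact Y (g \<otimes> h) x = eact Y g (eact Y h x)"
      if gh: "g \<in> carrier G" "h \<in> carrier G" and x: "x \<in> edges Y" for g h x
    proof -
      obtain e where e: "e \<in> E - F" "x = d e" using x by (auto simp: edges_Y)
      then show ?thesis using eact_Y[OF e(1)] eact_Y[OF ea_remaining[OF gh(2) e(1)]] ea_mult[OF gh] by simp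
    qed
  qed
  moreover have "tail (space Y) (eact Y g x) = vact Y g (tail (space Y) x) \<and>
      head (space Y) (eact Y g x) = vact Y g (head (space Y) x) \<and>
      eact Y g (flip Y x) = flip Y (eact Y g x) \<and> eact Y g x \<noteq> flip Y x"
    if g: "g \<in> carrier G" and x: "x \<in> edges Y" for g x
  proof -
    obtain e where e: "e \<in> E - F" "x = d e" using x by (auto simp: edges_Y)
    note ge = ea_remaining[OF g e(1)]
    show ?thesis
      using e(1) g eact_Y[OF e(1)] tail_Y[OF e(1)] head_Y[OF e(1)] tail_Y[OF ge] head_Y[OF ge]
        flip_Y[OF e(1)] flip_Y[OF ge] eact_Y[OF fl_remaining[OF e(1)]] d_eq_iff[OF ge fl_remaining[OF e(1)]]
      unfolding e(2) by (simp add: vact_Y)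
  qed
  ultimately show ?thesis
    unfolding splitting_def is_tree_iff using is_group by blast
qed

lemma vertex_group_Y: "x \<in> V \<Longrightarrow> vertex_group G Y (c x) = {g \<in> carrier G. (va g x, x) \<in> (st F)\<^sup>*}"
  unfolding stabilizer_def using vact_Y c by auto

lemma edge_group_Y: "e \<in> E - F \<Longrightarrow> edge_group G Y (d e) = edge_group G X e"
  unfolding stabilizer_def using eact_Y d_eq_iff ea_remaining by auto

lemma orbit_Y: "x \<in> V \<Longrightarrow> orbit G (vact Y) (c x) = c ` orbit G va x"
  by (simp add: orbit_eq_image image_image vact_Y cong: image_cong)

lemma eorbit_Y: "e \<in> E - F \<Longrightarrow> orbit G (eact Y) (d e) = d ` orbit G ea e"
  by (simp add: orbit_eq_image image_image eact_Y cong: image_cong)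

text \<open>The maximality condition treats the tail of an edge; applied to the reversed edge, whose
  group is the same, it treats the head.\<close>

lemma collapse_reduced:
  assumes max: "\<forall>e\<in>E. (\<forall>g\<in>carrier G. (ini e, va g (ter e)) \<notin> (st F)\<^sup>*) \<longrightarrow>
      (\<exists>g\<in>carrier G. (va g (ini e), ini e) \<in> (st F)\<^sup>* \<and> ea g e \<noteq> e)"
  shows "reduced_splitting G Y"
proof -
  interpret Y: tree_action G Y
    by unfold_locales (rule collapse_splitting)
  have less: "edge_group G X e \<subset> vertex_group G Y (c (ini e))"
    if e: "e \<in> E - F" and nl: "\<And>g. g \<in> carrier G \<Longrightarrow> (ini e, va g (ter e)) \<notin> (st F)\<^sup>*" for e
  proof -
    obtain g where "g \<in> carrier G" "(va g (ini e), ini e) \<in> (st F)\<^sup>*" "ea g e \<noteq> e"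
      using bspec[OF max, of e] e nl by blast
    then have "g \<in> vertex_group G Y (c (ini e))" "g \<notin> edge_group G X e"
      using vertex_group_Y[of "ini e"] e by (auto simp: stabilizer_def)
    moreover have "edge_group G X e \<subseteq> vertex_group G Y (c (ini e))"
      using Y.edge_group_le_tail[of "d e"] e edge_group_Y[OF e] tail_Y[OF e] by (simp add: edges_Y)
    ultimately show ?thesis by blast
  qed
  have "edge_group G Y x \<subset> vertex_group G Y (tail (space Y) x) \<and>
      edge_group G Y x \<subset> vertex_group G Y (head (space Y) x)"
    if x: "x \<in> edges Y" and ne: "orbit G (vact Y) (tail (space Y) x) \<noteq> orbit G (vact Y) (head (space Y) x)" for x
  proof -
    obtain e where e: "e \<in> E - F" "x = d e" using x by (auto simp: edges_Y)
    then have eV: "ini e \<in> V" "ter e \<in> V" by auto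
    have nl: "(ini e, va g (ter e)) \<notin> (st F)\<^sup>*" if g: "g \<in> carrier G" for g
    proof
      assume "(ini e, va g (ter e)) \<in> (st F)\<^sup>*"
      then have "c (ini e) = vact Y g (c (ter e))" using c[of "ini e" "va g (ter e)"] eV g vact_Y by simp
      moreover have "c (ter e) \<in> vertices Y" using eV by (auto simp: verts_Y)
      ultimately have "orbit G (vact Y) (c (ini e)) = orbit G (vact Y) (c (ter e))"
        using Y.vertex.orbit_image[OF g] by simp
      then show False using ne e tail_Y head_Y by simp
    qed
    have nl': "(ini (fl e), va g (ter (fl e))) \<notin> (st F)\<^sup>*" if g: "g \<in> carrier G" for g
    proof
      assume "(ini (fl e), va g (ter (fl e))) \<in> (st F)\<^sup>*"
      then have "(va g (ini e), ter e) \<in> (st F)\<^sup>*" using forest_sym[OF F] e by simp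
      then have "(ini e, va (inv g) (ter e)) \<in> (st F)\<^sup>*" using forest_va_iff[OF F g eV] by simp
      then show False using nl g by simp
    qed
    show ?thesis
      using less[OF e(1) nl] less[OF fl_remaining[OF e(1)] nl'] e edge_group_flip[of e]
        edge_group_Y[OF e(1)] tail_Y[OF e(1)] head_Y[OF e(1)] by simp
  qed
  then show ?thesis unfolding reduced_splitting_def using collapse_splitting by blast
qed

end

section \<open>A lower bound for the weighted complexity\<close>

context tree
begin

definition gdist :: "'v \<Rightarrow> 'v \<Rightarrow> nat" where
  "gdist x y = (LEAST n. (x, y) \<in> steps X E ^^ n)"

lemma gdist_relpow:
  assumes "x \<in> V" "y \<in> V"
  shows "(x, y) \<in> steps X E ^^ gdist x y"
proof -
  obtain n where "(x, y) \<in> steps X E ^^ n" using rtrancl_imp_relpow[OF connected[OF assms]] by blast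
  then show ?thesis unfolding gdist_def by (rule LeastI)
qed

lemma gdist_le: "(x, y) \<in> steps X E ^^ n \<Longrightarrow> gdist x y \<le> n"
  unfolding gdist_def by (rule Least_le)

lemma gdist_pos: "x \<in> V \<Longrightarrow> y \<in> V \<Longrightarrow> x \<noteq> y \<Longrightarrow> gdist x y > 0"
  using gdist_relpow[of x y] by (metis gr0I relpow_0_E)

lemma gdist_through:
  assumes "w \<in> V" "x \<in> V" "y \<in> V" "x = w \<or> y = w \<or> towards w x \<noteq> towards w y"
  shows "gdist x w + gdist w y \<le> gdist x y"
proof -
  obtain i where "i \<le> gdist x y" "(x, w) \<in> steps X E ^^ i" "(w, y) \<in> steps X E ^^ (gdist x y - i)"
    using relpow_through[OF gdist_relpow[OF assms(2,3)] assms(1,2,4)] by blast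
  then show ?thesis using gdist_le[of x w i] gdist_le[of w y "gdist x y - i"] by linarith
qed

end

section \<open>Hyperbolic elements from elliptic ones\<close>

context tree_action
begin

lemma relpow_va:
  "g \<in> carrier G \<Longrightarrow> (x, y) \<in> st E ^^ n \<Longrightarrow> (va g x, va g y) \<in> st E ^^ n"
proof (induction n arbitrary: y)
  case (Suc n)
  then obtain z where z: "(x, z) \<in> st E ^^ n" "(z, y) \<in> st E" by auto
  then obtain e where "e \<in> E" "z = ini e" "y = ter e" by (auto simp: steps_def)
  then have "(va g z, va g y) \<in> st E" using stepsI[of "ea g e" E "space X"] Suc.prems(1) by simp
  then show ?case using Suc.IH[OF Suc.prems(1) z(1)] by auto
qed simp

lemma gdist_va:
  assumes "g \<in> carrier G" "x \<in> V" "y \<in> V"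
  shows "gdist (va g x) (va g y) = gdist x y"
proof -
  have "gdist (va g x) (va g y) \<le> gdist x y" if "g \<in> carrier G" "x \<in> V" "y \<in> V" for g x y
    using gdist_le[OF relpow_va[OF that(1) gdist_relpow[OF that(2,3)]]] .
  from this[OF assms] this[OF inv_closed[OF assms(1)], of "va g x" "va g y"] show ?thesis
    using assms by simp
qed

text \<open>If \<open>gh\<close> fixes \<open>u\<close>, put \<open>y = hu = g\<^sup>-\<^sup>1u\<close>. Then \<open>w\<^sub>2\<close> lies between \<open>w\<^sub>1\<close> and one of \<open>u\<close>, \<open>y\<close>, and
  \<open>w\<^sub>1\<close> lies between \<open>w\<^sub>2\<close> and one of them, while \<open>u\<close> and \<open>y\<close> have the same distances to \<open>w\<^sub>1\<close> and
  to \<open>w\<^sub>2\<close>; this is impossible.\<close>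

lemma hyperbolic_product:
  assumes w: "w1 \<in> V" "w2 \<in> V" "w1 \<noteq> w2"
    and g: "g \<in> vertex_group G X w1" "g \<notin> edge_group G X (towards w1 w2)"
    and h: "h \<in> vertex_group G X w2" "h \<notin> edge_group G X (towards w2 w1)"
  shows "\<not> elliptic X (g \<otimes> h)"
proof
  assume "elliptic X (g \<otimes> h)"
  then obtain u where u: "u \<in> V" "va (g \<otimes> h) u = u" by (auto simp: elliptic_def)
  have gG: "g \<in> carrier G" "va g w1 = w1" and hG: "h \<in> carrier G" "va h w2 = w2"
    using vertex_groupD g(1) h(1) by auto
  let ?g = "inv g"
  have gi: "?g \<in> carrier G" "va ?g w1 = w1" using gG va_inv(1)[of g w1] w by auto
  define y where "y = va h u"
  have y: "y \<in> V" "y = va ?g u"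
    using u hG gG va_mult[of g h u] va_inv(1)[of g "va h u"] by (auto simp: y_def)
  define A where "A z \<longleftrightarrow> z = w2 \<or> towards w2 w1 \<noteq> towards w2 z" for z
  define B where "B z \<longleftrightarrow> z = w1 \<or> towards w1 w2 \<noteq> towards w1 z" for z
  have "A u \<or> A y"
  proof (rule ccontr)
    assume "\<not> (A u \<or> A y)"
    then have "u \<noteq> w2" "towards w2 w1 = towards w2 u" "towards w2 w1 = towards w2 y" by (auto simp: A_def)
    then have "ea h (towards w2 w1) = towards w2 w1"
      using towards_va[OF hG(1) w(2) u(1)] hG(2) by (simp add: y_def)
    then show False using h(2) hG(1) by (simp add: stabilizer_def)
  qed
  moreover have "B u \<or> B y"
  proof (rule ccontr)
    assume "\<not> (B u \<or> B y)"
    then have "u \<noteq> w1" "towards w1 w2 = towards w1 u" "towards w1 w2 = towards w1 y" by (auto simp: B_def)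
    then have "ea ?g (towards w1 w2) = towards w1 w2"
      using towards_va[OF gi(1) w(1) u(1)] gi(2) y(2) by simp
    then have "ea g (towards w1 w2) = towards w1 w2"
      using ea_inv(2)[OF gG(1), of "towards w1 w2"] towards(1)[OF w(1,2)] w(3) by simp
    then show False using g(2) gG(1) by (simp add: stabilizer_def)
  qed
  moreover have A: "gdist w1 w2 + gdist w2 z \<le> gdist w1 z" if "A z" "z \<in> V" for z
    using gdist_through[of w2 w1 z] that w by (auto simp: A_def)
  moreover have B: "gdist w2 w1 + gdist w1 z \<le> gdist w2 z" if "B z" "z \<in> V" for z
    using gdist_through[of w1 w2 z] that w by (auto simp: B_def)
  moreover have "gdist w2 y = gdist w2 u" using gdist_va[OF hG(1) w(2) u(1)] hG(2) by (simp add: y_def)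
  moreover have "gdist w1 y = gdist w1 u" using gdist_va[OF gi(1) w(1) u(1)] gi(2) y(2) by simp
  moreover have "gdist w1 w2 > 0" "gdist w2 w1 > 0" using gdist_pos w by auto
  \<comment> \<open>If \<open>d1\<close> and \<open>d2\<close> are the common distances of
    \<open>u\<close> and \<open>y\<close> to \<open>w1\<close> and \<open>w2\<close>, the
    \<open>A\<close> case yields \<open>d2 < d1\<close> and the \<open>B\<close> case
    \<open>d1 < d2\<close>.\<close>
  ultimately show False using u(1) y(1) A[of u] A[of y] B[of u] B[of y] by linarith
qed

lemma not_all_elliptic:
  assumes "w1 \<in> V" "w2 \<in> V" "w1 \<noteq> w2"
    and "\<And>e. e \<in> E \<Longrightarrow> \<not> vertex_group G X w1 \<subseteq> edge_group G X e"
    and "\<And>e. e \<in> E \<Longrightarrow> \<not> vertex_group G X w2 \<subseteq> edge_group G X e"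
  shows "\<not> (\<forall>g \<in> carrier G. elliptic X g)"
proof -
  have "towards w1 w2 \<in> E" "towards w2 w1 \<in> E" using towards(1) assms(1-3) by auto
  then obtain g h where gh: "g \<in> vertex_group G X w1" "g \<notin> edge_group G X (towards w1 w2)"
    "h \<in> vertex_group G X w2" "h \<notin> edge_group G X (towards w2 w1)"
    using assms(4,5) by blast
  then have "\<not> elliptic X (g \<otimes> h)" by (intro hyperbolic_product[OF assms(1-3)])
  moreover have "g \<otimes> h \<in> carrier G" using gh vertex_groupD by simp
  ultimately show ?thesis by blast
qed

section \<open>The minimal invariant subtree\<close>

definition core :: "'v set" where
  "core = \<Inter>{W. invariant_subtree G X W}"

lemma invariant_subtree_connected:
  assumes "invariant_subtree G X W"
  shows "W \<subseteq> V" "W \<noteq> {}" "\<And>g x. g \<in> carrier G \<Longrightarrow> x \<in> W \<Longrightarrow> va g x \<in> W"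
    "\<And>x y. x \<in> W \<Longrightarrow> y \<in> W \<Longrightarrow> (x, y) \<in> (st {e \<in> E. ini e \<in> W \<and> ter e \<in> W})\<^sup>*"
proof -
  let ?Y = "restrict_action X W"
  have "is_tree (space ?Y) (flip ?Y)" using assms unfolding invariant_subtree_def by blast
  then interpret Y: tree "space ?Y" "flip ?Y" by (rule iffD1[OF is_tree_iff])
  have verts: "vertices ?Y = W" and edges: "edges ?Y = {e \<in> E. ini e \<in> W \<and> ter e \<in> W}"
    by (auto simp: restrict_action_def induce_subgraph_def)
  have steps: "steps (space ?Y) A = st A" for A
    by (simp add: restrict_action_def induce_subgraph_def steps_def)
  show "W \<subseteq> V" using assms by (simp add: invariant_subtree_def)
  show "W \<noteq> {}" using Y.nonempty verts by simp
  show "va g x \<in> W" if "g \<in> carrier G" "x \<in> W" for g x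
    using assms that by (auto simp: invariant_subtree_def)
  show "(x, y) \<in> (st {e \<in> E. ini e \<in> W \<and> ter e \<in> W})\<^sup>*" if "x \<in> W" "y \<in> W" for x y
    using Y.connected[of x y] that unfolding verts steps edges .
qed

lemma core_subset: "core \<subseteq> V"
proof -
  have "invariant_subtree G X V"
  proof -
    have "induce_subgraph (space X) V = space X"
      by (rule pre_digraph.equality) (auto simp: induce_subgraph_def)
    then have "space (restrict_action X V) = space X" "flip (restrict_action X V) = flip X"
      using arev_eq by (simp_all add: restrict_action_def fun_eq_iff)
    moreover have "is_tree (space X) (flip X)" using splitting unfolding splitting_def by blast
    ultimately show ?thesis
      using vertex.surj_prop unfolding invariant_subtree_def by simp
  qed
  then show ?thesis by (auto simp: core_def)
qed

text \<open>Suppose an invariant subtree misses \<open>w\<close>. Being connected, it lies in a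
  single direction from \<open>w\<close>; being invariant, it makes the stabilizer of
  \<open>w\<close> preserve that direction and thus fix an edge.\<close>

lemma in_core:
  assumes w: "w \<in> V" and big: "\<And>e. e \<in> E \<Longrightarrow> \<not> vertex_group G X w \<subseteq> edge_group G X e"
  shows "w \<in> core"
  unfolding core_def
proof (rule InterI, unfold mem_Collect_eq, rule ccontr)
  fix W assume W: "invariant_subtree G X W" "w \<notin> W"
  note WW = invariant_subtree_connected[OF W(1)]
  obtain x where x: "x \<in> W" using WW(2) by blast
  then have xV: "x \<in> V" "x \<noteq> w" using WW(1) W(2) by auto
  have "vertex_group G X w \<subseteq> edge_group G X (towards w x)"
  proof
    fix g assume "g \<in> vertex_group G X w"
    then have g: "g \<in> carrier G" "va g w = w" using vertex_groupD by auto
    have "(x, va g x) \<in> (st (avoiding w))\<^sup>*"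
      by (rule steps_rtrancl_mono[OF WW(4)[OF x WW(3)[OF g(1) x]]]) (use W(2) in \<open>auto simp: avoiding_def\<close>)
    then have "towards w x = towards w (va g x)" by (rule towards_steps[OF w xV])
    then show "g \<in> edge_group G X (towards w x)"
      using towards_va[OF g(1) w xV] g by (simp add: stabilizer_def)
  qed
  then show False using big towards(1)[OF w xV] by blast
qed

lemma minimal_subtree_core: "minimal_subtree G X = restrict_action X core"
  by (simp add: minimal_subtree_def core_def)

lemma core_vertices: "vertices (minimal_subtree G X) = core"
  by (simp add: minimal_subtree_core restrict_action_def)

lemma core_edges: "edges (minimal_subtree G X) = {e \<in> E. ini e \<in> core \<and> ter e \<in> core}"
  by (simp add: minimal_subtree_core restrict_action_def induce_subgraph_def)

lemma core_vact: "x \<in> core \<Longrightarrow> vact (minimal_subtree G X) g x = va g x"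
  by (simp add: minimal_subtree_core restrict_action_def)

lemma core_eact: "e \<in> edges (minimal_subtree G X) \<Longrightarrow> eact (minimal_subtree G X) g e = ea g e"
  by (simp add: minimal_subtree_core restrict_action_def)

text \<open>A stabilizer inside no edge group puts its vertex into the minimal subtree and makes it
  non-degenerate there. Two such vertices exclude the case where every element is elliptic, and the
  rank term is simply bounded below by 0.\<close>

lemma complexity_lower_bound:
  assumes W: "W \<subseteq> V" "\<And>g w. g \<in> carrier G \<Longrightarrow> w \<in> W \<Longrightarrow> va g w \<in> W"
    and big: "\<And>w e. w \<in> W \<Longrightarrow> e \<in> E \<Longrightarrow> \<not> vertex_group G X w \<subseteq> edge_group G X e"
    and two: "w1 \<in> W" "w2 \<in> W" "w1 \<noteq> w2"
    and c0: "\<And>w. w \<in> W \<Longrightarrow> c0 \<le> 1 + \<phi> (vertex_group G X w)"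
  shows "of_nat (card (orbit G va ` W)) * c0 \<le> complexity \<phi> G X"
\<comment> \<open>For infinitely many orbits \<open>card\<close> is 0 and the bound is
  trivial.\<close>
proof (cases "finite (orbit G va ` W)")
  case True
  let ?T = "minimal_subtree G X"
  let ?f = "\<lambda>O'. 1 + \<phi> (vertex_group G ?T (SOME v. v \<in> O'))"
  have Wcore: "w \<in> core" if "w \<in> W" for w
    using in_core[of w] that W(1) big[OF that] by blast
  have vg: "vertex_group G ?T w = vertex_group G X w" if "w \<in> core" for w
    using core_vact[OF that] by (simp add: stabilizer_def)
  have sub: "orbit G va ` W \<subseteq> nondegenerate_vertices G ?T"
  proof (rule image_subsetI)
    fix w assume w: "w \<in> W"
    have "\<not> degenerate G ?T w"
    proof
      assume "degenerate G ?T w"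
      then obtain e where e: "e \<in> edges ?T" "edge_group G ?T e = vertex_group G ?T w"
        by (auto simp: degenerate_def)
      have "edge_group G ?T e = edge_group G X e"
        using core_eact[OF e(1)] by (simp add: stabilizer_def)
      then have "vertex_group G X w \<subseteq> edge_group G X e" using e(2) vg[OF Wcore[OF w]] by simp
      moreover have "e \<in> E" using e(1) by (simp add: core_edges)
      ultimately show False using big[OF w] by blast
    qed
    moreover have "orbit G va w = orbit G (vact ?T) w"
      using core_vact[OF Wcore[OF w]] by (simp add: orbit_def)
    ultimately show "orbit G va w \<in> nondegenerate_vertices G ?T"
      using Wcore[OF w] unfolding nondegenerate_vertices_def core_vertices by blast
  qed
  have "of_nat (card (orbit G va ` W)) * c0 = (\<Sum>O'\<in>orbit G va ` W. c0)" by simp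
  also have "\<dots> \<le> sum ?f (orbit G va ` W)"
  proof (rule sum_mono)
    fix O' assume "O' \<in> orbit G va ` W"
    then obtain w where w: "w \<in> W" "O' = orbit G va w" by blast
    then have "w \<in> O'" using vertex.orbit_refl W(1) by blast
    then have "(SOME v. v \<in> O') \<in> O'" by (rule someI)
    then have "(SOME v. v \<in> O') \<in> W" using w W(2) by (auto simp: orbit_def)
    then show "c0 \<le> ?f O'" using c0 vg Wcore by simp
  qed
  \<comment> \<open>For non-negative terms the infinite sum is the supremum of its finite partial
    sums.\<close>
  also have "\<dots> \<le> infsum ?f (nondegenerate_vertices G ?T)"
    using True sub by (subst nonneg_infsum_complete) (auto intro!: SUP_upper)
  also have "\<dots> \<le> complexity \<phi> G X"
    using not_all_elliptic[of w1 w2] two W(1) big unfolding complexity_def Let_def by auto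
  finally show ?thesis .
qed simp

end

section \<open>The rank of a rose\<close>

locale rose =
  fixes Y :: "('v, 'e) pre_digraph" and \<iota> :: "'e \<Rightarrow> 'e" and y :: 'v
  assumes verts: "verts Y = {y}"
    and ends: "\<And>e. e \<in> arcs Y \<Longrightarrow> tail Y e = y \<and> head Y e = y"
    and inv_closed: "\<And>e. e \<in> arcs Y \<Longrightarrow> \<iota> e \<in> arcs Y"
    and inv_inv: "\<And>e. e \<in> arcs Y \<Longrightarrow> \<iota> (\<iota> e) = e"
    and inv_neq: "\<And>e. e \<in> arcs Y \<Longrightarrow> \<iota> e \<noteq> e"
begin

abbreviation "A \<equiv> arcs Y"
abbreviation "P \<equiv> fundamental_group Y \<iota> y"
abbreviation "cls \<equiv> homotopy_class Y \<iota> y"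
abbreviation "eqv \<equiv> word_eq A \<iota> {}"

lemma awalk_iff: "pre_digraph.awalk Y y p y \<longleftrightarrow> set p \<subseteq> A"
proof -
  have "set p \<subseteq> A \<Longrightarrow> pre_digraph.cas Y y p y"
  proof (induction p)
    case (Cons e p)
    then show ?case using ends[of e] by (auto simp: pre_digraph.cas.simps)
  qed (simp add: pre_digraph.cas.simps)
  then show ?thesis using verts by (auto simp: pre_digraph.awalk_def)
qed

lemma cls_eq: "cls p = {q. set q \<subseteq> A \<and> eqv p q}"
  by (simp add: homotopy_class_def awalk_iff)

lemma cls_self: "set p \<subseteq> A \<Longrightarrow> p \<in> cls p"
  by (simp add: cls_eq)

lemma cls_eqI: "eqv p q \<Longrightarrow> cls p = cls q"
  unfolding cls_eq using word_eq_trans word_eq_sym by blast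

lemma carrier_P: "carrier P = {cls p | p. set p \<subseteq> A}"
  by (simp add: fundamental_group_def awalk_iff)

lemma one_P: "\<one>\<^bsub>P\<^esub> = cls []"
  by (simp add: fundamental_group_def)

lemma mult_P:
  assumes "set p \<subseteq> A" "set q \<subseteq> A"
  shows "cls p \<otimes>\<^bsub>P\<^esub> cls q = cls (p @ q)"
proof -
  have "cls (p' @ q') = cls (p @ q)" if "p' \<in> cls p" "q' \<in> cls q" for p' q'
    using that word_eq_append[of A \<iota> "{}" p p' q q'] cls_eqI by (simp add: cls_eq)
  then have "(\<Union>p'\<in>cls p. \<Union>q'\<in>cls q. cls (p' @ q')) = cls (p @ q)"
    using cls_self assms by blast
  then show ?thesis by (simp add: fundamental_group_def)
qed

lemma word_inverse: "set p \<subseteq> A \<Longrightarrow> eqv (p @ rev (map \<iota> p)) [] \<and> eqv (rev (map \<iota> p) @ p) []"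
proof (induction p)
  case (Cons e p)
  then have e: "e \<in> A" "\<iota> e \<in> A" "\<iota> (\<iota> e) = e" and IH: "eqv (p @ rev (map \<iota> p)) []" "eqv (rev (map \<iota> p) @ p) []"
    using inv_closed inv_inv by auto
  have "eqv ([e] @ (p @ rev (map \<iota> p)) @ [\<iota> e]) ([e] @ [] @ [\<iota> e])"
    by (rule word_eq_context[OF IH(1)])
  then have 1: "eqv ((e # p) @ rev (map \<iota> (e # p))) []"
    using word_eq_cancel[OF e(1), of \<iota> "{}"] word_eq_trans by fastforce
  have "eqv (rev (map \<iota> p) @ [\<iota> e, \<iota> (\<iota> e)] @ p) (rev (map \<iota> p) @ [] @ p)"
    by (rule word_eq_context[OF word_eq_cancel[OF e(2)]])
  then have "eqv (rev (map \<iota> (e # p)) @ (e # p)) []"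
    using IH(2) word_eq_trans e(3) by fastforce
  with 1 show ?case ..
qed simp

lemma set_inverse: "set p \<subseteq> A \<Longrightarrow> set (rev (map \<iota> p)) \<subseteq> A"
  using inv_closed by auto

lemma group_P: "group P"
proof (rule groupI)
  show "\<one>\<^bsub>P\<^esub> \<in> carrier P" unfolding one_P carrier_P by (auto intro!: exI[of _ "[]"])
  fix X Z assume "X \<in> carrier P" "Z \<in> carrier P"
  then obtain p q where pq: "set p \<subseteq> A" "X = cls p" "set q \<subseteq> A" "Z = cls q" by (auto simp: carrier_P)
  then show "X \<otimes>\<^bsub>P\<^esub> Z \<in> carrier P"
    by (auto simp: mult_P carrier_P intro!: exI[of _ "p @ q"])
  show "\<one>\<^bsub>P\<^esub> \<otimes>\<^bsub>P\<^esub> X = X" using pq mult_P[of "[]" p] by (simp add: one_P)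
  show "\<exists>Y\<in>carrier P. Y \<otimes>\<^bsub>P\<^esub> X = \<one>\<^bsub>P\<^esub>"
  proof (rule bexI)
    show "cls (rev (map \<iota> p)) \<otimes>\<^bsub>P\<^esub> X = \<one>\<^bsub>P\<^esub>"
      using pq word_inverse[of p] set_inverse[of p] by (simp add: mult_P one_P cls_eqI)
    show "cls (rev (map \<iota> p)) \<in> carrier P" using set_inverse[OF pq(1)] unfolding carrier_P by blast
  qed
  fix W assume "W \<in> carrier P"
  then obtain r where "set r \<subseteq> A" "W = cls r" by (auto simp: carrier_P)
  then show "X \<otimes>\<^bsub>P\<^esub> Z \<otimes>\<^bsub>P\<^esub> W = X \<otimes>\<^bsub>P\<^esub> (Z \<otimes>\<^bsub>P\<^esub> W)"
    using pq by (simp add: mult_P)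
qed

text \<open>Counting modulo 2 how often a set of edges is traversed gives homomorphisms to the group
  of order 2, and these are determined by their values on a generating set.\<close>

definition parity :: "'e set \<Rightarrow> 'e list \<Rightarrow> bool" where
  "parity B p \<longleftrightarrow> odd (length (filter (\<lambda>e. e \<in> B) p))"

lemma parity_append: "parity B (p @ q) \<longleftrightarrow> parity B p \<noteq> parity B q"
  by (auto simp: parity_def)

definition cparity :: "'e set \<Rightarrow> 'e list set \<Rightarrow> bool" where
  "cparity B X = (\<exists>p \<in> X. parity B p)"

definition pairs :: "'e set set" where "pairs = (\<lambda>e. {e, \<iota> e}) ` A"

text \<open>Sets made of whole geometric edges are stable under reversal; so cancelling a backtrack
  removes both of its letters from the count or neither, and parity descends to homotopy
  classes.\<close>

lemma pairs_inv:
  assumes "\<B> \<subseteq> pairs" "e \<in> A"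
  shows "\<iota> e \<in> \<Union>\<B> \<longleftrightarrow> e \<in> \<Union>\<B>"
proof -
  have "\<iota> e \<in> C \<longleftrightarrow> e \<in> C" if C: "C \<in> pairs" for C
  proof -
    obtain f where f: "f \<in> A" "C = {f, \<iota> f}" using C by (auto simp: pairs_def)
    have "\<iota> e = f \<longleftrightarrow> e = \<iota> f" "\<iota> e = \<iota> f \<longleftrightarrow> e = f"
      using inv_inv[OF f(1)] inv_inv[OF assms(2)] by metis+
    then show ?thesis unfolding f(2) by blast
  qed
  then show ?thesis using assms(1) by blast
qed

lemma parity_eqv:
  assumes "\<B> \<subseteq> pairs" "eqv p q"
  shows "parity (\<Union>\<B>) p \<longleftrightarrow> parity (\<Union>\<B>) q"
  using assms(2) unfolding word_eq_def
proof (rule equivclp_invariant)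
  fix p q assume "word_step A \<iota> {} p q"
  then show "parity (\<Union>\<B>) p = parity (\<Union>\<B>) q"
  proof cases
    case (cancel e u v)
    then show ?thesis using pairs_inv[OF assms(1) cancel(3)] by (auto simp: parity_def)
  qed simp
qed

lemma cparity_cls: "\<B> \<subseteq> pairs \<Longrightarrow> set p \<subseteq> A \<Longrightarrow> cparity (\<Union>\<B>) (cls p) \<longleftrightarrow> parity (\<Union>\<B>) p"
  unfolding cparity_def using parity_eqv cls_self[of p] by (auto simp: cls_eq)

lemma cparity_mult:
  assumes "\<B> \<subseteq> pairs" "X \<in> carrier P" "Z \<in> carrier P"
  shows "cparity (\<Union>\<B>) (X \<otimes>\<^bsub>P\<^esub> Z) \<longleftrightarrow> cparity (\<Union>\<B>) X \<noteq> cparity (\<Union>\<B>) Z"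
proof -
  obtain p q where pq: "set p \<subseteq> A" "X = cls p" "set q \<subseteq> A" "Z = cls q"
    using assms by (auto simp: carrier_P)
  then show ?thesis
    using cparity_cls[OF assms(1), of p] cparity_cls[OF assms(1), of q] cparity_cls[OF assms(1), of "p @ q"]
    by (simp add: mult_P parity_append)
qed

text \<open>Every set of geometric edges defines a parity homomorphism, and different sets are told
  apart by the one-edge loops. Restriction to \<open>S\<close> is thus injective on these
  homomorphisms, which gives \<open>2 ^ card pairs \<le> 2 ^ card S\<close>.\<close>

lemma card_pairs_le_generators:
  assumes gen: "finite S" "generates P S"
  shows "finite pairs" "card pairs \<le> card S"
proof -
  interpret P: group P by (rule group_P)
  have S: "S \<subseteq> carrier P" using gen by (simp add: generates_def)
  have one_even: "\<not> cparity (\<Union>\<B>) \<one>\<^bsub>P\<^esub>" if "\<B> \<subseteq> pairs" for \<B>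
    using cparity_cls[OF that, of "[]"] by (simp add: one_P parity_def)
  have inj: "inj_on (\<lambda>\<B>. {X \<in> S. cparity (\<Union>\<B>) X}) (Pow pairs)"
  proof (rule inj_onI)
    fix \<B> \<C> assume BC: "\<B> \<in> Pow pairs" "\<C> \<in> Pow pairs"
      and eq: "{X \<in> S. cparity (\<Union>\<B>) X} = {X \<in> S. cparity (\<Union>\<C>) X}"
    then have B: "\<B> \<subseteq> pairs" and C: "\<C> \<subseteq> pairs" by auto
    have same: "cparity (\<Union>\<B>) X \<longleftrightarrow> cparity (\<Union>\<C>) X" if "X \<in> generate P S" for X
      using that
    proof induction
      case one
      then show ?case using one_even[OF B] one_even[OF C] by simp
    next
      case (incl X)
      then show ?case using eq by blast
    next
      case (inv X)
      then have X: "X \<in> carrier P" and XBC: "cparity (\<Union>\<B>) X \<longleftrightarrow> cparity (\<Union>\<C>) X" using S eq by blast+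
      show ?case
        using cparity_mult[OF B X P.inv_closed[OF X]] cparity_mult[OF C X P.inv_closed[OF X]]
          one_even[OF B] one_even[OF C] XBC P.r_inv[OF X] by simp
    next
      case (eng X Z)
      then have "X \<in> carrier P" "Z \<in> carrier P" using P.generate_in_carrier[OF S] by blast+
      then show ?case using cparity_mult[OF B] cparity_mult[OF C] eng.IH by simp
    qed
    have "e \<in> \<Union>\<B> \<longleftrightarrow> e \<in> \<Union>\<C>" if e: "e \<in> A" for e
    proof -
      have "cls [e] \<in> generate P S" using gen e by (auto simp: generates_def carrier_P)
      from same[OF this] show ?thesis
        using cparity_cls[OF B, of "[e]"] cparity_cls[OF C, of "[e]"] e by (simp add: parity_def split: if_splits)
    qed
    moreover have UA: "\<Union>\<D> \<subseteq> A" if "\<D> \<subseteq> pairs" for \<D>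
      using that inv_closed unfolding pairs_def by blast
    ultimately have "\<Union>\<B> = \<Union>\<C>" using UA[OF B] UA[OF C] by blast
    \<comment> \<open>Distinct geometric edges are disjoint, so a family of them is recovered from
      its union.\<close>
    moreover have mem: "\<D> = {D \<in> pairs. D \<subseteq> \<Union>\<D>}" if \<D>: "\<D> \<subseteq> pairs" for \<D>
    proof (intro equalityI subsetI)
      fix D assume "D \<in> {D \<in> pairs. D \<subseteq> \<Union>\<D>}"
      then obtain e where e: "e \<in> A" "D = {e, \<iota> e}" "D \<subseteq> \<Union>\<D>" by (auto simp: pairs_def)
      then obtain D' where D': "D' \<in> \<D>" "e \<in> D'" by blast
      then obtain f where f: "f \<in> A" "D' = {f, \<iota> f}" using \<D> by (auto simp: pairs_def)
      have "e = f \<or> e = \<iota> f" using D'(2) f(2) by simp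
      then have "D' = D" using e(2) f inv_inv[OF f(1)] by (elim disjE) (simp_all add: insert_commute)
      then show "D \<in> \<D>" using D' by simp
    qed (use \<D> in blast)
    ultimately show "\<B> = \<C>" using mem[OF B] mem[OF C] by simp
  qed
  have sub: "(\<lambda>\<B>. {X \<in> S. cparity (\<Union>\<B>) X}) ` Pow pairs \<subseteq> Pow S" by blast
  then have "finite (Pow pairs)" using inj gen(1) by (meson finite_Pow_iff inj_on_finite)
  then show fin: "finite pairs" by simp
  have "card (Pow pairs) \<le> card (Pow S)" using card_inj_on_le[OF inj sub] gen(1) by simp
  then show "card pairs \<le> card S" using gen(1) fin by (simp add: card_Pow)
qed

lemma graph_rank_lower_bound:
  assumes "2 * m \<le> card A"
  shows "of_nat m \<le> graph_rank Y \<iota>"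
proof -
  have y: "(SOME z. z \<in> verts Y) = y" using verts by simp
  have "m \<le> card S" if S: "finite S" "generates P S" for S
  proof -
    note p = card_pairs_le_generators[OF S]
    have "A = \<Union>pairs" using inv_closed by (auto simp: pairs_def)
    then have "card A \<le> (\<Sum>C\<in>pairs. card C)" using card_Union_le_sum_card[of pairs] by simp
    also have "\<dots> \<le> (\<Sum>C\<in>pairs. 2)"
      by (rule sum_mono) (auto simp: pairs_def card_insert_if)
    finally show ?thesis using p assms by simp
  qed
  then have "of_nat m \<le> (INF S\<in>{S. finite S \<and> generates P S}. of_nat (card S) :: ennreal)"
    by (intro INF_greatest) auto
  then show ?thesis by (simp add: graph_rank_def group_rank_def y)
qed

end

section \<open>Free actions on trees\<close>

lemma (in tree_action) nat_collapse:
  assumes V: "countable V" and E: "countable E" and F: "forest F"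
  obtains c :: "'v \<Rightarrow> nat" and d :: "'e \<Rightarrow> nat" where "tree_collapse G X F c d"
proof -
  \<comment> \<open>A component is named by the number of a vertex chosen in it; related vertices
    define the same predicate and hence the same choice.\<close>
  define c where "c x = to_nat_on V (SOME z. z \<in> V \<and> (x, z) \<in> (st F)\<^sup>*)" for x
  have c: "c x = c y \<longleftrightarrow> (x, y) \<in> (st F)\<^sup>*" if xy: "x \<in> V" "y \<in> V" for x y
  proof -
    let ?s = "\<lambda>x. SOME z. z \<in> V \<and> (x, z) \<in> (st F)\<^sup>*"
    have s: "?s x \<in> V \<and> (x, ?s x) \<in> (st F)\<^sup>*" if "x \<in> V" for x
      by (rule someI[of _ x]) (use that in simp)
    show ?thesis
    proof
      assume "c x = c y"
      then have eq: "?s x = ?s y"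
        using inj_on_to_nat_on[OF V] s[OF xy(1)] s[OF xy(2)] by (simp add: c_def inj_on_eq_iff)
      have "(x, ?s x) \<in> (st F)\<^sup>*" "(?s y, y) \<in> (st F)\<^sup>*"
        using s[OF xy(1)] forest_sym[OF F] s[OF xy(2)] by blast+
      then show "(x, y) \<in> (st F)\<^sup>*" unfolding eq by (rule rtrancl_trans)
    next
      assume "(x, y) \<in> (st F)\<^sup>*"
      then have "(x, z) \<in> (st F)\<^sup>* \<longleftrightarrow> (y, z) \<in> (st F)\<^sup>*" for z
        using forest_sym[OF F, of x y] rtrancl_trans[of y x _ z] rtrancl_trans[of x y _ z] by blast
      then show "c x = c y" by (simp add: c_def)
    qed
  qed
  have "inj_on (to_nat_on E) (E - F)" by (rule inj_on_subset[OF inj_on_to_nat_on[OF E]]) simp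
  then have "tree_collapse G X F c (to_nat_on E)"
    using F c by unfold_locales auto
  then show ?thesis by (rule that)
qed

context tree_action
begin

text \<open>All edge and vertex groups are trivial, so reducedness turns every edge into a loop of
  the quotient. With a single orbit of vertices the tree is its own minimal subtree and the quotient
  is a rose. Freeness makes \<open>g\<close> hyperbolic, and the bound comes from the rank
  term.\<close>

lemma free_action_rose:
  assumes free: "\<And>x. x \<in> V \<Longrightarrow> vertex_group G X x = {\<one>}"
    and red: "reduced_splitting G X" and g: "g \<in> carrier G" "g \<noteq> \<one>"
    and m: "2 * m \<le> card (orbits G E ea)"
  shows "of_nat m \<le> complexity \<phi> G X"
proof -
  have step: "orbit G va (ini e) = orbit G va (ter e)" if e: "e \<in> E" for e
  proof (rule ccontr)
    assume "orbit G va (ini e) \<noteq> orbit G va (ter e)"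
    then have "edge_group G X e \<subset> {\<one>}"
      using red e free unfolding reduced_splitting_def by force
    then show False using subgroup.one_closed[OF edge_group_subgroup[OF e]] by blast
  qed
  have orb: "orbit G va x = orbit G va y" if "x \<in> V" "y \<in> V" for x y
    using connected[OF that]
  proof (induction rule: rtrancl_induct)
    case (step y z)
    then show ?case using \<open>\<And>e. e \<in> E \<Longrightarrow> orbit G va (ini e) = orbit G va (ter e)\<close>
      by (auto simp: steps_def)
  qed simp
  have core_V: "core = V"
  proof (intro equalityI core_subset subsetI)
    fix x assume x: "x \<in> V"
    show "x \<in> core"
      unfolding core_def
    proof (rule InterI, unfold mem_Collect_eq)
      fix W assume W: "invariant_subtree G X W"
      obtain w where w: "w \<in> W" using invariant_subtree_connected(2)[OF W] by blast
      then have "w \<in> V" using invariant_subtree_connected(1)[OF W] by blast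
      then have "x \<in> orbit G va w" using orb[OF x] vertex.orbit_refl[OF x] by blast
      then show "x \<in> W" using invariant_subtree_connected(3)[OF W _ w] by (auto simp: orbit_def)
    qed
  qed
  let ?T = "minimal_subtree G X"
  let ?Q = "quotient_graph G ?T"
  have vT: "vertices ?T = V" using core_vertices core_V by simp
  have eT: "edges ?T = E" using core_edges core_V by auto
  have oV: "orbit G (vact ?T) x = orbit G va x" if "x \<in> V" for x
    using core_vact that core_V by (simp add: orbit_def)
  have oE: "orbit G (eact ?T) e = orbit G ea e" if "e \<in> E" for e
    using core_eact that eT by (simp add: orbit_def)
  obtain y where y: "y \<in> V" using nonempty by blast
  have qverts: "verts ?Q = {orbit G va y}"
  proof -
    have "orbit G (vact ?T) x = orbit G va y" if "x \<in> V" for x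
      using oV[OF that] orb[OF that y] by simp
    then have "orbit G (vact ?T) ` V = (\<lambda>_. orbit G va y) ` V" by (rule image_cong[OF refl])
    then show ?thesis using y unfolding quotient_graph_def orbits_eq_image vT by auto
  qed
  have qarcs: "arcs ?Q = orbits G E ea"
    using image_cong[OF refl oE, of E] unfolding quotient_graph_def orbits_eq_image eT by simp
  have tl: "tail (space ?T) = ini" "head (space ?T) = ter"
    by (simp_all add: minimal_subtree_core restrict_action_def induce_subgraph_def)
  have fl: "flip ?T ` orbit G ea e = orbit G ea (fl e)" if e: "e \<in> E" for e
  proof -
    have "flip ?T f = fl f" if "f \<in> E" for f
      using eT that unfolding minimal_subtree_core restrict_action_def by simp
    then show ?thesis
      unfolding orbit_eq_image image_image using e by (intro image_cong) simp_all
  qed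
  have img: "ini ` orbit G ea e = orbit G va (ini e)" "ter ` orbit G ea e = orbit G va (ter e)" if "e \<in> E" for e
    unfolding orbit_eq_image image_image using that by (auto intro!: image_cong)
  have flQ: "quotient_flip G ?T (orbit G ea e) = orbit G ea (fl e)" if e: "e \<in> E" for e
    using fl[OF e] qarcs e by (simp add: quotient_flip_def orbits_eq_image)
  interpret rose ?Q "quotient_flip G ?T" "orbit G va y"
  proof
    show "verts ?Q = {orbit G va y}" by (rule qverts)
    fix O' assume "O' \<in> arcs ?Q"
    then obtain e where e: "e \<in> E" "O' = orbit G ea e" by (auto simp: qarcs orbits_eq_image)
    show "tail ?Q O' = orbit G va y \<and> head ?Q O' = orbit G va y"
      using img[OF e(1)] orb[OF _ y] e by (simp add: quotient_graph_def tl)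
    show "quotient_flip G ?T O' \<in> arcs ?Q" using flQ e by (auto simp: qarcs orbits_eq_image)
    show "quotient_flip G ?T (quotient_flip G ?T O') = O'" using flQ[of e] flQ[of "fl e"] e by simp
    show "quotient_flip G ?T O' \<noteq> O'"
    proof
      assume "quotient_flip G ?T O' = O'"
      then have "fl e \<in> orbit G ea e" using flQ[OF e(1)] e edge.orbit_refl[of "fl e"] by auto
      then obtain g where g: "g \<in> carrier G" "ea g e = fl e" by (auto simp: orbit_def)
      then show False using equivariant(4)[OF g(1) e(1)] by simp
    qed
  qed
  have "of_nat m \<le> graph_rank ?Q (quotient_flip G ?T)"
    using m graph_rank_lower_bound qarcs by simp
  also have "\<dots> \<le> complexity \<phi> G X"
  proof -
    have "\<not> elliptic X g"
    proof
      assume "elliptic X g"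
      then obtain x where "x \<in> V" "g \<in> vertex_group G X x" using g by (auto simp: elliptic_def stabilizer_def)
      then show False using free g(2) by blast
    qed
    then have "\<not> (\<forall>g\<in>carrier G. elliptic X g)" using g(1) by blast
    then show ?thesis unfolding complexity_def Let_def by (subst if_not_P) simp_all
  qed
  finally show ?thesis .
qed

text \<open>The last inequality is \<open>m \<le> 1 - (vertices) + (edges)\<close> for the quotient
  graph, doubled because arcs are counted. A maximal good forest preserves this Euler characteristic
  bound, and collapsing it leaves a rose.\<close>

lemma C_max_fin_free_action:
  assumes free: "\<And>x. x \<in> V \<Longrightarrow> vertex_group G X x = {\<one>}"
    and count: "countable V" "countable E"
    and fin: "finite (V // orbit_rel {})"
    and g: "g \<in> carrier G" "g \<noteq> \<one>"
    and m: "finite (orbit G ea ` E)" "2 * m + 2 * card (V // orbit_rel {}) \<le> card (orbit G ea ` E) + 2"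
  shows "of_nat m \<le> C_max_fin G"
proof -
  obtain F where F: "good_forest F" and finF': "finite (V // orbit_rel F)"
    and max: "\<forall>e\<in>E. (\<forall>g\<in>carrier G. (ini e, va g (ter e)) \<notin> (st F)\<^sup>*) \<longrightarrow>
      (\<exists>g\<in>carrier G. (va g (ini e), ini e) \<in> (st F)\<^sup>* \<and> ea g e \<noteq> e)"
    by (rule maximal_good_forest[OF fin])
  have forest: "forest F" using F by (simp add: good_forest_def)
  obtain c :: "'v \<Rightarrow> nat" and d :: "'e \<Rightarrow> nat" where "tree_collapse G X F c d"
    using nat_collapse[OF count forest] .
  then interpret T: tree_collapse G X F c d .
  have red: "reduced_splitting G T.Y" by (rule T.collapse_reduced[OF max])
  interpret Y: tree_action G T.Y by unfold_locales (rule T.collapse_splitting)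
  have freeY: "vertex_group G T.Y z = {\<one>}" if z: "z \<in> vertices T.Y" for z
  proof -
    \<comment> \<open>The stabilizer of a collapsed vertex is that of the distinguished vertex in
      its component, hence trivial.\<close>
    obtain x where x: "x \<in> V" "z = c x" using z by (auto simp: T.verts_Y)
    obtain u where u: "u \<in> V" "(x, u) \<in> (st F)\<^sup>*"
      "\<And>g. g \<in> carrier G \<Longrightarrow> (va g u, u) \<in> (st F)\<^sup>* \<Longrightarrow> va g u = u"
      using F x(1) unfolding good_forest_def by blast
    have "z = c u" using T.c[OF x(1) u(1)] u(2) x(2) by simp
    then have "vertex_group G T.Y z \<subseteq> vertex_group G X u"
      using T.vertex_group_Y[OF u(1)] u(3) by (auto simp: stabilizer_def)
    then have "vertex_group G T.Y z \<subseteq> {\<one>}" using free[OF u(1)] by simp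
    then show ?thesis using subgroup.one_closed[OF Y.vertex_group_subgroup[OF z]] by blast
  qed
  have edge: "finite (edge_group G T.Y e)" if e: "e \<in> edges T.Y" for e
  proof -
    have "edge_group G T.Y e \<subseteq> {\<one>}"
      using Y.edge_group_le_tail[OF e] freeY[OF Y.ini_ter_closed(1)[OF e]] by simp
    then show ?thesis by (rule finite_subset) simp
  qed
  have orbs: "orbits G (edges T.Y) (eact T.Y) = (\<lambda>O'. d ` O') ` (orbit G ea ` (E - F))"
    unfolding orbits_eq_image T.edges_Y image_image by (intro image_cong refl T.eorbit_Y)
  have subE: "orbit G ea e \<subseteq> E - F" if "e \<in> E - F" for e
    using T.ea_remaining that by (auto simp: orbit_def)
  have "inj_on (\<lambda>O'. d ` O') (orbit G ea ` (E - F))"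
  proof (rule inj_onI)
    fix O1 O2 assume O: "O1 \<in> orbit G ea ` (E - F)" "O2 \<in> orbit G ea ` (E - F)" "d ` O1 = d ` O2"
    have "O1 \<subseteq> E - F" using O(1) subE by (elim imageE) simp
    moreover have "O2 \<subseteq> E - F" using O(2) subE by (elim imageE) simp
    ultimately show "O1 = O2" using inj_on_image_eq_iff[OF T.d] O(3) by blast
  qed
  then have cardY: "card (orbits G (edges T.Y) (eact T.Y)) = card (orbit G ea ` (E - F))"
    unfolding orbs by (rule card_image)
  have finF: "finite (orbit G ea ` F)"
    and leF: "card (orbit G ea ` F) + 2 * card (V // orbit_rel F) \<le> 2 * card (V // orbit_rel {})"
    using F by (simp_all add: good_forest_def)
  have "orbit G ea ` E \<subseteq> orbit G ea ` (E - F) \<union> orbit G ea ` F" by blast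
  then have "card (orbit G ea ` E) \<le> card (orbit G ea ` (E - F) \<union> orbit G ea ` F)"
    by (rule card_mono[rotated]) (use finF finite_subset[OF _ m(1), of "orbit G ea ` (E - F)"] in auto)
  also have "\<dots> \<le> card (orbit G ea ` (E - F)) + card (orbit G ea ` F)" by (rule card_Un_le)
  finally have E_le: "card (orbit G ea ` E) \<le> card (orbit G ea ` (E - F)) + card (orbit G ea ` F)" .
  have "card (V // orbit_rel F) \<ge> 1"
  proof -
    obtain y where "y \<in> V" using nonempty by blast
    then have "V // orbit_rel F \<noteq> {}" using quotientI[of y V "orbit_rel F"] by blast
    then show ?thesis using finF' by (simp add: Suc_leI card_gt_0_iff)
  qed
  then have "2 * m \<le> card (orbits G (edges T.Y) (eact T.Y))"
    unfolding cardY using E_le leF m(2) by linarith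
  then have "of_nat m \<le> complexity (\<lambda>_. 0) G T.Y"
    using Y.free_action_rose[OF freeY red g] by blast
  also have "\<dots> \<le> C_max_fin G"
    unfolding C_max_fin_def finite_edge_splitting_def using red edge T.collapse_splitting
    by (intro SUP_upper) simp
  finally show ?thesis .
qed

end

section \<open>Cayley trees of free groups\<close>

lemma (in tree_action) quotient_orbit_rel_empty: "V // orbit_rel {} = orbits G V va"
proof -
  have "orbit_rel {} `` {x} = orbit G va x" if x: "x \<in> V" for x
  proof (intro equalityI subsetI)
    fix y assume "y \<in> orbit_rel {} `` {x}"
    then obtain g where "y \<in> V" "g \<in> carrier G" "x = va g y" by (auto simp: orbit_rel_def steps_def)
    then show "y \<in> orbit G va x" unfolding orbit_eq_image by (intro image_eqI[of _ _ "inv g"]) simp_all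
  next
    fix y assume "y \<in> orbit G va x"
    then obtain g where "g \<in> carrier G" "y = va g x" by (auto simp: orbit_def)
    then show "y \<in> orbit_rel {} `` {x}" using x by (auto simp: orbit_rel_def intro!: bexI[of _ "inv g"])
  qed
  then show ?thesis unfolding quotient_def orbits_eq_image by auto
qed

context group
begin

lemma mult_inv_cancel:
  assumes "g \<in> carrier G" "h \<in> carrier G" "t \<in> carrier G"
  shows "g \<otimes> inv t \<otimes> inv (h \<otimes> inv t) = g \<otimes> inv h"
proof -
  have "g \<otimes> inv t \<otimes> inv (h \<otimes> inv t) = g \<otimes> (inv t \<otimes> (t \<otimes> inv h))"
    using assms by (simp add: inv_mult_group m_assoc)
  also have "inv t \<otimes> (t \<otimes> inv h) = inv h" using assms by (simp add: m_assoc[symmetric])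
  finally show ?thesis .
qed

text \<open>The map \<open>f\<close> records the coset of \<open>K\<close> and, after division by a
  representative, the coset of \<open>N\<close> inside \<open>K\<close>. It is constant on cosets of
  \<open>N\<close>, separates them, and is onto the product.\<close>

lemma index_tower:
  assumes K: "subgroup K G" "finite (rcosets K)" and N: "subgroup N (G\<lparr>carrier := K\<rparr>)"
    and fin: "finite (rcosets\<^bsub>G\<lparr>carrier := K\<rparr>\<^esub> N)"
  shows "finite (rcosets N)" "card (rcosets N) = card (rcosets K) * card (rcosets\<^bsub>G\<lparr>carrier := K\<rparr>\<^esub> N)"
proof -
  interpret K: group "G\<lparr>carrier := K\<rparr>" using subgroup_imp_group[OF K(1)] .
  have KG: "K \<subseteq> carrier G" using subgroup.subset[OF K(1)] .
  have NK: "N \<subseteq> K" using subgroup.subset[OF N] by simp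
  have NG: "subgroup N G" using incl_subgroup[OF K(1) N] .
  have coset_eq: "N #>\<^bsub>G\<lparr>carrier := K\<rparr>\<^esub> k = N #> k" for k by (simp add: r_coset_def)
  define t where "t C = (SOME g. g \<in> carrier G \<and> C = K #> g)" for C
  have t: "t (K #> g) \<in> carrier G \<and> K #> g = K #> t (K #> g)" if "g \<in> carrier G" for g
    unfolding t_def by (rule someI[of _ g]) (use that in simp)
  define f where "f g = (K #> g, N #> (g \<otimes> inv (t (K #> g))))" for g
  have img: "f ` carrier G = (rcosets K) \<times> (rcosets\<^bsub>G\<lparr>carrier := K\<rparr>\<^esub> N)"
  proof (intro equalityI subsetI)
    fix z assume "z \<in> f ` carrier G"
    then obtain g where g: "g \<in> carrier G" "z = f g" by blast
    note tg = t[OF g(1)]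
    have "g \<otimes> inv (t (K #> g)) \<in> K" using coset_eq_iff[OF K(1) g(1), of "t (K #> g)"] tg by blast
    then show "z \<in> (rcosets K) \<times> (rcosets\<^bsub>G\<lparr>carrier := K\<rparr>\<^esub> N)"
      using g by (auto simp: f_def RCOSETS_def coset_eq)
  next
    fix z assume "z \<in> (rcosets K) \<times> (rcosets\<^bsub>G\<lparr>carrier := K\<rparr>\<^esub> N)"
    then obtain g k where gk: "g \<in> carrier G" "k \<in> K" "z = (K #> g, N #> k)"
      by (auto simp: RCOSETS_def coset_eq)
    let ?t = "t (K #> g)"
    have tg: "?t \<in> carrier G" "K #> g = K #> ?t" using t[OF gk(1)] by blast+
    have kG: "k \<in> carrier G" using gk KG by blast
    have "K #> (k \<otimes> ?t) = K #> ?t"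
      using coset_eq_iff[OF K(1), of "k \<otimes> ?t" ?t] kG tg(1) gk(2) by (simp add: m_assoc)
    then have "K #> (k \<otimes> ?t) = K #> g" using tg(2) by simp
    then have "f (k \<otimes> ?t) = z" using gk kG tg(1) by (simp add: f_def m_assoc)
    then show "z \<in> f ` carrier G" using kG tg(1) by blast
  qed
  have fin_img: "finite (f ` carrier G)" unfolding img using K fin by simp
  have inj: "g \<otimes> inv h \<in> N" if gh: "g \<in> carrier G" "h \<in> carrier G" and eq: "f g = f h" for g h
  proof -
    let ?t = "t (K #> g)"
    have tG: "?t \<in> carrier G" using t[OF gh(1)] by blast
    have Kg: "K #> g = K #> h" and Ng: "N #> (g \<otimes> inv ?t) = N #> (h \<otimes> inv (t (K #> h)))"
      using eq unfolding f_def by blast+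
    have "N #> (g \<otimes> inv ?t) = N #> (h \<otimes> inv ?t)" using Ng unfolding Kg .
    then have "g \<otimes> inv ?t \<otimes> inv (h \<otimes> inv ?t) \<in> N"
      using coset_eq_iff[OF NG, of "g \<otimes> inv ?t" "h \<otimes> inv ?t"] gh tG by simp
    then show ?thesis using mult_inv_cancel[OF gh tG] by simp
  qed
  show finN: "finite (rcosets N)" by (rule rcosets_bound(1)[OF NG fin_img inj])
  have le: "card (rcosets N) \<le> card (f ` carrier G)" by (rule rcosets_bound(2)[OF NG fin_img inj])
  have "f ` carrier G \<subseteq> (\<lambda>C. f (SOME g. g \<in> carrier G \<and> C = N #> g)) ` (rcosets N)"
  proof (rule image_subsetI)
    fix g assume g: "g \<in> carrier G"
    let ?h = "SOME h. h \<in> carrier G \<and> N #> g = N #> h"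
    have h: "?h \<in> carrier G \<and> N #> g = N #> ?h" by (rule someI[of _ g]) (use g in simp)
    then have gh: "g \<otimes> inv ?h \<in> N" using coset_eq_iff[OF NG g] by blast
    then have Kg: "K #> g = K #> ?h" using coset_eq_iff[OF K(1) g] h NK by blast
    let ?t = "t (K #> g)"
    have tG: "?t \<in> carrier G" using t[OF g] by blast
    have "g \<otimes> inv ?t \<otimes> inv (?h \<otimes> inv ?t) \<in> N"
      using gh mult_inv_cancel[OF g conjunct1[OF h] tG] by simp
    then have "N #> (g \<otimes> inv ?t) = N #> (?h \<otimes> inv ?t)"
      using coset_eq_iff[OF NG, of "g \<otimes> inv ?t" "?h \<otimes> inv ?t"] g h tG by simp
    then have "f g = f ?h" using Kg by (simp add: f_def)
    moreover have "N #> g \<in> rcosets N" using g by (auto simp: RCOSETS_def)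
    ultimately show "f g \<in> (\<lambda>C. f (SOME g. g \<in> carrier G \<and> C = N #> g)) ` (rcosets N)" by (rule image_eqI)
  qed
  then have "card (f ` carrier G) \<le> card (rcosets N)" using finN by (rule surj_card_le[rotated])
  with le have "card (rcosets N) = card (f ` carrier G)" by simp
  then show "card (rcosets N) = card (rcosets K) * card (rcosets\<^bsub>G\<lparr>carrier := K\<rparr>\<^esub> N)"
    unfolding img card_cartesian_product .
qed

text \<open>Pigeonhole among the cosets of the powers of \<open>z\<close>: if exponents
  \<open>i < j\<close> give the same coset, then the power \<open>j - i\<close> lies in
  \<open>N\<close>.\<close>

lemma pow_in_finite_index:
  assumes N: "subgroup N G" "finite (rcosets N)" and z: "z \<in> carrier G"
  obtains m :: nat where "m > 0" "z [^] m \<in> N"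
proof -
  have "(\<lambda>i. N #> z [^] i) ` (UNIV :: nat set) \<subseteq> rcosets N" using z by (auto simp: RCOSETS_def)
  then have "finite ((\<lambda>i. N #> z [^] i) ` (UNIV :: nat set))" using N(2) finite_subset by blast
  then have "\<not> inj_on (\<lambda>i. N #> z [^] i) (UNIV :: nat set)" using finite_imageD infinite_UNIV_nat by blast
  then obtain i j :: nat where "i \<noteq> j" "N #> z [^] i = N #> z [^] j" by (auto simp: inj_on_def)
  then obtain i j :: nat where ij: "i < j" "N #> z [^] j = N #> z [^] i" by (metis linorder_neqE_nat)
  have "z [^] j = z [^] (j - i) \<otimes> z [^] i" using ij z by (simp add: nat_pow_mult)
  then have "z [^] j \<otimes> inv (z [^] i) = z [^] (j - i)" using z by (simp add: m_assoc)
  moreover have "z [^] j \<otimes> inv (z [^] i) \<in> N" using coset_eq_iff[OF N(1)] ij(2) z by blast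
  ultimately show ?thesis using that[of "j - i"] ij by simp
qed

end

context free_basis
begin

text \<open>The basis letters \<open>S0\<close> in the normal forms of \<open>T\<close> already
  generate. Reduction creates no new letters, so a basis element spelled over \<open>S0\<close>,
  whose normal form is itself, belongs to \<open>S0\<close>.\<close>

lemma finite_basis:
  assumes "finite T" "generates G T"
  shows "finite S"
proof -
  have T: "T \<subseteq> carrier G" using assms(2) by (simp add: generates_def)
  define S0 where "S0 = (\<Union>t\<in>T. fst ` set (nf t))"
  have fin: "finite S0" unfolding S0_def using assms(1) by simp
  have nf_in: "nf g \<in> lists letters" if g: "g \<in> carrier G" for g
  proof -
    obtain w where "w \<in> lists letters" "word_value G w = g" using word_value_surj[OF basis_generates g] .
    then show ?thesis using nf_word_value stack_props by metis
  qed
  have S0S: "S0 \<subseteq> S"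
  proof
    fix s assume "s \<in> S0"
    then obtain t x where tx: "t \<in> T" "x \<in> set (nf t)" "s = fst x" unfolding S0_def by blast
    have "nf t \<in> lists letters" using nf_in T tx(1) by blast
    then have "x \<in> letters" using tx(2) by (auto simp del: mem_Sigma_iff)
    then show "s \<in> S" using tx(3) by (cases x) simp
  qed
  have S0: "S0 \<subseteq> carrier G" by (rule subset_trans[OF S0S basis_subset])
  have "T \<subseteq> generate G S0"
  proof
    fix t assume t: "t \<in> T"
    have "rev (nf t) \<in> lists (S0 \<times> UNIV)"
    proof (rule in_listsI, rule ballI)
      fix y assume "y \<in> set (rev (nf t))"
      then have "fst y \<in> S0" unfolding S0_def using t by (intro UN_I[of t] imageI) simp_all
      then show "y \<in> S0 \<times> UNIV" by (simp add: mem_Times_iff)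
    qed
    from word_value_in_generate[OF S0 this] show "t \<in> generate G S0"
      using word_value_rev_nf[OF subsetD[OF T t]] by simp
  qed
  then have "generate G T \<subseteq> generate G S0"
    by (rule generate_subgroup_incl[OF _ generate_is_subgroup[OF S0]])
  then have gen: "generate G S0 = carrier G"
    using generate_incl[OF S0] assms(2) unfolding generates_def by blast
  have stack_sub: "set (stack w) \<subseteq> set w" for w :: "('a \<times> bool) list"
  proof (induction w rule: rev_induct)
    case (snoc y w)
    have "set (push r y) \<subseteq> insert y (set r)" for r by (cases r) auto
    then show ?case using snoc by (auto simp: stack_snoc)
  qed (simp add: stack_def)
  have "S \<subseteq> S0"
  proof
    fix s assume s: "s \<in> S"
    then have "s \<in> generate G S0" using gen by simp
    then obtain w where w: "w \<in> lists (S0 \<times> UNIV)" "word_value G w = s" using generate_word[OF S0] by blast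
    have "w \<in> lists letters" using w(1) S0S by auto
    then have "stack w = [(s, True)]" using nf_word_value[of w] w(2) nf_pow[OF s, of 1] s by simp
    then have "(s, True) \<in> set w" using stack_sub[of w] by simp
    then show "s \<in> S0" using w(1) by auto
  qed
  then show ?thesis using fin finite_subset by blast
qed

section \<open>The Cayley tree and its quotients by subgroups\<close>

definition cayley :: "('a, 'a, 'a \<times> 'a \<times> bool) graph_action" where
  "cayley =
     \<lparr>space = \<lparr>verts = carrier G, arcs = carrier G \<times> letters, tail = fst,
        head = (\<lambda>(g, x). g \<otimes> letter_value G x)\<rparr>,
      flip = (\<lambda>(g, x). if g \<in> carrier G \<and> x \<in> letters then (g \<otimes> letter_value G x, linv x) else (g, x)),
      vact = (\<lambda>g. restrict (\<lambda>h. g \<otimes> h) (carrier G)),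
      eact = (\<lambda>g. restrict (\<lambda>(h, x). (g \<otimes> h, x)) (carrier G \<times> letters))\<rparr>"

lemma letter_closed [simp]: "x \<in> letters \<Longrightarrow> letter_value G x \<in> carrier G"
  by (rule letter_value_closed[OF basis_subset])

lemma cayley_sel:
  "vertices cayley = carrier G" "edges cayley = carrier G \<times> letters"
  "tail (space cayley) (g, x) = g" "head (space cayley) (g, x) = g \<otimes> letter_value G x"
  "g \<in> carrier G \<Longrightarrow> x \<in> letters \<Longrightarrow> flip cayley (g, x) = (g \<otimes> letter_value G x, linv x)"
  "h \<in> carrier G \<Longrightarrow> vact cayley g h = g \<otimes> h"
  "h \<in> carrier G \<Longrightarrow> x \<in> letters \<Longrightarrow> eact cayley g (h, x) = (g \<otimes> h, x)"
  by (simp_all add: cayley_def)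

lemma cancel_letter: "g \<in> carrier G \<Longrightarrow> x \<in> letters \<Longrightarrow> g \<otimes> letter_value G x \<otimes> letter_value G (linv x) = g"
  using letter_value_linv[OF basis_subset, of x] letter_closed[of x] by (simp add: m_assoc)

text \<open>After translation by \<open>inv g\<close> the deleted edge is the one from
  \<open>\<one>\<close> to \<open>x\<close>. Membership in the branch of \<open>x\<close> is then
  constant along paths, but differs at the two ends.\<close>

lemma cayley_separating:
  assumes g: "g \<in> carrier G" and x: "x \<in> letters"
  shows "(g \<otimes> letter_value G x, g) \<notin>
    (steps (space cayley) (carrier G \<times> letters - {(g, x), (g \<otimes> letter_value G x, linv x)}))\<^sup>*"
proof
  let ?A = "carrier G \<times> letters - {(g, x), (g \<otimes> letter_value G x, linv x)}"
  assume "(g \<otimes> letter_value G x, g) \<in> (steps (space cayley) ?A)\<^sup>*"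
  moreover have "inv g \<otimes> (g \<otimes> letter_value G x) \<in> branch x \<longleftrightarrow> inv g \<otimes> q \<in> branch x"
    if "(g \<otimes> letter_value G x, q) \<in> (steps (space cayley) ?A)\<^sup>*" for q
    using that
  proof induction
    case (step p q)
    from step(2) obtain e where e: "e \<in> ?A" "p = tail (space cayley) e" "q = head (space cayley) e"
      unfolding steps_def by blast
    obtain h y where "e = (h, y)" by (cases e)
    with e have hy: "(h, y) \<in> ?A" "p = h" "q = h \<otimes> letter_value G y" by (simp_all only: cayley_sel)
    then have h: "h \<in> carrier G" and y: "y \<in> letters" by blast+
    have "\<not> (inv g \<otimes> h = \<one> \<and> y = x)"
    proof
      assume *: "inv g \<otimes> h = \<one> \<and> y = x"
      then have "g \<otimes> (inv g \<otimes> h) = g" using g by simp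
      then have "h = g" using g h by (simp add: m_assoc[symmetric])
      then show False using * hy(1) by simp
    qed
    moreover have "\<not> (inv g \<otimes> h = letter_value G x \<and> y = linv x)"
    proof
      assume *: "inv g \<otimes> h = letter_value G x \<and> y = linv x"
      then have "g \<otimes> (inv g \<otimes> h) = g \<otimes> letter_value G x" by simp
      then have "h = g \<otimes> letter_value G x" using g h by (simp add: m_assoc[symmetric])
      then show False using * hy(1) by simp
    qed
    ultimately have "inv g \<otimes> h \<otimes> letter_value G y \<in> branch x \<longleftrightarrow> inv g \<otimes> h \<in> branch x"
      using g h by (intro branch_step[OF _ y x]) auto
    moreover have "inv g \<otimes> q = inv g \<otimes> h \<otimes> letter_value G y"
      unfolding hy(3) by (rule m_assoc[OF inv_closed[OF g] h letter_closed[OF y], symmetric])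
    ultimately show ?case using step.IH unfolding hy(2) by (simp only:)
  qed simp
  ultimately have "inv g \<otimes> (g \<otimes> letter_value G x) \<in> branch x \<longleftrightarrow> inv g \<otimes> g \<in> branch x" by blast
  moreover have "inv g \<otimes> (g \<otimes> letter_value G x) = letter_value G x"
    using m_assoc[OF inv_closed[OF g] g letter_closed[OF x]] g letter_closed[OF x] by simp
  ultimately show False using letter_in_branch[OF x] g by simp
qed

lemma cayley_splitting: "splitting G cayley"
proof -
  have arc: "\<exists>g x. e = (g, x) \<and> g \<in> carrier G \<and> x \<in> letters" if "e \<in> edges cayley" for e
    using that by (cases e) (simp add: cayley_sel)
  have "tree (space cayley) (flip cayley)"
  proof unfold_locales
    fix e
    show "e \<in> edges cayley \<longleftrightarrow> flip cayley e \<noteq> e"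
    proof (cases "e \<in> edges cayley")
      case True
      then obtain g x where "e = (g, x)" "g \<in> carrier G" "x \<in> letters" using arc by blast
      then show ?thesis using True cayley_sel(5)[of g x] by simp
    next
      case False
      then show ?thesis by (cases e) (auto simp: cayley_def)
    qed
    assume e: "e \<in> edges cayley"
    then obtain g x where gx: "e = (g, x)" "g \<in> carrier G" "x \<in> letters" using arc by blast
    note lx = letter_closed[OF gx(3)]
    have lin: "linv x \<in> letters" using gx(3) by (rule iffD2[OF linv_in])
    show "tail (space cayley) e \<in> vertices cayley" "head (space cayley) e \<in> vertices cayley"
      using gx(1,2) lx by (simp_all add: cayley_sel)
    show "flip cayley (flip cayley e) = e"
      using cayley_sel(5)[OF gx(2,3)] cayley_sel(5)[OF m_closed[OF gx(2) lx] lin] cancel_letter[OF gx(2,3)] gx(1)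
      by simp
    show "tail (space cayley) (flip cayley e) = head (space cayley) e"
      using cayley_sel(5)[OF gx(2,3)] gx(1) by (simp add: cayley_sel)
    show "(head (space cayley) e, tail (space cayley) e) \<notin>
        (steps (space cayley) (edges cayley - {e, flip cayley e}))\<^sup>*"
      using cayley_separating[OF gx(2,3)] cayley_sel(5)[OF gx(2,3)] gx(1) by (simp add: cayley_sel)
  next
    show "vertices cayley \<noteq> {}" by (auto simp: cayley_sel)
    fix a b assume "a \<in> vertices cayley" "b \<in> vertices cayley"
    then have a: "a \<in> carrier G" and b: "b \<in> carrier G" by (simp_all add: cayley_sel)
    have "(a, a \<otimes> g) \<in> (steps (space cayley) (edges cayley))\<^sup>*" if "g \<in> carrier G" for g
    proof (rule word_induct[OF basis_generates that])
      fix h y assume h: "h \<in> carrier G" "(a, a \<otimes> h) \<in> (steps (space cayley) (edges cayley))\<^sup>*" and y: "y \<in> letters"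
      have "(tail (space cayley) (a \<otimes> h, y), head (space cayley) (a \<otimes> h, y)) \<in> steps (space cayley) (edges cayley)"
        by (rule stepsI) (use a h y in \<open>simp add: cayley_sel\<close>)
      then have "(a \<otimes> h, a \<otimes> (h \<otimes> letter_value G y)) \<in> steps (space cayley) (edges cayley)"
        using a h letter_closed[OF y] by (simp add: cayley_sel m_assoc)
      with h(2) show "(a, a \<otimes> (h \<otimes> letter_value G y)) \<in> (steps (space cayley) (edges cayley))\<^sup>*"
        by (rule rtrancl_into_rtrancl)
    qed (use a in simp)
    from this[of "inv a \<otimes> b"] show "(a, b) \<in> (steps (space cayley) (edges cayley))\<^sup>*"
      using a b by (simp add: m_assoc[symmetric])
  qed
  moreover have "group_action G (vertices cayley) (vact cayley)"
  proof (rule group_actionI[OF is_group])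
    show "vact cayley g \<in> extensional (vertices cayley)" for g by (simp add: cayley_def)
  qed (simp_all add: cayley_sel m_assoc)
  moreover have "group_action G (edges cayley) (eact cayley)"
  proof (rule group_actionI[OF is_group])
    show "eact cayley g \<in> extensional (edges cayley)" for g by (simp add: cayley_def)
    fix g e assume g: "g \<in> carrier G" and "e \<in> edges cayley"
    then obtain h x where gx: "e = (h, x)" "h \<in> carrier G" "x \<in> letters" using arc by blast
    show "eact cayley g e \<in> edges cayley" using g gx cayley_sel(2,7) by simp
    show "eact cayley (g \<otimes> k) e = eact cayley g (eact cayley k e)" if "k \<in> carrier G" for k
      using g gx(1) that cayley_sel(7)[OF gx(2,3)] cayley_sel(7)[OF m_closed[OF that gx(2)] gx(3)] gx(2)
      by (simp add: m_assoc)
  next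
    fix e assume "e \<in> edges cayley"
    then obtain h x where gx: "e = (h, x)" "h \<in> carrier G" "x \<in> letters" using arc by blast
    then show "eact cayley \<one> e = e" using cayley_sel(7)[OF gx(2,3)] by simp
  qed
  moreover have "tail (space cayley) (eact cayley g e) = vact cayley g (tail (space cayley) e) \<and>
        head (space cayley) (eact cayley g e) = vact cayley g (head (space cayley) e) \<and>
        eact cayley g (flip cayley e) = flip cayley (eact cayley g e) \<and>
        eact cayley g e \<noteq> flip cayley e" if g: "g \<in> carrier G" and e: "e \<in> edges cayley" for g e
  proof -
    obtain h x where hx: "e = (h, x)" "h \<in> carrier G" "x \<in> letters" using arc[OF e] by blast
    note lx = letter_closed[OF hx(3)]
    have lin: "linv x \<in> letters" using hx(3) by (rule iffD2[OF linv_in])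
    show ?thesis
      unfolding hx(1) cayley_sel(5)[OF hx(2,3)] cayley_sel(7)[OF hx(2,3)]
        cayley_sel(7)[OF m_closed[OF hx(2) lx] lin] cayley_sel(5)[OF m_closed[OF g hx(2)] hx(3)] cayley_sel(3,4)
      using cayley_sel(6)[OF hx(2)] cayley_sel(6)[OF m_closed[OF hx(2) lx]] g hx(2) lx by (simp add: m_assoc)
  qed
  ultimately show ?thesis unfolding splitting_def is_tree_iff using is_group by blast
qed

text \<open>Put \<open>k = [G : L]\<close>. The free action of \<open>L\<close> on the Cayley tree
  has \<open>k\<close> orbits of vertices and \<open>2 * k * card S\<close> orbits of arcs, so the
  rose has at least \<open>k * (card S - 1) + 1\<close> petals, and
  \<open>card S \<ge> 2\<close>.\<close>

lemma C_max_fin_subgroup: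
  assumes S: "finite S" "a \<in> S" "b \<in> S" "a \<noteq> b" and L: "subgroup L G" "finite (rcosets L)"
  shows "of_nat (card (rcosets L)) \<le> C_max_fin (G\<lparr>carrier := L\<rparr>)"
proof -
  interpret C: tree_action G cayley by unfold_locales (rule cayley_splitting)
  interpret L: group "G\<lparr>carrier := L\<rparr>" using subgroup_imp_group[OF L(1)] .
  interpret T: tree_action "G\<lparr>carrier := L\<rparr>" cayley
    by unfold_locales (rule C.subgroup_splitting[OF L(1)])
  have LG: "L \<subseteq> carrier G" using subgroup.subset[OF L(1)] .
  have free: "vertex_group (G\<lparr>carrier := L\<rparr>) cayley x = {\<one>\<^bsub>G\<lparr>carrier := L\<rparr>\<^esub>}" if "x \<in> vertices cayley" for x
    using that LG subgroup.one_closed[OF L(1)] by (auto simp: stabilizer_def cayley_sel subset_iff)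
  have orbV: "orbit (G\<lparr>carrier := L\<rparr>) (vact cayley) x = L #> x" if "x \<in> carrier G" for x
    using that by (auto simp: orbit_def r_coset_def cayley_sel)
  have "vertices cayley // T.orbit_rel {} = (\<lambda>x. L #> x) ` carrier G"
    using T.quotient_orbit_rel_empty image_cong[OF refl orbV, of "carrier G"]
    by (simp add: orbits_eq_image cayley_sel)
  then have VQ: "vertices cayley // T.orbit_rel {} = rcosets L" by (auto simp: RCOSETS_def)
  have orbE: "orbit (G\<lparr>carrier := L\<rparr>) (eact cayley) (h, x) = (L #> h) \<times> {x}"
    if "h \<in> carrier G" "x \<in> letters" for h x
    unfolding orbit_eq_image using cayley_sel(7)[OF that] by (auto simp: r_coset_def)
  have EQ: "orbit (G\<lparr>carrier := L\<rparr>) (eact cayley) ` edges cayley = (\<lambda>(C, x). C \<times> {x}) ` ((rcosets L) \<times> letters)"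
  proof (intro equalityI subsetI)
    fix O' assume "O' \<in> orbit (G\<lparr>carrier := L\<rparr>) (eact cayley) ` edges cayley"
    then obtain h x where hx: "h \<in> carrier G" "x \<in> letters" "O' = (L #> h) \<times> {x}"
      using orbE by (auto simp: cayley_sel simp del: mem_Sigma_iff) blast?
    then show "O' \<in> (\<lambda>(C, x). C \<times> {x}) ` ((rcosets L) \<times> letters)"
      by (intro image_eqI[of _ _ "(L #> h, x)"]) (auto simp: RCOSETS_def)
  next
    fix O' assume "O' \<in> (\<lambda>(C, x). C \<times> {x}) ` ((rcosets L) \<times> letters)"
    then obtain h x where hx: "h \<in> carrier G" "x \<in> letters" "O' = (L #> h) \<times> {x}"
      by (auto simp: RCOSETS_def)
    then show "O' \<in> orbit (G\<lparr>carrier := L\<rparr>) (eact cayley) ` edges cayley"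
      using orbE[OF hx(1,2)] by (intro image_eqI[of _ _ "(h, x)"]) (simp_all add: cayley_sel)
  qed
  have inj: "inj_on (\<lambda>(C, x). C \<times> {x}) ((rcosets L) \<times> letters)"
  proof (rule inj_onI)
    fix z z' assume z: "z \<in> (rcosets L) \<times> letters"
      and eq: "(\<lambda>(C, x). C \<times> {x}) z = (\<lambda>(C, x). C \<times> {x}) z'"
    obtain C x C' x' where zz: "z = (C, x)" "z' = (C', x')" by (cases z; cases z')
    have "C \<in> rcosets L" using z zz by simp
    then have "C \<noteq> {}" using subgroup.rcosets_non_empty[OF L(1)] by blast
    moreover have "C \<times> {x} = C' \<times> {x'}" using eq zz by simp
    ultimately show "z = z'" unfolding zz times_eq_iff by blast
  qed
  have cardE: "card (orbit (G\<lparr>carrier := L\<rparr>) (eact cayley) ` edges cayley) = card (rcosets L) * (card S * 2)"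
    unfolding EQ card_image[OF inj] card_cartesian_product by simp
  have "card {a, b} \<le> card S" by (rule card_mono[OF S(1)]) (use S(2,3) in simp)
  then have "2 * 2 \<le> card S * 2" using S(4) by simp
  then have "card (rcosets L) * (2 * 2) \<le> card (rcosets L) * (card S * 2)" by (rule mult_le_mono2)
  then have m: "2 * card (rcosets L) + 2 * card (vertices cayley // T.orbit_rel {}) \<le>
      card (orbit (G\<lparr>carrier := L\<rparr>) (eact cayley) ` edges cayley) + 2"
    unfolding VQ cardE by linarith
  \<comment> \<open>A non-trivial element of \<open>L\<close> is needed to exclude the purely
    elliptic case.\<close>
  obtain n :: nat where n: "n > 0" "a [^] n \<in> L" using pow_in_finite_index[OF L, of a] S(2) by auto
  have "a [^] n \<noteq> \<one>" using basis_pow_inj[OF S(2), of n 0] n(1) by simp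
  show ?thesis
  proof (rule T.C_max_fin_free_action[OF free _ _ _ _ _ _ m])
    have c: "countable (carrier G)" using countable_carrier[OF S(1) basis_generates] .
    then show "countable (vertices cayley)" by (simp add: cayley_sel)
    show "countable (edges cayley)" unfolding cayley_sel using c S(1) by (intro countable_SIGMA) (auto intro: countable_finite)
    show "finite (vertices cayley // T.orbit_rel {})" using VQ L(2) by simp
    show "a [^] n \<in> carrier (G\<lparr>carrier := L\<rparr>)" "a [^] n \<noteq> \<one>\<^bsub>G\<lparr>carrier := L\<rparr>\<^esub>" using n \<open>a [^] n \<noteq> \<one>\<close> by simp_all
    show "finite (orbit (G\<lparr>carrier := L\<rparr>) (eact cayley) ` edges cayley)" unfolding EQ using L(2) S(1) by simp
  qed
qed

text \<open>For \<open>N\<close> in \<open>K\<close> the bound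
  \<open>[G : N] = [G : K] [K : N]\<close> is divided by \<open>[K : N]\<close>, which leaves the
  constant \<open>[G : K]\<close> for every \<open>N\<close>.\<close>

lemma V_fin_subgroup:
  assumes S: "finite S" "a \<in> S" "b \<in> S" "a \<noteq> b" and K: "subgroup K G" "finite (rcosets K)"
  shows "of_nat (card (rcosets K)) \<le> V_fin (G\<lparr>carrier := K\<rparr>)"
proof -
  interpret K: group "G\<lparr>carrier := K\<rparr>" using subgroup_imp_group[OF K(1)] .
  obtain A where A: "finite A" "generates (G\<lparr>carrier := K\<rparr>) A"
    using finite_index_fg[OF K S(1) basis_generates] .
  show ?thesis
    unfolding V_fin_def
  proof (rule K.normal_limsup_lower_bound[OF A])
    fix N assume "N \<in> fin_index_normal (G\<lparr>carrier := K\<rparr>)"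
    note N = K.fin_index_normalD[OF this]
    let ?i = "index (G\<lparr>carrier := K\<rparr>) N"
    note tower = index_tower[OF K N(2,3)]
    have "subgroup N G" using incl_subgroup[OF K(1) N(2)] .
    from C_max_fin_subgroup[OF S this tower(1)]
    have "of_nat (card (rcosets K)) * of_nat ?i \<le> C_max_fin (G\<lparr>carrier := N\<rparr>)"
      unfolding tower(2) by (simp add: index_def)
    then have "of_nat (card (rcosets K)) * of_nat ?i / of_nat ?i \<le> C_max_fin (G\<lparr>carrier := N\<rparr>) / of_nat ?i"
      by (rule divide_right_mono_ennreal)
    moreover have "of_nat (card (rcosets K)) * of_nat ?i / of_nat ?i = (of_nat (card (rcosets K)) :: ennreal)"
      using N(4) by (intro ennreal_mult_divide_eq) simp_all
    ultimately show "of_nat (card (rcosets K)) \<le> C_max_fin (G\<lparr>carrier := K, carrier := N\<rparr>) / of_nat ?i"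
      by simp
  qed
qed

end

section \<open>Cyclic splittings\<close>

context group
begin

text \<open>Division with remainder by the least positive exponent \<open>d\<close> that lands in
  \<open>K\<close> shows that \<open>z [^] d\<close> generates. If \<open>K\<close> were finite,
  \<open>G\<close> would be a finite union of finite cosets.\<close>

lemma infinite_cyclic_finite_index:
  assumes G: "infinite_cyclic G" and K: "subgroup K G" "finite (rcosets K)"
  shows "infinite_cyclic (G\<lparr>carrier := K\<rparr>)"
proof -
  interpret K: group "G\<lparr>carrier := K\<rparr>" using subgroup_imp_group[OF K(1)] .
  obtain z where z: "z \<in> carrier G" "carrier G = range (\<lambda>n::int. z [^] n)"
    using G cyclic_group by (auto simp: infinite_cyclic_def)
  have KG: "K \<subseteq> carrier G" using subgroup.subset[OF K(1)] .
  have "\<exists>d::nat. d > 0 \<and> z [^] d \<in> K" using pow_in_finite_index[OF K z(1)] by metis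
  define d where "d = (LEAST d::nat. d > 0 \<and> z [^] d \<in> K)"
  have d: "d > 0" "z [^] d \<in> K" and least: "\<And>r. r > 0 \<Longrightarrow> z [^] r \<in> K \<Longrightarrow> d \<le> r"
    using LeastI_ex[OF \<open>\<exists>d::nat. d > 0 \<and> z [^] d \<in> K\<close>] Least_le[of "\<lambda>d::nat. d > 0 \<and> z [^] d \<in> K"]
    unfolding d_def by blast+
  let ?y = "z [^] d"
  have y: "?y = z [^] int d" by (simp add: int_pow_int)
  have yK: "?y [^]\<^bsub>G\<lparr>carrier := K\<rparr>\<^esub> (i::int) = z [^] (int d * i)" for i
    using int_pow_consistent[OF K(1) d(2), of i] int_pow_pow[OF z(1), of "int d" i] unfolding y by simp
  have "K = range (\<lambda>n::int. ?y [^]\<^bsub>G\<lparr>carrier := K\<rparr>\<^esub> n)"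
  proof (intro equalityI subsetI)
    fix k assume k: "k \<in> K"
    then obtain i :: int where i: "k = z [^] i" using KG z(2) by blast
    define r where "r = nat (i mod int d)"
    have r: "int r = i mod int d" "r < d" using d(1) by (simp_all add: r_def nat_less_iff)
    have q: "z [^] (int d * (i div int d)) \<in> K" using K.int_pow_closed[of ?y "i div int d"] d(2) yK by simp
    have "z [^] i = z [^] (int d * (i div int d)) \<otimes> z [^] int r"
      unfolding r(1) using int_pow_mult[OF z(1), of "int d * (i div int d)" "i mod int d"] by simp
    then have "inv (z [^] (int d * (i div int d))) \<otimes> k = z [^] r"
      using i z(1) by (simp add: int_pow_int m_assoc[symmetric])
    then have "z [^] r \<in> K"
      using subgroup.m_closed[OF K(1) subgroup.m_inv_closed[OF K(1) q] k] by simp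
    then have "r = 0" using least[of r] r(2) by force
    then have "i = int d * (i div int d)" using r(1) by (metis add.right_neutral mult_div_mod_eq of_nat_0)
    then have "k = ?y [^]\<^bsub>G\<lparr>carrier := K\<rparr>\<^esub> (i div int d)" using i yK[of "i div int d"] by simp
    then show "k \<in> range (\<lambda>n::int. ?y [^]\<^bsub>G\<lparr>carrier := K\<rparr>\<^esub> n)" by (rule range_eqI)
  next
    fix k assume "k \<in> range (\<lambda>n::int. ?y [^]\<^bsub>G\<lparr>carrier := K\<rparr>\<^esub> n)"
    then obtain i :: int where "k = ?y [^]\<^bsub>G\<lparr>carrier := K\<rparr>\<^esub> i" by blast
    then show "k \<in> K" using K.int_pow_closed[of ?y i] d(2) by simp
  qed
  then have cyc: "cyclic_group (G\<lparr>carrier := K\<rparr>)"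
    using K.cyclic_group d(2) by auto
  have "infinite K"
  proof
    assume "finite K"
    then have "finite C" if "C \<in> rcosets K" for C
      using that by (auto simp: RCOSETS_def r_coset_def)
    then have "finite (\<Union>(rcosets K))" using K(2) by blast
    then show False using rcosets_part_G[OF K(1)] G by (simp add: infinite_cyclic_def)
  qed
  then show ?thesis using cyc K.is_group by (simp add: infinite_cyclic_def)
qed

lemma cyclic_fg:
  assumes "cyclic_group G"
  shows "\<exists>Z. finite Z \<and> generates G Z"
proof -
  obtain z where z: "z \<in> carrier G" "carrier G = range (\<lambda>n::int. z [^] n)"
    using assms cyclic_group by auto
  have "generate G {z} = carrier G" using generate_pow[OF z(1)] z(2) by auto
  then show ?thesis using z(1) by (intro exI[of _ "{z}"]) (simp add: generates_def)
qed

lemma inter_finite_index: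
  assumes N: "N \<in> fin_index_normal G" and K: "subgroup K G"
  shows "subgroup (N \<inter> K) (G\<lparr>carrier := K\<rparr>)" "finite (rcosets\<^bsub>G\<lparr>carrier := K\<rparr>\<^esub> (N \<inter> K))"
proof -
  note NN = fin_index_normalD[OF N]
  interpret K: group "G\<lparr>carrier := K\<rparr>" using subgroup_imp_group[OF K] .
  have KG: "K \<subseteq> carrier G" using subgroup.subset[OF K] .
  show sub: "subgroup (N \<inter> K) (G\<lparr>carrier := K\<rparr>)"
    by (rule subgroup_incl[OF subgroups_Inter_pair[OF NN(2) K] K]) simp
  show "finite (rcosets\<^bsub>G\<lparr>carrier := K\<rparr>\<^esub> (N \<inter> K))"
  proof (rule K.rcosets_bound(1)[OF sub, where f = "\<lambda>k. N #> k"])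
    have "(\<lambda>k. N #> k) ` carrier (G\<lparr>carrier := K\<rparr>) \<subseteq> rcosets N" using KG by (auto simp: RCOSETS_def)
    then show "finite ((\<lambda>k. N #> k) ` carrier (G\<lparr>carrier := K\<rparr>))" using NN(3) finite_subset by blast
    fix g h assume gh: "g \<in> carrier (G\<lparr>carrier := K\<rparr>)" "h \<in> carrier (G\<lparr>carrier := K\<rparr>)" "N #> g = N #> h"
    then have gK: "g \<in> K" "h \<in> K" by simp_all
    then have "g \<otimes> inv h \<in> N" using coset_eq_iff[OF NN(2)] gh(3) KG by blast
    moreover have "g \<otimes> inv h \<in> K"
      using gK subgroup.m_closed[OF K] subgroup.m_inv_closed[OF K] by blast
    ultimately show "g \<otimes>\<^bsub>G\<lparr>carrier := K\<rparr>\<^esub> inv\<^bsub>G\<lparr>carrier := K\<rparr>\<^esub> h \<in> N \<inter> K"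
      using m_inv_consistent[OF K gK(2)] by simp
  qed
qed

end

text \<open>Serves to carry a free basis along conjugation from \<open>G_v\<close> to the
  stabilizers of the other vertices in its orbit.\<close>

lemma presented_by_iso:
  assumes "group G" "group H" and h: "h \<in> iso G H" and pres: "presented_by G S {}"
  shows "presented_by H (h ` S) {}"
proof -
  interpret group_hom G H h
    using assms by (intro group_hom.intro group_hom_axioms.intro) (auto simp: iso_def)
  have bij: "bij_betw h (carrier G) (carrier H)" using h by (simp add: iso_def)
  have S: "S \<subseteq> carrier G" and gen: "generate G S = carrier G"
    using pres by (auto simp: presented_by_def generates_def)
  let ?f = "map_prod h (id :: bool \<Rightarrow> bool)"
  have lv: "letter_value H (?f x) = h (letter_value G x)" if "x \<in> S \<times> UNIV" for x
    using that S by (cases x) (auto simp: letter_value_def)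
  have wv: "word_value H (map ?f w) = h (word_value G w)" if "w \<in> lists (S \<times> UNIV)" for w
    using that
  proof (induction w rule: list.induct)
    case (Cons x w)
    then have x: "x \<in> S \<times> UNIV" and w: "w \<in> lists (S \<times> UNIV)" by auto
    have "word_value H (map ?f (x # w)) = h (letter_value G x) \<otimes>\<^bsub>H\<^esub> h (word_value G w)"
      using Cons.IH[OF w] lv[OF x] by (simp only: list.map word_value_Cons)
    also have "\<dots> = h (word_value G (x # w))"
      using hom_mult[OF G.letter_value_closed[OF S x] G.word_value_closed[OF S w]] by (simp only: word_value_Cons)
    finally show ?case .
  qed simp
  have gen': "generates H (h ` S)"
    unfolding generates_def using generate_img[OF S] gen bij image_mono[OF S, of h]
    by (simp add: bij_betw_def)
  have "word_eq (h ` S \<times> UNIV) linv {} w []"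
    if w: "w \<in> lists (h ` S \<times> UNIV)" and one: "word_value H w = \<one>\<^bsub>H\<^esub>" for w
  proof -
    have "h ` S \<times> UNIV = ?f ` (S \<times> UNIV)" by (auto simp: image_iff)
    then have "w \<in> map ?f ` lists (S \<times> UNIV)" using w lists_image[of ?f "S \<times> UNIV"] by simp
    then obtain u where u: "u \<in> lists (S \<times> UNIV)" "w = map ?f u" by blast
    have "h (word_value G u) = h \<one>\<^bsub>G\<^esub>" using wv[OF u(1)] one u(2) by simp
    then have "word_value G u = \<one>\<^bsub>G\<^esub>"
      by (rule inj_onD[OF bij_betw_imp_inj_on[OF bij] _ G.word_value_closed[OF S u(1)] G.one_closed])
    then have "equivclp (word_step (S \<times> UNIV) linv {}) u []"
      using pres u(1) unfolding presented_by_def word_eq_def by (simp del: in_lists_conv_set)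
    moreover have "equivclp (word_step (h ` S \<times> UNIV) linv {}) (map ?f u) (map ?f z)"
      if "equivclp (word_step (S \<times> UNIV) linv {}) u z" for z
      using that
    proof (induction rule: equivclp_induct)
      case (step y z)
      have st: "word_step (h ` S \<times> UNIV) linv {} (map ?f p) (map ?f q)"
        if "word_step (S \<times> UNIV) linv {} p q" for p q
        using that
      proof cases
        case (cancel x a b)
        have "?f (linv x) = linv (?f x)" by (cases x) simp
        moreover have "?f x \<in> h ` S \<times> UNIV" using cancel(3) by (cases x) auto
        ultimately show ?thesis
          using word_step.cancel[of "?f x" "h ` S \<times> UNIV" linv "{}" "map ?f a" "map ?f b"] cancel(1,2) by simp
      qed simp
      from step(2) have "word_step (h ` S \<times> UNIV) linv {} (map ?f y) (map ?f z) \<or>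
          word_step (h ` S \<times> UNIV) linv {} (map ?f z) (map ?f y)" using st by blast
      with step.IH show ?case by (rule equivclp_into_equivclp)
    qed simp
    ultimately have "equivclp (word_step (h ` S \<times> UNIV) linv {}) (map ?f u) (map ?f [])" by blast
    then show ?thesis unfolding word_eq_def u(2) by simp
  qed
  then show ?thesis unfolding presented_by_def using gen' by simp
qed

context tree_action
begin

lemma conj_iso:
  assumes g: "g \<in> carrier G" and v: "v \<in> V"
  shows "(\<lambda>h. g \<otimes> h \<otimes> inv g) \<in>
    iso (G\<lparr>carrier := vertex_group G X v\<rparr>) (G\<lparr>carrier := vertex_group G X (va g v)\<rparr>)"
proof -
  let ?s = "\<lambda>h. g \<otimes> h \<otimes> inv g"
  have st: "h \<in> vertex_group G X x \<longleftrightarrow> h \<in> carrier G \<and> va h x = x" for h x by (simp add: stabilizer_def)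
  have s: "?s h \<in> vertex_group G X (va g v)" if "h \<in> vertex_group G X v" for h
    using that g v unfolding st by (simp add: va_mult)
  have "?s (h \<otimes> k) = ?s h \<otimes> ?s k" if "h \<in> carrier G" "k \<in> carrier G" for h k
  proof -
    have "?s h \<otimes> ?s k = g \<otimes> (h \<otimes> ((inv g \<otimes> g) \<otimes> (k \<otimes> inv g)))"
      using that g by (simp only: m_assoc m_closed inv_closed)
    then show ?thesis using that g by (simp add: m_assoc)
  qed
  then have hom: "?s \<in> hom (G\<lparr>carrier := vertex_group G X v\<rparr>) (G\<lparr>carrier := vertex_group G X (va g v)\<rparr>)"
    using s by (intro homI) (simp_all add: st)
  have bwd: "inv g \<otimes> k \<otimes> g \<in> vertex_group G X v" if "k \<in> vertex_group G X (va g v)" for k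
  proof -
    have k: "k \<in> carrier G" "va k (va g v) = va g v" using vertex_groupD[OF that] by blast+
    have "va (inv g \<otimes> k \<otimes> g) v = va (inv g) (va k (va g v))" using g k(1) v by (simp add: va_mult)
    also have "\<dots> = v" unfolding k(2) by (rule va_inv(1)[OF g v])
    finally show ?thesis unfolding st using k(1) g by simp
  qed
  have c1: "inv g \<otimes> ?s h \<otimes> g = h" if "h \<in> carrier G" for h
  proof -
    have "inv g \<otimes> ?s h \<otimes> g = (inv g \<otimes> g) \<otimes> (h \<otimes> (inv g \<otimes> g))"
      using that g by (simp only: m_assoc m_closed inv_closed)
    then show ?thesis using that g by simp
  qed
  have c2: "?s (inv g \<otimes> k \<otimes> g) = k" if "k \<in> carrier G" for k
  proof -
    have "?s (inv g \<otimes> k \<otimes> g) = (g \<otimes> inv g) \<otimes> (k \<otimes> (g \<otimes> inv g))"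
      using that g by (simp only: m_assoc m_closed inv_closed)
    then show ?thesis using that g by simp
  qed
  have "bij_betw ?s (vertex_group G X v) (vertex_group G X (va g v))"
    by (rule bij_betwI[of _ _ _ "\<lambda>k. inv g \<otimes> k \<otimes> g"])
      (use s bwd c1 c2 vertex_groupD in \<open>blast+\<close>)
  then show ?thesis using hom by (simp add: iso_def)
qed

section \<open>Weights and orbits for a normal subgroup of finite index\<close>

definition local_index :: "'a set \<Rightarrow> 'v \<Rightarrow> nat" where
  "local_index N w = card (rcosets\<^bsub>G\<lparr>carrier := vertex_group G X w\<rparr>\<^esub> (N \<inter> vertex_group G X w))"

text \<open>Being non-abelian is encoded by two distinct basis elements, the form used in the rank
  estimate and preserved by conjugation.\<close>

definition free_vertex :: "'v \<Rightarrow> bool" where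
  "free_vertex w \<longleftrightarrow> w \<in> V \<and> (\<exists>S a b. finite S \<and> a \<in> S \<and> b \<in> S \<and> a \<noteq> b \<and>
     presented_by (G\<lparr>carrier := vertex_group G X w\<rparr>) S {})"

lemma free_vertex_va:
  assumes "free_vertex v" "g \<in> carrier G"
  shows "free_vertex (va g v)"
proof -
  obtain S a b where S: "v \<in> V" "finite S" "a \<in> S" "b \<in> S" "a \<noteq> b"
    "presented_by (G\<lparr>carrier := vertex_group G X v\<rparr>) S {}"
    using assms(1) unfolding free_vertex_def by blast
  let ?s = "\<lambda>h. g \<otimes> h \<otimes> inv g"
  have gr: "group (G\<lparr>carrier := vertex_group G X w\<rparr>)" if "w \<in> V" for w
    using subgroup_imp_group[OF vertex_group_subgroup[OF that]] .
  note iso = conj_iso[OF assms(2) S(1)]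
  have "presented_by (G\<lparr>carrier := vertex_group G X (va g v)\<rparr>) (?s ` S) {}"
    by (rule presented_by_iso[OF gr gr iso S(6)]) (use S(1) assms(2) in simp_all)
  moreover have "S \<subseteq> vertex_group G X v" using S(6) by (simp add: presented_by_def generates_def)
  then have "?s a \<noteq> ?s b"
    using iso S(3-5) by (auto simp: iso_def bij_betw_def inj_on_def)
  ultimately show ?thesis
    unfolding free_vertex_def using S(1) assms(2) finite_imageI[OF S(2), of ?s] imageI[OF S(3), of ?s]
      imageI[OF S(4), of ?s] by (intro conjI va_closed exI)
qed

text \<open>Finite presentability makes the weight equal to \<open>V_fin\<close>, which the Cayley
  tree bounds by the index. The second part will show that \<open>N \<inter> G_w\<close> fits into
  no cyclic edge group.\<close>

lemma free_vertex_weight: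
  assumes N: "N \<in> fin_index_normal G" and w: "free_vertex w"
  shows "of_nat (local_index N w) \<le> hyp_weight G (N \<inter> vertex_group G X w)"
    and "\<exists>x \<in> N \<inter> vertex_group G X w. \<exists>y \<in> N \<inter> vertex_group G X w. x \<otimes> y \<noteq> y \<otimes> x"
proof -
  let ?Gw = "vertex_group G X w"
  obtain S a b where S: "w \<in> V" "finite S" "a \<in> S" "b \<in> S" "a \<noteq> b"
    "presented_by (G\<lparr>carrier := ?Gw\<rparr>) S {}"
    using w unfolding free_vertex_def by blast
  note sub = vertex_group_subgroup[OF S(1)]
  interpret F: free_basis "G\<lparr>carrier := ?Gw\<rparr>" S
    by (intro free_basis.intro free_basis_axioms.intro subgroup_imp_group[OF sub] S(6))
  note K = inter_finite_index[OF N sub]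
  have fp: "finitely_presented (G\<lparr>carrier := N \<inter> ?Gw\<rparr>)"
    using F.finite_index_finitely_presented[OF K S(2) _ S(6)] by simp
  have "of_nat (local_index N w) \<le> V_fin (G\<lparr>carrier := N \<inter> ?Gw\<rparr>)"
    using F.V_fin_subgroup[OF S(2-5) K] by (simp add: local_index_def)
  then show "of_nat (local_index N w) \<le> hyp_weight G (N \<inter> ?Gw)"
    using fp by (simp add: hyp_weight_def)
  have ab: "a \<in> ?Gw" "b \<in> ?Gw" using F.basis_closed S(3,4) by simp_all
  obtain m :: nat where m: "m > 0" "a [^]\<^bsub>G\<lparr>carrier := ?Gw\<rparr>\<^esub> m \<in> N \<inter> ?Gw"
    using F.pow_in_finite_index[OF K, of a] ab by auto
  obtain n :: nat where n: "n > 0" "b [^]\<^bsub>G\<lparr>carrier := ?Gw\<rparr>\<^esub> n \<in> N \<inter> ?Gw"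
    using F.pow_in_finite_index[OF K, of b] ab by auto
  interpret NK: group "G\<lparr>carrier := ?Gw, carrier := N \<inter> ?Gw\<rparr>" using F.subgroup_imp_group[OF K(1)] .
  let ?p = "\<lambda>x i. x [^]\<^bsub>G\<lparr>carrier := ?Gw\<rparr>\<^esub> (i::nat)"
  have pow: "?p x k \<in> N \<inter> ?Gw" if "x \<in> N \<inter> ?Gw" for x k
    using that
  proof (induction k)
    case 0
    then show ?case using subgroup.one_closed[OF K(1)] by simp
  next
    case (Suc k)
    then show ?case using subgroup.m_closed[OF K(1), of "?p x k" x] by simp
  qed
  \<comment> \<open>A common exponent is taken so that both powers lie in \<open>N\<close> and
    \<open>basis_pow_noncommute\<close> applies.\<close>
  have "?p a (m * n) \<in> N \<inter> ?Gw" using pow[OF m(2), of n] F.nat_pow_pow[of a m n] ab by simp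
  moreover have "?p b (m * n) \<in> N \<inter> ?Gw"
    using pow[OF n(2), of m] F.nat_pow_pow[of b n m] ab by (simp add: mult.commute)
  moreover have "?p a (m * n) \<otimes> ?p b (m * n) \<noteq> ?p b (m * n) \<otimes> ?p a (m * n)"
    using F.basis_pow_noncommute[OF S(3-5), of "m * n"] m(1) n(1) by simp
  ultimately show "\<exists>x \<in> N \<inter> ?Gw. \<exists>y \<in> N \<inter> ?Gw. x \<otimes> y \<noteq> y \<otimes> x" by blast
qed

text \<open>Conjugation by \<open>g\<close> maps \<open>G_v\<close> to the stabilizer of
  \<open>g v\<close> and preserves the normal subgroup \<open>N\<close>, so it is injective on
  cosets of the intersections.\<close>

lemma local_index_va:
  assumes N: "N \<in> fin_index_normal G" and v: "v \<in> V" and g: "g \<in> carrier G"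
  shows "local_index N v \<le> local_index N (va g v)"
proof -
  let ?Gv = "vertex_group G X v" and ?Gw = "vertex_group G X (va g v)"
  let ?s = "\<lambda>h. g \<otimes> h \<otimes> inv g"
  have w: "va g v \<in> V" using v g by simp
  note sv = vertex_group_subgroup[OF v] and sw = vertex_group_subgroup[OF w]
  interpret Gv: group "G\<lparr>carrier := ?Gv\<rparr>" using subgroup_imp_group[OF sv] .
  interpret Gw: group "G\<lparr>carrier := ?Gw\<rparr>" using subgroup_imp_group[OF sw] .
  note Kv = inter_finite_index[OF N sv] and Kw = inter_finite_index[OF N sw]
  have sG: "?s h \<in> ?Gw" if "h \<in> ?Gv" for h
    using conj_iso[OF g v] that by (auto simp: iso_def hom_def)
  define f where "f h = (N \<inter> ?Gw) #>\<^bsub>G\<lparr>carrier := ?Gw\<rparr>\<^esub> (?s h)" for h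
  have sub: "f ` carrier (G\<lparr>carrier := ?Gv\<rparr>) \<subseteq> rcosets\<^bsub>G\<lparr>carrier := ?Gw\<rparr>\<^esub> (N \<inter> ?Gw)"
    using sG by (auto simp: f_def RCOSETS_def)
  have fin: "finite (f ` carrier (G\<lparr>carrier := ?Gv\<rparr>))" using Kw(2) sub finite_subset by blast
  have "h \<otimes>\<^bsub>G\<lparr>carrier := ?Gv\<rparr>\<^esub> inv\<^bsub>G\<lparr>carrier := ?Gv\<rparr>\<^esub> k \<in> N \<inter> ?Gv"
    if h: "h \<in> carrier (G\<lparr>carrier := ?Gv\<rparr>)" and k: "k \<in> carrier (G\<lparr>carrier := ?Gv\<rparr>)" and eq: "f h = f k" for h k
  proof -
    have hk: "h \<in> ?Gv" "k \<in> ?Gv" using h k by simp_all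
    then have hkG: "h \<in> carrier G" "k \<in> carrier G" using subgroup.subset[OF sv] by blast+
    have "?s h \<otimes>\<^bsub>G\<lparr>carrier := ?Gw\<rparr>\<^esub> inv\<^bsub>G\<lparr>carrier := ?Gw\<rparr>\<^esub> (?s k) \<in> N \<inter> ?Gw"
      using Gw.coset_eq_iff[OF Kw(1), of "?s h" "?s k"] eq sG hk by (simp add: f_def)
    then have "?s h \<otimes> inv (?s k) \<in> N" using m_inv_consistent[OF sw sG[OF hk(2)]] by simp
    then have "inv g \<otimes> (?s h \<otimes> inv (?s k)) \<otimes> inv (inv g) \<in> N"
      using normal.inv_op_closed2[OF fin_index_normalD(1)[OF N], of "inv g"] g by simp
    moreover have "inv g \<otimes> (?s h \<otimes> inv (?s k)) \<otimes> inv (inv g) = h \<otimes> inv k"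
    proof -
      have "inv (?s k) = g \<otimes> (inv k \<otimes> inv g)" using g hkG by (simp add: inv_mult_group m_assoc)
      then have "inv g \<otimes> (?s h \<otimes> inv (?s k)) \<otimes> inv (inv g) =
          (inv g \<otimes> g) \<otimes> (h \<otimes> ((inv g \<otimes> g) \<otimes> (inv k \<otimes> (inv g \<otimes> g))))"
        using g hkG by (simp only: m_assoc m_closed inv_closed inv_inv)
      then show ?thesis using g hkG by simp
    qed
    ultimately have "h \<otimes> inv k \<in> N" by simp
    moreover have "h \<otimes> inv k \<in> ?Gv"
      using hk subgroup.m_closed[OF sv] subgroup.m_inv_closed[OF sv] by blast
    ultimately show ?thesis using m_inv_consistent[OF sv hk(2)] by simp
  qed
  then have "local_index N v \<le> card (f ` carrier (G\<lparr>carrier := ?Gv\<rparr>))"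
    unfolding local_index_def by (rule Gv.rcosets_bound(2)[OF Kv(1) fin])
  also have "\<dots> \<le> local_index N (va g v)"
    unfolding local_index_def by (rule card_mono[OF Kw(2) sub])
  finally show ?thesis .
qed

text \<open>Every \<open>g\<close> factors as \<open>n t h\<close> with \<open>n \<in> N\<close>,
  \<open>h \<in> G_v\<close> and \<open>t\<close> depending only on the \<open>N\<close>-orbit of
  \<open>g v\<close>. By normality the coset of \<open>g\<close> is determined by \<open>t\<close>
  and the coset of \<open>h\<close> modulo \<open>N \<inter> G_v\<close>.\<close>

lemma index_le_orbits:
  assumes N: "N \<in> fin_index_normal G" and v: "v \<in> V"
    and fin: "finite (orbit (G\<lparr>carrier := N\<rparr>) va ` orbit G va v)"
  shows "index G N \<le> card (orbit (G\<lparr>carrier := N\<rparr>) va ` orbit G va v) * local_index N v"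
proof -
  note NN = fin_index_normalD[OF N]
  have NG: "N \<subseteq> carrier G" using subgroup.subset[OF NN(2)] .
  let ?Gv = "vertex_group G X v"
  note sv = vertex_group_subgroup[OF v]
  interpret Gv: group "G\<lparr>carrier := ?Gv\<rparr>" using subgroup_imp_group[OF sv] .
  note Kv = inter_finite_index[OF N sv]
  have GvG: "?Gv \<subseteq> carrier G" using subgroup.subset[OF sv] .
  define Q where "Q g = orbit (G\<lparr>carrier := N\<rparr>) va (va g v)" for g
  define t where "t C = (SOME g. g \<in> carrier G \<and> C = Q g)" for C
  have t: "t (Q g) \<in> carrier G \<and> Q g = Q (t (Q g))" if "g \<in> carrier G" for g
    unfolding t_def by (rule someI[of _ g]) (use that in simp)
  have "\<exists>h n. n \<in> N \<and> h \<in> ?Gv \<and> g = n \<otimes> t (Q g) \<otimes> h" if g: "g \<in> carrier G" for g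
  proof -
    let ?t = "t (Q g)"
    have tG: "?t \<in> carrier G" "Q g = Q ?t" using t[OF g] by blast+
    have "va g v \<in> Q g"
      using subgroup.one_closed[OF NN(2)] g v unfolding Q_def orbit_def by (auto intro!: exI[of _ \<one>])
    then obtain n where n: "n \<in> N" "va g v = va n (va ?t v)"
      using tG(2) unfolding Q_def orbit_def by auto
    have nG: "n \<in> carrier G" using n NG by blast
    let ?h = "inv (n \<otimes> ?t) \<otimes> g"
    have "va ?h v = va (inv (n \<otimes> ?t)) (va (n \<otimes> ?t) v)"
      using n(2) nG tG(1) g v by (simp add: va_mult)
    then have "?h \<in> ?Gv" using nG tG(1) g v by (simp add: stabilizer_def)
    moreover have "g = n \<otimes> ?t \<otimes> ?h"
    proof -
      have "n \<otimes> ?t \<otimes> ?h = (n \<otimes> ?t) \<otimes> inv (n \<otimes> ?t) \<otimes> g"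
        by (rule m_assoc[symmetric]) (use nG tG g in simp_all)
      then show ?thesis using nG tG g by simp
    qed
    ultimately show ?thesis using n(1) by blast
  qed
  then obtain h n where hn: "\<And>g. g \<in> carrier G \<Longrightarrow> n g \<in> N \<and> h g \<in> ?Gv \<and> g = n g \<otimes> t (Q g) \<otimes> h g"
    by metis
  define f where "f g = (Q g, (N \<inter> ?Gv) #>\<^bsub>G\<lparr>carrier := ?Gv\<rparr>\<^esub> h g)" for g
  let ?B = "(orbit (G\<lparr>carrier := N\<rparr>) va ` orbit G va v) \<times> (rcosets\<^bsub>G\<lparr>carrier := ?Gv\<rparr>\<^esub> (N \<inter> ?Gv))"
  have sub: "f ` carrier G \<subseteq> ?B"
  proof (rule image_subsetI)
    fix g assume g: "g \<in> carrier G"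
    have "Q g \<in> orbit (G\<lparr>carrier := N\<rparr>) va ` orbit G va v"
      unfolding Q_def orbit_def[of G] using g by blast
    moreover have "(N \<inter> ?Gv) #>\<^bsub>G\<lparr>carrier := ?Gv\<rparr>\<^esub> h g \<in> rcosets\<^bsub>G\<lparr>carrier := ?Gv\<rparr>\<^esub> (N \<inter> ?Gv)"
      using hn[OF g] by (auto simp: RCOSETS_def)
    ultimately show "f g \<in> ?B" by (simp add: f_def)
  qed
  have finB: "finite ?B" using fin Kv(2) by simp
  have "g \<otimes> inv g' \<in> N" if g: "g \<in> carrier G" and g': "g' \<in> carrier G" and eq: "f g = f g'" for g g'
  proof -
    let ?t = "t (Q g)"
    have Q: "Q g = Q g'" and co: "(N \<inter> ?Gv) #>\<^bsub>G\<lparr>carrier := ?Gv\<rparr>\<^esub> h g = (N \<inter> ?Gv) #>\<^bsub>G\<lparr>carrier := ?Gv\<rparr>\<^esub> h g'"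
      using eq by (simp_all add: f_def)
    have tG: "?t \<in> carrier G" using t[OF g] by blast
    have 1: "n g \<in> N" "h g \<in> ?Gv" "g = n g \<otimes> ?t \<otimes> h g" using hn[OF g] by blast+
    have 2: "n g' \<in> N" "h g' \<in> ?Gv" "g' = n g' \<otimes> ?t \<otimes> h g'" using hn[OF g'] unfolding Q by blast+
    have cl: "n g \<in> carrier G" "n g' \<in> carrier G" "h g \<in> carrier G" "h g' \<in> carrier G"
      using 1 2 NG GvG by blast+
    have "h g \<otimes>\<^bsub>G\<lparr>carrier := ?Gv\<rparr>\<^esub> inv\<^bsub>G\<lparr>carrier := ?Gv\<rparr>\<^esub> h g' \<in> N \<inter> ?Gv"
      using Gv.coset_eq_iff[OF Kv(1), of "h g" "h g'"] co 1(2) 2(2) by simp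
    then have hh: "h g \<otimes> inv (h g') \<in> N" using m_inv_consistent[OF sv 2(2)] by simp
    \<comment> \<open>Here normality enters: the quotient of the two \<open>h\<close>-parts stays in
      \<open>N\<close> after conjugation by the common representative.\<close>
    have thht: "?t \<otimes> (h g \<otimes> inv (h g')) \<otimes> inv ?t \<in> N"
      using normal.inv_op_closed2[OF NN(1) tG hh] .
    have "g \<otimes> inv g' = (n g \<otimes> ?t \<otimes> h g) \<otimes> inv (n g' \<otimes> ?t \<otimes> h g')" using 1(3) 2(3) by simp
    also have "inv (n g' \<otimes> ?t \<otimes> h g') = inv (h g') \<otimes> (inv ?t \<otimes> inv (n g'))"
      using cl tG by (simp add: inv_mult_group)
    also have "(n g \<otimes> ?t \<otimes> h g) \<otimes> (inv (h g') \<otimes> (inv ?t \<otimes> inv (n g'))) =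
        n g \<otimes> (?t \<otimes> (h g \<otimes> inv (h g')) \<otimes> inv ?t) \<otimes> inv (n g')"
      using cl tG by (simp only: m_assoc m_closed inv_closed)
    also have "\<dots> \<in> N"
      by (rule subgroup.m_closed[OF NN(2) subgroup.m_closed[OF NN(2) 1(1) thht]
            subgroup.m_inv_closed[OF NN(2) 2(1)]])
    finally show ?thesis .
  qed
  then have "index G N \<le> card (f ` carrier G)"
    unfolding index_def by (rule rcosets_bound(2)[OF NN(2) finite_subset[OF sub finB]])
  also have "\<dots> \<le> card ?B" by (rule card_mono[OF finB sub])
  finally show ?thesis by (simp add: card_cartesian_product local_index_def)
qed

text \<open>Inside the orbit of a chosen point \<open>x\<close>, each \<open>N\<close>-orbit is the
  image of a coset of \<open>N\<close> under evaluation at \<open>x\<close>.\<close>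

lemma finite_orbits_subgroup:
  assumes N: "N \<in> fin_index_normal G" and fin: "finite (orbits G V va)"
  shows "finite (orbits (G\<lparr>carrier := N\<rparr>) V va)"
proof -
  note NN = fin_index_normalD[OF N]
  have NG: "N \<subseteq> carrier G" using subgroup.subset[OF NN(2)] .
  let ?o = "orbit (G\<lparr>carrier := N\<rparr>) va"
  have coset: "?o (va g x) = (\<lambda>k. va k x) ` (N #> g)" if "g \<in> carrier G" "x \<in> V" for g x
  proof -
    have "?o (va g x) = (\<lambda>n. va (n \<otimes> g) x) ` N"
      unfolding orbit_eq_image using that NG by (auto intro!: image_cong simp: va_mult subset_iff)
    also have "\<dots> = (\<lambda>k. va k x) ` (N #> g)" by (auto simp: r_coset_def)
    finally show ?thesis .
  qed
  define s where "s O' = (SOME x. x \<in> V \<and> O' = orbit G va x)" for O'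
  have "orbits (G\<lparr>carrier := N\<rparr>) V va \<subseteq> (\<lambda>(C, O'). (\<lambda>k. va k (s O')) ` C) ` ((rcosets N) \<times> orbits G V va)"
    unfolding orbits_eq_image[of "G\<lparr>carrier := N\<rparr>"]
  proof (rule image_subsetI)
    fix x assume x: "x \<in> V"
    let ?O = "orbit G va x"
    have s: "s ?O \<in> V \<and> ?O = orbit G va (s ?O)" unfolding s_def by (rule someI[of _ x]) (use x in simp)
    then have "x \<in> orbit G va (s ?O)" using vertex.orbit_refl[OF x] by simp
    then obtain g where g: "g \<in> carrier G" "x = va g (s ?O)" by (auto simp: orbit_def)
    have "?o (va g (s ?O)) = (\<lambda>k. va k (s ?O)) ` (N #> g)"
      by (rule coset[OF g(1) conjunct1[OF s]])
    then have "?o x = (\<lambda>k. va k (s ?O)) ` (N #> g)" unfolding g(2)[symmetric] .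
    moreover have "(N #> g, ?O) \<in> (rcosets N) \<times> orbits G V va"
      using g(1) x unfolding orbits_eq_image RCOSETS_def by blast
    ultimately show "?o x \<in> (\<lambda>(C, O'). (\<lambda>k. va k (s O')) ` C) ` ((rcosets N) \<times> orbits G V va)"
      by (intro image_eqI[of _ _ "(N #> g, ?O)"]) simp_all
  qed
  then show ?thesis by (rule finite_subset) (use NN(3) fin in simp)
qed

text \<open>The reduced collapse for \<open>N\<close> keeps the orbit of \<open>v\<close> with its
  stabilizers and its number of \<open>N\<close>-orbits. Each of these orbits weighs at least
  \<open>local_index N v\<close>, and the product of both numbers is at least the index of
  \<open>N\<close>.\<close>

lemma C_max_cyclic_lower_bound:
  assumes count: "countable V" "countable E" and fin: "finite (orbits G V va)"
    and cyc: "\<And>e. e \<in> E \<Longrightarrow> infinite_cyclic (G\<lparr>carrier := edge_group G X e\<rparr>)"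
    and v: "free_vertex v" and moved: "g0 \<in> carrier G" "va g0 v \<noteq> v"
    and N: "N \<in> fin_index_normal G"
  shows "of_nat (index G N) \<le> C_max_cyclic (hyp_weight G) (G\<lparr>carrier := N\<rparr>)"
proof -
  note NN = fin_index_normalD[OF N]
  let ?N = "G\<lparr>carrier := N\<rparr>"
  have NG: "N \<subseteq> carrier G" using subgroup.subset[OF NN(2)] .
  interpret N: group ?N using subgroup_imp_group[OF NN(2)] .
  interpret T: tree_action ?N X by unfold_locales (rule subgroup_splitting[OF NN(2)])
  have Nst: "stabilizer ?N \<phi> x = N \<inter> stabilizer G \<phi> x" for \<phi> :: "'a \<Rightarrow> 'c \<Rightarrow> 'c" and x
    by (rule stabilizer_subgroup_carrier[OF NG])
  have vV: "v \<in> V" using v by (simp add: free_vertex_def)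
  define W where "W = orbit G va v"
  have WV: "W \<subseteq> V" unfolding W_def orbit_def using vV by auto
  have Wfree: "free_vertex w" and Windex: "local_index N v \<le> local_index N w" if "w \<in> W" for w
    using that free_vertex_va[OF v] local_index_va[OF N vV] unfolding W_def orbit_def by auto
  have big: "\<not> N \<inter> vertex_group G X w \<subseteq> edge_group G X e" if w: "w \<in> W" and e: "e \<in> E" for w e
  proof
    assume sub: "N \<inter> vertex_group G X w \<subseteq> edge_group G X e"
    obtain x y where xy: "x \<in> edge_group G X e" "y \<in> edge_group G X e" "x \<otimes> y \<noteq> y \<otimes> x"
      using free_vertex_weight(2)[OF N Wfree[OF w]] sub by blast
    have "comm_group (G\<lparr>carrier := edge_group G X e\<rparr>)"
      using cyc[OF e] group.cyclic_imp_abelian_group by (auto simp: infinite_cyclic_def)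
    then show False using comm_groupE(4)[of "G\<lparr>carrier := edge_group G X e\<rparr>" x y] xy by simp
  qed
  have finN: "finite (orbits ?N V va)" by (rule finite_orbits_subgroup[OF N fin])
  obtain F where F: "T.good_forest F"
    and max: "\<forall>e\<in>E. (\<forall>g\<in>carrier ?N. (ini e, va g (ter e)) \<notin> (st F)\<^sup>*) \<longrightarrow>
      (\<exists>g\<in>carrier ?N. (va g (ini e), ini e) \<in> (st F)\<^sup>* \<and> ea g e \<noteq> e)"
    using T.maximal_good_forest T.quotient_orbit_rel_empty finN by metis
  have forest: "T.forest F" using F by (simp add: T.good_forest_def)
  obtain c :: "'v \<Rightarrow> nat" and d :: "'e \<Rightarrow> nat" where "tree_collapse ?N X F c d"
    using T.nat_collapse[OF count forest] .
  then interpret C: tree_collapse ?N X F c d .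
  have red: "reduced_splitting ?N C.Y" by (rule C.collapse_reduced[OF max])
  interpret Y: tree_action ?N C.Y by unfold_locales (rule C.collapse_splitting)
  \<comment> \<open>Elements of \<open>N\<close> fixing \<open>w\<close> preserve its component and
    hence fix the distinguished vertex \<open>u\<close> too. If \<open>u\<close> differed from
    \<open>w\<close> they would fix an edge, against \<open>big\<close>. So orbit points are their
    own distinguished vertices, which gives both unchanged stabilizers and injectivity of
    \<open>c\<close> on \<open>W\<close>.\<close>
  have special: "u = w"
    if w: "w \<in> W" and u: "u \<in> V" "(w, u) \<in> (st F)\<^sup>*"
      and su: "\<forall>g\<in>N. (va g u, u) \<in> (st F)\<^sup>* \<longrightarrow> va g u = u" for u w
  proof (rule ccontr)
    assume "u \<noteq> w"
    have wV: "w \<in> V" using w WV by blast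
    have "N \<inter> vertex_group G X w \<subseteq> edge_group G X (towards w u)"
    proof
      fix g assume g: "g \<in> N \<inter> vertex_group G X w"
      then have gg: "g \<in> N" "g \<in> carrier ?N" "va g w = w" "g \<in> vertex_group G X w" by (auto simp: stabilizer_def)
      have "(w, va g u) \<in> (st F)\<^sup>*" using T.forest_va[OF forest gg(2) u(2)] gg(3) by simp
      then have "(va g u, u) \<in> (st F)\<^sup>*"
        using rtrancl_trans[OF T.forest_sym[OF forest] u(2)] by blast
      then have "va g u = u" using su gg(1) by blast
      then have "g \<in> vertex_group G X u" using gg(1) NG by (auto simp: stabilizer_def)
      then show "g \<in> edge_group G X (towards w u)"
        by (rule vertex_group_inter_towards[OF wV u(1) \<open>u \<noteq> w\<close> gg(4)])
    qed
    then show False using big[OF w] towards(1)[OF wV u(1) \<open>u \<noteq> w\<close>] by blast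
  qed
  have spec_ex: "\<exists>u\<in>V. (x, u) \<in> (st F)\<^sup>* \<and> (\<forall>g\<in>N. (va g u, u) \<in> (st F)\<^sup>* \<longrightarrow> va g u = u)" if "x \<in> V" for x
    using F that unfolding T.good_forest_def by simp
  have fixW: "va g w = w" if w: "w \<in> W" and g: "g \<in> N" "(va g w, w) \<in> (st F)\<^sup>*" for w g
  proof -
    have "w \<in> V" using w WV by blast
    then obtain u where u: "u \<in> V" "(w, u) \<in> (st F)\<^sup>*" "\<forall>g\<in>N. (va g u, u) \<in> (st F)\<^sup>* \<longrightarrow> va g u = u"
      using spec_ex by blast
    then have "u = w" by (rule special[OF w])
    then show ?thesis using u(3) g by blast
  qed
  have cW: "inj_on c W"
  proof (rule inj_onI)
    fix w w' assume w: "w \<in> W" and w': "w' \<in> W" and "c w = c w'"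
    then have rel: "(w', w) \<in> (st F)\<^sup>*" using C.c[of w' w] WV by auto
    have "\<forall>g\<in>N. (va g w, w) \<in> (st F)\<^sup>* \<longrightarrow> va g w = w" using fixW[OF w] by blast
    moreover have "w \<in> V" using w WV by blast
    ultimately show "w = w'" using special[OF w' _ rel] by blast
  qed
  have vgY: "vertex_group ?N C.Y (c w) = N \<inter> vertex_group G X w" if w: "w \<in> W" for w
  proof -
    have "w \<in> V" using w WV by blast
    then show ?thesis
      unfolding C.vertex_group_Y[OF \<open>w \<in> V\<close>] using fixW[OF w] NG by (auto simp: stabilizer_def)
  qed
  have egY: "edge_group ?N C.Y (d e) = N \<inter> edge_group G X e" if "e \<in> E - F" for e
    using C.edge_group_Y[OF that] Nst by simp
  have cycY: "cyclic_splitting ?N C.Y"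
    unfolding cyclic_splitting_def
  proof (intro conjI ballI C.collapse_splitting)
    fix e' assume "e' \<in> edges C.Y"
    then obtain e where e: "e \<in> E - F" "e' = d e" unfolding C.edges_Y by blast
    have eE: "e \<in> E" using e by blast
    interpret Ge: group "G\<lparr>carrier := edge_group G X e\<rparr>"
      using subgroup_imp_group[OF edge_group_subgroup[OF eE]] .
    have "infinite_cyclic (G\<lparr>carrier := edge_group G X e, carrier := N \<inter> edge_group G X e\<rparr>)"
      by (rule Ge.infinite_cyclic_finite_index[OF cyc[OF eE] inter_finite_index[OF N edge_group_subgroup[OF eE]]])
    then show "infinite_cyclic (?N\<lparr>carrier := edge_group ?N C.Y e'\<rparr>)" using egY[OF e(1)] e(2) by simp
  qed
  let ?k = "local_index N v"
  have "of_nat (card (orbit ?N (vact C.Y) ` (c ` W))) * of_nat ?k \<le> complexity (hyp_weight G) ?N C.Y"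
  proof (rule Y.complexity_lower_bound[of "c ` W" "c v" "c (va g0 v)"])
    show "c ` W \<subseteq> vertices C.Y" unfolding C.verts_Y using WV by blast
    show "vact C.Y g z \<in> c ` W" if g: "g \<in> carrier ?N" and z: "z \<in> c ` W" for g z
    proof -
      obtain w where w: "w \<in> W" "z = c w" using z by blast
      obtain h where h: "h \<in> carrier G" "w = va h v" using w(1) unfolding W_def orbit_def by blast
      have gG: "g \<in> carrier G" using g NG by auto
      have "va g w = va (g \<otimes> h) v" using va_mult[OF gG h(1) vV] h(2) by simp
      then have "va g w \<in> W" unfolding W_def orbit_def using gG h(1) by blast
      moreover have "vact C.Y g z = c (va g w)" using C.vact_Y[OF g, of w] w WV by blast
      ultimately show ?thesis by blast
    qed
    show "\<not> vertex_group ?N C.Y z \<subseteq> edge_group ?N C.Y e'" if z: "z \<in> c ` W" and e': "e' \<in> edges C.Y" for z e'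
    proof -
      obtain w where w: "w \<in> W" "z = c w" using z by blast
      obtain e where e: "e \<in> E - F" "e' = d e" using e' unfolding C.edges_Y by blast
      show ?thesis using big[OF w(1), of e] vgY[OF w(1)] egY[OF e(1)] w(2) e by auto
    qed
    have vW: "v \<in> W" unfolding W_def by (rule vertex.orbit_refl[OF vV])
    have gW: "va g0 v \<in> W" unfolding W_def orbit_def using moved(1) by blast
    show "c v \<in> c ` W" "c (va g0 v) \<in> c ` W" using vW gW by blast+
    show "c v \<noteq> c (va g0 v)" using inj_onD[OF cW _ vW gW] moved(2) by metis
    show "of_nat ?k \<le> 1 + hyp_weight G (vertex_group ?N C.Y z)" if z: "z \<in> c ` W" for z
    proof -
      obtain w where w: "w \<in> W" "z = c w" using z by blast
      have "of_nat ?k \<le> (of_nat (local_index N w) :: ennreal)" using Windex[OF w(1)] by simp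
      also have "\<dots> \<le> hyp_weight G (vertex_group ?N C.Y z)"
        using free_vertex_weight(1)[OF N Wfree[OF w(1)]] vgY[OF w(1)] w(2) by simp
      also have "\<dots> \<le> 1 + \<dots>" by simp
      finally show ?thesis .
    qed
  qed
  also have "\<dots> \<le> C_max_cyclic (hyp_weight G) ?N"
    unfolding C_max_cyclic_def using red cycY by (intro SUP_upper) simp
  finally have le: "of_nat (card (orbit ?N (vact C.Y) ` (c ` W))) * of_nat ?k \<le> C_max_cyclic (hyp_weight G) ?N" .
  \<comment> \<open>As \<open>c\<close> is injective on \<open>W\<close>, the collapse identifies no
    two \<open>N\<close>-orbits in \<open>W\<close>.\<close>
  have "orbit ?N (vact C.Y) ` (c ` W) = (\<lambda>O'. c ` O') ` (orbit ?N va ` W)"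
    unfolding image_image using C.orbit_Y WV by (intro image_cong) auto
  moreover have "inj_on (\<lambda>O'. c ` O') (orbit ?N va ` W)"
  proof (rule inj_onI)
    fix A B assume A: "A \<in> orbit ?N va ` W" and B: "B \<in> orbit ?N va ` W" and eq: "c ` A = c ` B"
    have sub: "orbit ?N va w \<subseteq> W" if w: "w \<in> W" for w
    proof
      fix z assume "z \<in> orbit ?N va w"
      then obtain g where g: "g \<in> N" "z = va g w" by (auto simp: orbit_def)
      have "orbit G va w = W" using vertex.orbit_image[OF _ vV] w unfolding W_def orbit_def[of G va v] by auto
      then show "z \<in> W" using g NG by (auto simp: orbit_def)
    qed
    have "A \<subseteq> W" using A sub by (elim imageE) simp
    moreover have "B \<subseteq> W" using B sub by (elim imageE) simp
    ultimately show "A = B" using inj_on_image_eq_iff[OF cW] eq by blast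
  qed
  ultimately have "card (orbit ?N (vact C.Y) ` (c ` W)) = card (orbit ?N va ` W)" by (simp add: card_image)
  moreover have "index G N \<le> card (orbit ?N va ` W) * ?k"
    unfolding W_def
  proof (rule index_le_orbits[OF N vV])
    show "finite (orbit ?N va ` orbit G va v)"
      using finite_subset[OF image_mono[OF WV] finN[unfolded orbits_eq_image]] unfolding W_def .
  qed
  ultimately have "of_nat (index G N) \<le> (of_nat (card (orbit ?N (vact C.Y) ` (c ` W))) * of_nat ?k :: ennreal)"
    by (metis of_nat_le_iff of_nat_mult)
  then show ?thesis using le by (rule order_trans)
qed

end

theorem proposition4p1:
  fixes G :: "('a, 'b) monoid_scheme"
    and X :: "('a, 'v, 'e) graph_action"
    and v :: 'v
  assumes "group G"
    and "torsion_free G"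
    and "one_ended G"
    and "hyperbolic_group G"
    and "cyclic_splitting G X"
    and "v \<in> vertices X"
    and "free_group (G\<lparr>carrier := vertex_group G X v\<rparr>)"
    and "\<not> comm_group (G\<lparr>carrier := vertex_group G X v\<rparr>)"
  shows "V1_hyp G > 0"
proof -
  interpret group G by fact
  interpret X: tree_action G X
    using assms(5) by unfold_locales (simp add: cyclic_splitting_def)
  let ?Gv = "vertex_group G X v"
  have v: "v \<in> vertices X" by fact
  obtain S0 where S0: "finite S0" "generates G S0"
    using assms(4) unfolding hyperbolic_group_def by blast
  have cyc: "infinite_cyclic (G\<lparr>carrier := edge_group G X e\<rparr>)" if "e \<in> edges X" for e
    using assms(5) that by (simp add: cyclic_splitting_def)
  obtain S where S: "presented_by (G\<lparr>carrier := ?Gv\<rparr>) S {}"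
    using assms(7) by (auto simp: free_group_def)
  interpret F: free_basis "G\<lparr>carrier := ?Gv\<rparr>" S
    by (intro free_basis.intro free_basis_axioms.intro subgroup_imp_group[OF X.vertex_group_subgroup[OF v]] S)
  obtain a b where ab: "a \<in> S" "b \<in> S" "a \<noteq> b"
    using F.basis_two_elements[OF assms(8)] .
  have "\<exists>Z. finite Z \<and> generates (G\<lparr>carrier := edge_group G X e\<rparr>) Z" if e: "e \<in> edges X" for e
    using group.cyclic_fg cyc[OF e] by (auto simp: infinite_cyclic_def)
  then obtain Z where "finite Z" "generates (G\<lparr>carrier := ?Gv\<rparr>) Z"
    using X.vertex_group_fg[OF S0 _ v] by blast
  \<comment> \<open>A finite basis is used both for finite presentability of the weighted groups and
    for the finiteness of quotients of the Cayley tree.\<close>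
  then have finS: "finite S" by (rule F.finite_basis)
  \<comment> \<open>If \<open>v\<close> were fixed by all of \<open>G\<close>, then \<open>G\<close>
    itself would be free on at least two generators and not one-ended.\<close>
  have "\<exists>g \<in> carrier G. vact X g v \<noteq> v"
  proof (rule ccontr)
    assume "\<not> (\<exists>g \<in> carrier G. vact X g v \<noteq> v)"
    then have "?Gv = carrier G" by (auto simp: stabilizer_def)
    then show False using F.not_one_ended[OF ab] assms(3) by simp
  qed
  then obtain g0 where g0: "g0 \<in> carrier G" "vact X g0 v \<noteq> v" by blast
  \<comment> \<open>Passing to this subtree makes labels in \<open>nat\<close> possible and the
    number of orbits finite, while the stabilizers of \<open>v\<close> and of the remaining edges
    are unchanged.\<close>
  obtain V' E' where Y: "splitting G (sub_action X V' E')" "v \<in> V'" "V' \<subseteq> vertices X" "E' \<subseteq> edges X"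
    "countable V'" "countable E'" "finite (orbits G V' (vact X))"
    using X.cofinite_subtree[OF S0 v] .
  define Y where "Y = sub_action X V' E'"
  interpret Y: tree_action G Y unfolding Y_def by unfold_locales (rule Y(1))
  have sel: "vertices Y = V'" "edges Y = E'" by (simp_all add: Y_def sub_action_def)
  have vact: "vact Y g x = vact X g x" if "x \<in> V'" for g x using that by (simp add: Y_def sub_action_def)
  have eact: "eact Y g e = eact X g e" if "e \<in> E'" for g e using that by (simp add: Y_def sub_action_def)
  have vg: "vertex_group G Y v = ?Gv" using vact[OF Y(2)] by (simp add: stabilizer_def)
  have eg: "edge_group G Y e = edge_group G X e" if "e \<in> E'" for e using eact[OF that] by (simp add: stabilizer_def)
  have "orbits G V' (vact Y) = orbits G V' (vact X)"
    unfolding orbits_eq_image by (intro image_cong refl) (simp add: orbit_def vact)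
  then have fin: "finite (orbits G (vertices Y) (vact Y))" using Y(7) sel by simp
  have free: "Y.free_vertex v"
    unfolding Y.free_vertex_def sel vg using finS ab S Y(2) by blast
  have "1 \<le> V1_hyp G"
    unfolding V1_hyp_def
  proof (rule normal_limsup_lower_bound[OF S0])
    fix N assume N: "N \<in> fin_index_normal G"
    have "of_nat (index G N) \<le> C_max_cyclic (hyp_weight G) (G\<lparr>carrier := N\<rparr>)"
    proof (rule Y.C_max_cyclic_lower_bound[OF _ _ fin _ free g0(1) _ N])
      show "infinite_cyclic (G\<lparr>carrier := edge_group G Y e\<rparr>)" if "e \<in> edges Y" for e
        using cyc[of e] eg[of e] that Y(4) sel by auto
    qed (use Y(2,5,6) sel g0(2) vact in simp_all)
    then have "of_nat (index G N) / of_nat (index G N) \<le>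
        C_max_cyclic (hyp_weight G) (G\<lparr>carrier := N\<rparr>) / of_nat (index G N)"
      by (rule divide_right_mono_ennreal)
    \<comment> \<open>The index is positive and finite, so cancelling it in \<open>ennreal\<close>
      is legitimate and yields the uniform bound 1.\<close>
    moreover have "of_nat (index G N) / of_nat (index G N) = (1 :: ennreal)"
      by (rule ennreal_divide_self[OF _ of_nat_less_top]) (use fin_index_normalD(4)[OF N] in simp)
    ultimately show "1 \<le> C_max_cyclic (hyp_weight G) (G\<lparr>carrier := N\<rparr>) / of_nat (index G N)" by simp
  qed
  then show ?thesis using less_le_trans[OF zero_less_one] by blast
qed

end
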